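(* Let $T_0:I\to I$, $I=[0,1]$, be a piecewise $C^2$ uniformly expanding map with boundary point $b\in(0,1)$, invariant intervals $I_l=[0,b]$, $I_r=[b,1]$, satisfying (I1)--(I4), and let $(T_\epsilon)_{\epsilon>0}$ be a family of $C^2$-small perturbations of $T_0$ satisfying (P1)--(P2), all as spelled out in the context. Let $\phi_l,\phi_r$ be the densities of the unique absolutely continuous invariant probability measures $\mu_l,\mu_r$ of $T_0|_{I_l}$, $T_0|_{I_r}$, and let $\phi_\epsilon$ be the density of the unique absolutely continuous invariant probability measure of $T_\epsilon$. Let $H_{l,\epsilon}=I_l\cap T_\epsilon^{-1}(I_r)$ and $H_{r,\epsilon}=I_r\cap T_\epsilon^{-1}(I_l)$, suppose that $\mu_l(H_{l,\epsilon})>0$ for (small) $\epsilon>0$, and suppose that the limit $$l.h.r.=\lim_{\epsilon\to0}\frac{\mu_r(H_{r,\epsilon})}{\mu_l(H_{l,\epsilon})}\in[0,+\infty]$$ exists. Then, as $\epsilon\to 0$, $$\phi_\epsilon\longrightarrow \alpha\phi_l+(1-\alpha)\phi_r\quad\text{in } L^1,$$ where $\alpha\in[0,1]$ is determined by $\frac{\alpha}{1-\alpha}=l.h.r.$ (with $\alpha=1$ if $l.h.r.=+\infty$).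
   Context: Basic notions. $I=[0,1]$; $L^1=L^1(I,\mathrm{Leb})$ with norm $|f|_{L^1}=\int_I|f|\,dx$. A map $T:I\to I$ is piecewise $C^2$ with critical set $\mathcal C=\{0=c_0<c_1<\dots<c_d=1\}$ if for each $i$, $T|_{(c_i,c_{i+1})}$ extends to a $C^2$ function on a neighborhood of $[c_i,c_{i+1}]$. It is uniformly expanding if its minimum expansion $\inf_{x\in I\setminus\mathcal C}|T'(x)|$ is greater than $1$. At a critical point where $T$ is discontinuous, $T$ is considered bi-valued: $T(c_i)$ consists of both one-sided limits $T(c_{i-})$ and $T(c_{i+})$; images $T^k\mathcal C$ and preimages are understood accordingly. Restrictions of $T$ to a closed interval $[a,b']$ use the values $T(a_+)$ and $T(b'_-)$ at the endpoints. ACIM means absolutely continuous (with respect to Lebesgue measure) invariant probability measure. Every function of bounded variation is represented by its version with $f(x)=\frac12\big(f(x^-)+f(x^+)\big)$ at each interior point $x$ (and the one-sided limit at $0$ and $1$). Unperturbed map. $T_0:I\to I$ is piecewise $C^2$ and uniformly expanding with critical set $\mathcal C_0=\{0=c_{0,0}<\dots<c_{d,0}=1\}$. There is $b\in(0,1)$ such that $I_l=[0,b]$ and $I_r=[b,1]$ satisfy $T_0|_{I_*}(I_* )\subset I_*$ for $*\in\{l,r\}$. The set of infinitesimal holes is $H_0=T_0^{-1}\{b\}\setminus\{b\}$. Assumptions: (I1) For $*\in\{l,r\}$, $T_0|_{I_*}$ has exactly one ACIM $\mu_*$, with density $\phi_*=d\mu_*/dx$ (of bounded variation; regarded as a function on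 $I$ vanishing outside $I_*$). (I2) For every $k>0$, $(T_0^k\mathcal C_0)\cap H_0=\emptyset$. (I3) $\phi_l>0$ at each point of $H_0\cap I_l$, and $\phi_r>0$ at each point of $H_0\cap I_r$. (I4) Either (a) $\inf_{x\in I\setminus\mathcal C_0}|T_0'(x)|>2$, or (b) $T_0$ has no periodic critical points, except possibly that $0$ or $1$ may be fixed points. Here $c\in\mathcal C_0$ is periodic if $c\in T_0^n(c)$ for some $n>0$ (with $T_0$ possibly bi-valued). Perturbations. $T_\epsilon:I\to I$, $\epsilon>0$, are $C^2$-small perturbations of $T_0$: a critical set for $T_\epsilon$ may be chosen as $\mathcal C_\epsilon=\{0=c_{0,\epsilon}<\dots<c_{d,\epsilon}=1\}$ (same $d$), where each $\epsilon\mapsto c_{i,\epsilon}$ is $C^2$ for $\epsilon\ge0$; and there is $\delta>0$ such that for all sufficiently small $\epsilon$ and each $i$ there is a $C^2$ extension $\hat T_{i,\epsilon}:[c_{i,0}-\delta,c_{i+1,0}+\delta]\to\mathbb R$ of $T_\epsilon|_{[c_{i,\epsilon},c_{i+1,\epsilon}]}$, with $\hat T_{i,\epsilon}\to\hat T_{i,0}$ in the $C^2$ topology as $\epsilon\to0$. Assumptions: (P1) For $\epsilon>0$, $T_\epsilon$ has exactly one ACIM $\mu_\epsilon$, with density $\phi_\epsilon=d\mu_\epsilon/dx$. (P2) If $b\notin\mathcal C_0$ (in which case necessarily $T_0(b)=b$), then $T_\epsilon(b)=b$ for all $\epsilon>0$. If $b\in\mathcal C_0$, then $T_0(b_-)<b<T_0(b_+)$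 and $b\in\mathcal C_\epsilon$ for all $\epsilon$. *)

theory Defs
  imports "HOL-Probability.Probability"
begin

definition C2_derivs :: "real set \<Rightarrow> (real \<Rightarrow> real) \<Rightarrow> (real \<Rightarrow> real) \<Rightarrow> (real \<Rightarrow> real) \<Rightarrow> bool" where
  "C2_derivs S f f' f'' \<longleftrightarrow>
     (\<forall>x\<in>S. (f has_real_derivative f' x) (at x within S)) \<and>
     (\<forall>x\<in>S. (f' has_real_derivative f'' x) (at x within S)) \<and>
     continuous_on S f''"

definition C2_on :: "real set \<Rightarrow> (real \<Rightarrow> real) \<Rightarrow> bool" where
  "C2_on S f \<longleftrightarrow> (\<exists>f' f''. C2_derivs S f f' f'')"

definition C2_limit ::
  "real set \<Rightarrow> ('p \<Rightarrow> real \<Rightarrow> real) \<Rightarrow> (real \<Rightarrow> real) \<Rightarrow> 'p filter \<Rightarrow> bool" where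
  "C2_limit S F f Fl \<longleftrightarrow>
     (\<exists>F' F'' f' f''.
        C2_derivs S f f' f'' \<and>
        (\<forall>\<^sub>F p in Fl. C2_derivs S (F p) (F' p) (F'' p)) \<and>
        uniform_limit S F f Fl \<and>
        uniform_limit S F' f' Fl \<and>
        uniform_limit S F'' f'' Fl)"

text \<open>
  The critical points are \<open>c 0 < \<dots> < c d\<close>. A map is an ordinary function
  \<open>T\<close> whose values at critical points are arbitrary points of the unit interval; they are
  never used, since \<open>mvals\<close> below replaces them by the one-sided limits.
\<close>

definition crit :: "nat \<Rightarrow> (nat \<Rightarrow> real) \<Rightarrow> real set" where
  "crit d c = c ` {..d}"

definition piecewise_C2 :: "nat \<Rightarrow> (nat \<Rightarrow> real) \<Rightarrow> (real \<Rightarrow> real) \<Rightarrow> bool" where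
  "piecewise_C2 d c T \<longleftrightarrow>
     c 0 = 0 \<and> c d = 1 \<and> (\<forall>i<d. c i < c (Suc i)) \<and>
     (\<forall>x\<in>{0..1}. T x \<in> {0..1}) \<and>
     (\<forall>i<d. \<exists>U g. open U \<and> {c i..c (Suc i)} \<subseteq> U \<and> C2_on U g \<and>
        (\<forall>x\<in>{c i<..<c (Suc i)}. T x = g x))"

definition min_expansion :: "real set \<Rightarrow> (real \<Rightarrow> real) \<Rightarrow> real" where
  "min_expansion C T = (INF x\<in>{0..1} - C. \<bar>deriv T x\<bar>)"

text \<open>
  The set of values at \<open>x\<close> of the restriction of \<open>T\<close> to \<open>{p..q}\<close>: at a
  critical point or an endpoint, the one-sided limits from within \<open>{p..q}\<close> (two
  different ones exactly at an interior point of discontinuity, so a critical point at which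
  the two limits agree has one value). The map on the whole unit interval is the case
  \<open>p = 0\<close>, \<open>q = 1\<close>.
\<close>

definition mvals :: "real set \<Rightarrow> (real \<Rightarrow> real) \<Rightarrow> real \<Rightarrow> real \<Rightarrow> real \<Rightarrow> real set" where
  "mvals C T p q x =
     (if x \<in> C \<or> x = p \<or> x = q
      then {y. (p < x \<and> (T \<longlongrightarrow> y) (at_left x)) \<or> (x < q \<and> (T \<longlongrightarrow> y) (at_right x))}
      else {T x})"

definition mimage :: "real set \<Rightarrow> (real \<Rightarrow> real) \<Rightarrow> real set \<Rightarrow> real set" where
  "mimage C T A = (\<Union>x\<in>A. mvals C T 0 1 x)"

definition mpreimage :: "real set \<Rightarrow> (real \<Rightarrow> real) \<Rightarrow> real set \<Rightarrow> real set" where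
  "mpreimage C T A = {x\<in>{0..1}. mvals C T 0 1 x \<inter> A \<noteq> {}}"

definition invariant_interval :: "real set \<Rightarrow> (real \<Rightarrow> real) \<Rightarrow> real \<Rightarrow> real \<Rightarrow> bool" where
  "invariant_interval C T p q \<longleftrightarrow> (\<forall>x\<in>{p..q}. mvals C T p q x \<subseteq> {p..q})"

definition inf_holes :: "real set \<Rightarrow> (real \<Rightarrow> real) \<Rightarrow> real \<Rightarrow> real set" where
  "inf_holes C T b = mpreimage C T {b} - {b}"

definition periodic_point :: "real set \<Rightarrow> (real \<Rightarrow> real) \<Rightarrow> real \<Rightarrow> bool" where
  "periodic_point C T x \<longleftrightarrow> (\<exists>n>0. x \<in> (mimage C T ^^ n) {x})"

text \<open>
  Measures on \<open>S\<close> are represented as Borel measures on the line giving full mass to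
  \<open>S\<close>. The values of \<open>T\<close> at the finitely many critical points and endpoints do
  not matter for invariance, as an absolutely continuous measure has no atoms.
\<close>

definition acim :: "(real \<Rightarrow> real) \<Rightarrow> real set \<Rightarrow> real measure \<Rightarrow> bool" where
  "acim T S \<mu> \<longleftrightarrow>
     prob_space \<mu> \<and> sets \<mu> = sets borel \<and> measure \<mu> S = 1 \<and>
     absolutely_continuous lborel \<mu> \<and>
     (\<forall>A\<in>sets borel. emeasure \<mu> (T -` A \<inter> S) = emeasure \<mu> A)"

definition has_density :: "real measure \<Rightarrow> real set \<Rightarrow> (real \<Rightarrow> real) \<Rightarrow> bool" where
  "has_density \<mu> S \<phi> \<longleftrightarrow>
     \<phi> \<in> borel_measurable borel \<and> (\<forall>x. 0 \<le> \<phi> x) \<and> (\<forall>x. x \<notin> S \<longrightarrow> \<phi> x = 0) \<and>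
     \<mu> = density lborel (\<lambda>x. ennreal (\<phi> x))"

definition bounded_variation_on :: "real set \<Rightarrow> (real \<Rightarrow> real) \<Rightarrow> bool" where
  "bounded_variation_on S f \<longleftrightarrow>
     (\<exists>B. \<forall>n (t::nat \<Rightarrow> real). (\<forall>i\<le>n. t i \<in> S) \<and> (\<forall>i<n. t i \<le> t (Suc i)) \<longrightarrow>
        (\<Sum>i<n. \<bar>f (t (Suc i)) - f (t i)\<bar>) \<le> B)"

text \<open>
  Fixes the pointwise values of a density, on which its positivity at the holes depends.
\<close>

definition normalized_BV :: "(real \<Rightarrow> real) \<Rightarrow> bool" where
  "normalized_BV f \<longleftrightarrow>
     bounded_variation_on {0..1} f \<and>
     (\<forall>x\<in>{0<..<1}. \<exists>u v. (f \<longlongrightarrow> u) (at_left x) \<and> (f \<longlongrightarrow> v) (at_right x) \<and> f x = (u + v) / 2) \<and>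
     (f \<longlongrightarrow> f 0) (at_right 0) \<and> (f \<longlongrightarrow> f 1) (at_left 1)"

text \<open>
  The family is indexed by \<open>\<epsilon> \<ge> 0\<close>, with the unperturbed map at
  \<open>\<epsilon> = 0\<close>; \<open>c i \<epsilon>\<close> is the \<open>i\<close>-th critical point of
  \<open>T \<epsilon>\<close>. Agreement of \<open>E i \<epsilon>\<close> with \<open>T \<epsilon>\<close> on the
  open interval determines, by continuity, the one-sided values at its endpoints.
\<close>

definition C2_small_perturbations ::
  "nat \<Rightarrow> (nat \<Rightarrow> real \<Rightarrow> real) \<Rightarrow> (real \<Rightarrow> real \<Rightarrow> real) \<Rightarrow> bool" where
  "C2_small_perturbations d c T \<longleftrightarrow>
     (\<forall>\<epsilon>>0. piecewise_C2 d (\<lambda>i. c i \<epsilon>) (T \<epsilon>)) \<and>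
     (\<forall>i\<le>d. C2_on {0..} (c i)) \<and>
     (\<exists>\<delta>>0. \<exists>\<epsilon>\<^sub>0>0. \<exists>E :: nat \<Rightarrow> real \<Rightarrow> real \<Rightarrow> real. \<forall>i<d.
        (\<forall>\<epsilon>\<in>{0..<\<epsilon>\<^sub>0}.
           {c i \<epsilon>..c (Suc i) \<epsilon>} \<subseteq> {c i 0 - \<delta>..c (Suc i) 0 + \<delta>} \<and>
           C2_on {c i 0 - \<delta>..c (Suc i) 0 + \<delta>} (E i \<epsilon>) \<and>
           (\<forall>x\<in>{c i \<epsilon><..<c (Suc i) \<epsilon>}. E i \<epsilon> x = T \<epsilon> x)) \<and>
        C2_limit {c i 0 - \<delta>..c (Suc i) 0 + \<delta>} (E i) (E i 0) (at_right 0))"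

end

theory Submission
  imports Defs "HOL-Complex_Analysis.Great_Picard"
begin

text \<open>
  A density \<open>f\<close> is controlled by an estimate \<open>f y \<le> exp (D * \<bar>y - x\<bar>) * f x + J [x, y]\<close>, where \<open>J\<close> is a
  finite sum of point masses bounding the jumps of \<open>f\<close>. The transfer operator preserves such estimates:
  the exponential factor survives because the branches expand with bounded distortion, every jump is
  moved by the map and shrinks by the expansion factor, and new jumps appear only at one-sided images of
  critical points, with a size given by the density near the critical point. With a weight that absorbs
  the doubling of jumps close to critical points (here (I4) enters), the total size of the jumps stays
  bounded, uniformly in the iterate and in \<open>\<epsilon>\<close>. Hence the invariant densities are uniformly bounded and
  precompact in \<open>L\<^sup>1\<close>, and they oscillate little away from the images of the critical points under few
  iterates. A limit of \<open>\<phi> \<epsilon>\<close> is invariant under \<open>T 0\<close>, so it is \<open>\<alpha> * \<phi>l + (1 - \<alpha>) * \<phi>r\<close>. By (I2) the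
  images of critical points stay away from the infinitesimal holes, so near these \<open>\<phi> \<epsilon>\<close> is even
  uniformly close to its limit. Invariance of \<open>\<mu> \<epsilon>\<close> gives both holes the same mass, and comparing the
  two masses with \<open>\<alpha> * \<mu>l\<close> and \<open>(1 - \<alpha>) * \<mu>r\<close> of the holes determines \<open>\<alpha>\<close>.
\<close>

subsection \<open>Functions with controlled jumps\<close>

text \<open>The classical bound on variation needs expansion greater than 2; below that one passes
  to an iterate. For a family this fails: the monotonicity intervals of an iterate of the perturbed
  map can shrink to a point as the parameter tends to 0, and the constants degenerate. Hence only
  single steps are estimated, and the iterates are hidden in the weight on jump positions, which
  depends on the parameter while its bounds do not. The number 2 comes from a jump next to a
  critical point, which counts once for its own image and once for the cut it helps to bound. A
  second obstacle: convergence in L^1 says nothing about the holes, whose measure tends to 0. The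
  densities have to be close at each hole relative to their size there. This calls for pointwise
  bounds, for a limit density bounded below by (I3), and for (P2), which rules out holes next to
  \<open>b\<close>. The bounds hold at every point for iterates of an explicit function, whereas an
  invariant density is known only almost everywhere. Averages of iterates and the uniqueness of the
  invariant measure lead from one to the other.\<close>

text \<open>
  Jumps are recorded as lists of pairs (position, size); \<open>jint J g\<close> is the integral of \<open>g\<close> against
  the corresponding sum of point masses.
\<close>

definition jint :: "(real \<times> real) list \<Rightarrow> (real \<Rightarrow> real) \<Rightarrow> real" where
  "jint J g = (\<Sum>a\<leftarrow>J. snd a * g (fst a))"

definition jumps_ok :: "real set \<Rightarrow> (real \<times> real) list \<Rightarrow> bool" where
  "jumps_ok S J \<longleftrightarrow> (\<forall>a\<in>set J. fst a \<in> S \<and> 0 \<le> snd a)"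

lemma jint_simps [simp]:
  "jint [] g = 0" "jint (a # J) g = snd a * g (fst a) + jint J g"
  "jint (J @ J') g = jint J g + jint J' g"
  by (simp_all add: jint_def)

lemma jint_concat: "jint (concat (map J xs)) g = (\<Sum>i\<leftarrow>xs. jint (J i) g)"
  by (induction xs) auto

lemma jint_concat_upt: "jint (concat (map J [0..<d])) g = (\<Sum>i<d. jint (J i) g)"
  by (simp add: jint_concat sum_list_distinct_conv_sum_set atLeast0LessThan)

lemma jint_add: "jint J (\<lambda>x. g x + h x) = jint J g + jint J h"
  by (induction J) (auto simp: algebra_simps)

lemma jint_cmult: "jint J (\<lambda>x. k * g x) = k * jint J g"
  by (induction J) (auto simp: algebra_simps)

lemma jint_sum: "jint J (\<lambda>x. \<Sum>i\<in>I. g i x) = (\<Sum>i\<in>I. jint J (g i))"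
  by (induction J) (auto simp: sum.distrib sum_distrib_left)

lemma jint_mono:
  assumes "jumps_ok S J" "\<And>x. x \<in> S \<Longrightarrow> g x \<le> h x"
  shows "jint J g \<le> jint J h"
  using assms(1) unfolding jint_def jumps_ok_def
  by (intro sum_list_mono) (auto intro!: mult_left_mono assms(2))

lemma jint_nonneg:
  assumes "jumps_ok S J" "\<And>x. x \<in> S \<Longrightarrow> 0 \<le> g x"
  shows "0 \<le> jint J g"
  using jint_mono[OF assms(1), of "\<lambda>_. 0" g] assms(2) by (auto simp: jint_def)

lemma jint_cong:
  assumes "\<And>a. a \<in> set J \<Longrightarrow> g (fst a) = h (fst a)"
  shows "jint J g = jint J h"
  using assms unfolding jint_def by (auto intro!: arg_cong[of _ _ sum_list])

lemma jint_map: "jint (map (\<lambda>a. (E (fst a), snd a / l)) J) g = jint J (\<lambda>x. g (E x)) / l"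
  by (induction J) (auto simp: add_divide_distrib)

lemma jint_filter: "jint (filter (\<lambda>a. P (fst a)) J) g = jint J (\<lambda>x. if P x then g x else 0)"
  by (induction J) auto

lemma jumps_ok_append [simp]: "jumps_ok S (J @ J') \<longleftrightarrow> jumps_ok S J \<and> jumps_ok S J'"
  by (auto simp: jumps_ok_def)

text \<open>With \<open>J\<close> empty and \<open>f\<close> positive this says that the logarithm
  of \<open>f\<close> is \<open>D\<close>-Lipschitz. Both orders of \<open>x\<close> and
  \<open>y\<close> are covered, and \<open>x\<close> may lie where \<open>f\<close> vanishes; so the
  ends of the support must be paid for by jumps as well, and the jumps between \<open>y\<close> and
  any zero of \<open>f\<close> bound \<open>f y\<close>.\<close>

definition reg :: "real \<Rightarrow> (real \<Rightarrow> real) \<Rightarrow> (real \<times> real) list \<Rightarrow> bool" where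
  "reg D f J \<longleftrightarrow>
     (\<forall>x y. f y \<le> exp (D * \<bar>y - x\<bar>) * f x + jint J (indicator (closed_segment x y)))"

lemma regD: "reg D f J \<Longrightarrow> f y \<le> exp (D * \<bar>y - x\<bar>) * f x + jint J (indicator (closed_segment x y))"
  by (auto simp: reg_def)

lemma reg_sum:
  assumes "\<And>i. i < d \<Longrightarrow> reg D (f i) (J i)"
  shows "reg D (\<lambda>x. \<Sum>i<d. f i x) (concat (map J [0..<d]))"
  unfolding reg_def jint_concat_upt
proof (intro allI)
  fix x y
  have "(\<Sum>i<d. f i y) \<le> (\<Sum>i<d. exp (D * \<bar>y - x\<bar>) * f i x + jint (J i) (indicator (closed_segment x y)))"
    by (intro sum_mono regD assms) auto
  then show "(\<Sum>i<d. f i y) \<le> exp (D * \<bar>y - x\<bar>) * (\<Sum>i<d. f i x) + (\<Sum>i<d. jint (J i) (indicator (closed_segment x y)))"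
    by (simp add: sum.distrib sum_distrib_left)
qed

text \<open>\<open>b1\<close> and \<open>b2\<close> stand for bounds on the one-sided values at the
  two ends, corrected by the jumps met on the way from the end to \<open>z\<close>. When
  \<open>x\<close> lies beyond an end and \<open>y\<close> inside, the segment contains that end,
  and the jump placed there together with the jumps of \<open>J\<close> up to \<open>y\<close> pays
  for \<open>f y\<close>.\<close>

lemma reg_restrict:
  assumes f: "reg D f J" "\<And>x. 0 \<le> f x" and J: "jumps_ok S J" and b: "0 \<le> b1" "0 \<le> b2"
    and b1: "\<And>z. p < z \<Longrightarrow> z < q \<Longrightarrow> f z \<le> b1 + jint J (indicator {p<..z})"
    and b2: "\<And>z. p < z \<Longrightarrow> z < q \<Longrightarrow> f z \<le> b2 + jint J (indicator {z..<q})"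
  shows "reg D (\<lambda>x. if p < x \<and> x < q then f x else 0)
    (filter (\<lambda>a. p < fst a \<and> fst a < q) J @ [(p, b1), (q, b2)])"
  unfolding reg_def
proof (intro allI)
  fix x y :: real
  let ?f = "\<lambda>x. if p < x \<and> x < q then f x else 0"
  let ?J = "filter (\<lambda>a. p < fst a \<and> fst a < q) J @ [(p, b1), (q, b2)]"
  let ?I = "indicator (closed_segment x y) :: real \<Rightarrow> real"
  have eq: "jint ?J ?I = jint J (\<lambda>r. if p < r \<and> r < q then ?I r else 0) + b1 * ?I p + b2 * ?I q"
    by (simp add: jint_filter[of "\<lambda>r. p < r \<and> r < q" J])
  have nn: "0 \<le> jint J (\<lambda>r. if p < r \<and> r < q then ?I r else 0)"
    by (rule jint_nonneg[OF J]) auto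
  have nn1: "0 \<le> b1 * ?I p" "0 \<le> b2 * ?I q" using b by auto
  show "?f y \<le> exp (D * \<bar>y - x\<bar>) * ?f x + jint ?J ?I"
  proof (cases "p < y \<and> y < q")
    case False
    have "0 \<le> exp (D * \<bar>y - x\<bar>) * ?f x" using f(2) by auto
    then show ?thesis using False eq nn nn1 by auto
  next
    case y: True
    consider "p < x" "x < q" | "x \<le> p" | "q \<le> x" by linarith
    then show ?thesis
    proof cases
      case 1
      have "jint J ?I = jint J (\<lambda>r. if p < r \<and> r < q then ?I r else 0)"
        by (rule jint_cong) (use 1 y in \<open>auto simp: indicator_def closed_segment_eq_real_ivl split: if_splits\<close>)
      then show ?thesis using regD[OF f(1), of y x] eq nn1 1 y by auto
    next
      case 2
      have "jint J (indicator {p<..y}) \<le> jint J (\<lambda>r. if p < r \<and> r < q then ?I r else 0)"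
        by (rule jint_mono[OF J]) (use 2 y in \<open>auto simp: indicator_def closed_segment_eq_real_ivl split: if_splits\<close>)
      moreover have "?I p = 1" using 2 y by (auto simp: indicator_def closed_segment_eq_real_ivl)
      ultimately show ?thesis using b1[of y] y eq nn1 2 by auto
    next
      case 3
      have "jint J (indicator {y..<q}) \<le> jint J (\<lambda>r. if p < r \<and> r < q then ?I r else 0)"
        by (rule jint_mono[OF J]) (use 3 y in \<open>auto simp: indicator_def closed_segment_eq_real_ivl split: if_splits\<close>)
      moreover have "?I q = 1" using 3 y by (auto simp: indicator_def closed_segment_eq_real_ivl)
      ultimately show ?thesis using b2[of y] y eq nn1 3 by auto
    qed
  qed
qed

subsection \<open>A single expanding branch\<close>

locale branch =
  fixes p q :: real and E E' :: "real \<Rightarrow> real" and lam K :: real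
  assumes pq: "p < q"
    and der: "\<And>x. x \<in> {p..q} \<Longrightarrow> (E has_real_derivative E' x) (at x)"
    and lam: "1 < lam"
    and expand: "\<And>x. x \<in> {p..q} \<Longrightarrow> lam \<le> \<bar>E' x\<bar>"
    and K: "0 \<le> K"
    and lip: "\<And>x y. x \<in> {p..q} \<Longrightarrow> y \<in> {p..q} \<Longrightarrow> \<bar>E' x - E' y\<bar> \<le> K * \<bar>x - y\<bar>"
begin

lemma cont: "continuous_on {p..q} E"
  by (rule DERIV_continuous_on) (use der in \<open>auto intro: has_field_derivative_at_within\<close>)

lemma cont': "continuous_on {p..q} E'"
proof (rule lipschitz_on_continuous_on[of K])
  show "K-lipschitz_on {p..q} E'"
    by (rule lipschitz_onI) (use lip K in \<open>auto simp: dist_real_def\<close>)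
qed

lemma sign: "(\<forall>x\<in>{p..q}. lam \<le> E' x) \<or> (\<forall>x\<in>{p..q}. E' x \<le> - lam)"
proof (rule ccontr)
  assume "\<not> ?thesis"
  then obtain x y where xy: "x \<in> {p..q}" "y \<in> {p..q}" "E' x < lam" "E' y > - lam" by force
  then have "E' x \<le> - lam" "E' y \<ge> lam" using expand[of x] expand[of y] lam by auto
  moreover have "connected (E' ` {p..q})" by (intro connected_continuous_image cont') auto
  ultimately have "0 \<in> E' ` {p..q}" using xy lam
    using connected_contains_Icc[of "E' ` {p..q}" "E' x" "E' y"] by auto
  then show False using expand lam by fastforce
qed

lemma mono_cases:
  obtains (inc) "\<And>x y. x \<in> {p..q} \<Longrightarrow> y \<in> {p..q} \<Longrightarrow> x \<le> y \<Longrightarrow> lam * (y - x) \<le> E y - E x"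
  | (dec) "\<And>x y. x \<in> {p..q} \<Longrightarrow> y \<in> {p..q} \<Longrightarrow> x \<le> y \<Longrightarrow> lam * (y - x) \<le> E x - E y"
proof -
  have mvt: "\<exists>z. x < z \<and> z < y \<and> E y - E x = (y - x) * E' z" if "x \<in> {p..q}" "y \<in> {p..q}" "x < y" for x y
    using that by (intro MVT2) (auto intro!: der)
  from sign consider "\<forall>x\<in>{p..q}. lam \<le> E' x" | "\<forall>x\<in>{p..q}. E' x \<le> - lam" by blast
  then show thesis
  proof cases
    case 1
    show thesis
    proof (rule inc)
      fix x y assume xy: "x \<in> {p..q}" "y \<in> {p..q}" "x \<le> y"
      show "lam * (y - x) \<le> E y - E x"
      proof (cases "x = y")
        case False
        then obtain z where "x < z" "z < y" "E y - E x = (y - x) * E' z" using mvt[of x y] xy by auto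
        moreover have "lam \<le> E' z" using 1 xy \<open>x < z\<close> \<open>z < y\<close> by auto
        ultimately show ?thesis using xy by (simp add: mult.commute mult_left_mono)
      qed auto
    qed
  next
    case 2
    show thesis
    proof (rule dec)
      fix x y assume xy: "x \<in> {p..q}" "y \<in> {p..q}" "x \<le> y"
      show "lam * (y - x) \<le> E x - E y"
      proof (cases "x = y")
        case False
        then obtain z where z: "x < z" "z < y" "E y - E x = (y - x) * E' z" using mvt[of x y] xy by auto
        moreover have "E' z \<le> - lam" using 2 xy z by auto
        then have "(y - x) * E' z \<le> (y - x) * (- lam)" using xy by (intro mult_left_mono) auto
        ultimately show ?thesis by (simp add: algebra_simps)
      qed auto
    qed
  qed
qed

lemma expansion:
  assumes "x \<in> {p..q}" "y \<in> {p..q}"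
  shows "lam * \<bar>x - y\<bar> \<le> \<bar>E x - E y\<bar>"
proof (cases rule: mono_cases)
  case inc
  show ?thesis using inc[of x y] inc[of y x] assms by (cases "x \<le> y") (auto simp: abs_if)
next
  case dec
  show ?thesis using dec[of x y] dec[of y x] assms by (cases "x \<le> y") (auto simp: abs_if)
qed

lemma inj: "inj_on E {p..q}"
proof (rule inj_onI)
  fix x y assume "x \<in> {p..q}" "y \<in> {p..q}" "E x = E y"
  then have "lam * \<bar>x - y\<bar> \<le> 0" using expansion[of x y] by simp
  then show "x = y" using lam by (simp add: mult_le_0_iff)
qed

lemma segment:
  assumes "u \<in> {p..q}" "v \<in> {p..q}" "r \<in> closed_segment u v"
  shows "E r \<in> closed_segment (E u) (E v)"
proof -
  have r: "r \<in> {p..q}" using assms by (auto simp: closed_segment_eq_real_ivl split: if_splits)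
  have ge: "x \<le> y \<Longrightarrow> 0 \<le> lam * (y - x)" for x y using lam by auto
  show ?thesis
  proof (cases rule: mono_cases)
    case inc
    show ?thesis using assms r ge[of u r] ge[of r v] ge[of v r] ge[of r u] inc[of u r] inc[of r v] inc[of v r] inc[of r u]
      by (auto simp: closed_segment_eq_real_ivl split: if_splits)
  next
    case dec
    show ?thesis using assms r ge[of u r] ge[of r v] ge[of v r] ge[of r u] dec[of u r] dec[of r v] dec[of v r] dec[of r u]
      by (auto simp: closed_segment_eq_real_ivl split: if_splits)
  qed
qed

lemma image: "E ` {p..q} = closed_segment (E p) (E q)"
proof
  show "E ` {p..q} \<subseteq> closed_segment (E p) (E q)"
    using segment[of p q] pq by (auto simp: closed_segment_eq_real_ivl)
  have "connected (E ` {p..q})" by (intro connected_continuous_image cont) auto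
  then have "convex (E ` {p..q})" by (simp add: is_interval_convex is_interval_connected_1)
  then show "closed_segment (E p) (E q) \<subseteq> E ` {p..q}"
    using pq by (intro closed_segment_subset) auto
qed

definition inv_br :: "real \<Rightarrow> real" where
  "inv_br y = (if y \<in> E ` {p..q} then the_inv_into {p..q} E y else p)"

text \<open>Density of the image under \<open>E\<close> of the measure with density \<open>h\<close>.\<close>

definition push :: "(real \<Rightarrow> real) \<Rightarrow> real \<Rightarrow> real" where
  "push h y = (if y \<in> E ` {p..q} then h (inv_br y) / \<bar>E' (inv_br y)\<bar> else 0)"

lemma inv_br_E [simp]: "x \<in> {p..q} \<Longrightarrow> inv_br (E x) = x"
  unfolding inv_br_def by (auto simp: the_inv_into_f_f inj)

lemma push_E: "x \<in> {p..q} \<Longrightarrow> push h (E x) = h x / \<bar>E' x\<bar>"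
  unfolding push_def by auto

lemma push_outside: "y \<notin> E ` {p..q} \<Longrightarrow> push h y = 0"
  unfolding push_def by auto

lemma push_nonneg: "(\<And>x. 0 \<le> h x) \<Longrightarrow> 0 \<le> push h y"
  unfolding push_def by auto

text \<open>Preimages at distance \<open>s\<close> have images at distance at least
  \<open>lam * s\<close>, while the derivative there changes by a factor of at most
  \<open>exp (K * s)\<close>. The exponent \<open>D * s + K * s\<close> is thus absorbed by
  \<open>lam * D * s\<close>, which is what the condition \<open>D + K \<le> lam * D\<close> says.
  Jumps pick up a factor \<open>1 / \<bar>E' v\<bar>\<close>, at most
  \<open>1 / lam\<close>.\<close>

lemma reg_push:
  assumes h: "reg D h J" "\<And>x. 0 \<le> h x" "\<And>x. x \<notin> {p..q} \<Longrightarrow> h x = 0"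
    and J: "jumps_ok {p..q} J" and D: "0 \<le> D" "D + K \<le> lam * D"
  shows "reg D (push h) (map (\<lambda>a. (E (fst a), snd a / lam)) J)"
  unfolding reg_def jint_map
proof (intro allI)
  fix x y
  let ?I = "\<lambda>r. indicator (closed_segment x y) (E r) :: real"
  have nn: "0 \<le> jint J ?I" by (rule jint_nonneg[OF J]) auto
  have E0: "0 < \<bar>E' v\<bar>" if "v \<in> {p..q}" for v using expand[OF that] lam by linarith
  have sub: "jint J (indicator (closed_segment u v)) / \<bar>E' v\<bar> \<le> jint J ?I / lam"
    if "u \<in> {p..q}" "v \<in> {p..q}" "E u \<in> closed_segment x y" "E v = y" for u v
  proof -
    have sub: "E r \<in> closed_segment x y" if "r \<in> closed_segment u v" for r
    proof -
      have "closed_segment (E u) (E v) \<subseteq> closed_segment x y"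
        using \<open>E u \<in> _\<close> \<open>E v = y\<close> by (auto simp: closed_segment_eq_real_ivl split: if_splits)
      then show ?thesis using segment[OF \<open>u \<in> _\<close> \<open>v \<in> _\<close> that] by auto
    qed
    have "jint J (indicator (closed_segment u v)) \<le> jint J ?I"
      by (rule jint_mono[OF J]) (use sub in \<open>auto simp: indicator_def\<close>)
    then have "jint J (indicator (closed_segment u v)) / \<bar>E' v\<bar> \<le> jint J ?I / \<bar>E' v\<bar>"
      by (intro divide_right_mono) auto
    also have "\<dots> \<le> jint J ?I / lam"
      using nn expand[OF \<open>v \<in> _\<close>] lam by (intro divide_left_mono) auto
    finally show ?thesis .
  qed
  have push0: "0 \<le> push h z" for z using h(2) by (rule push_nonneg)
  show "push h y \<le> exp (D * \<bar>y - x\<bar>) * push h x + jint J ?I / lam"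
  proof (cases "y \<in> E ` {p..q}")
    case False
    then show ?thesis using push0[of x] nn lam by (simp add: push_outside)
  next
    case True
    then obtain v where v: "v \<in> {p..q}" "y = E v" by auto
    show ?thesis
    proof (cases "x \<in> E ` {p..q}")
      case True
      then obtain u where u: "u \<in> {p..q}" "x = E u" by auto
      define s where "s = \<bar>v - u\<bar>"
      have s: "lam * s \<le> \<bar>y - x\<bar>" using expansion[OF v(1) u(1)] u v s_def by simp
      have "\<bar>E' u\<bar> \<le> \<bar>E' v\<bar> + K * s" using lip[OF u(1) v(1)] by (simp add: s_def abs_minus_commute)
      also have "\<dots> \<le> \<bar>E' v\<bar> + K * s * \<bar>E' v\<bar>"
        using expand[OF v(1)] lam K mult_left_mono[of 1 "\<bar>E' v\<bar>" "K * s"] s_def by simp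
      also have "\<dots> = \<bar>E' v\<bar> * (1 + K * s)" by (simp add: algebra_simps)
      also have "\<dots> \<le> \<bar>E' v\<bar> * exp (K * s)" by (intro mult_left_mono exp_ge_add_one_self) auto
      finally have r: "1 / \<bar>E' v\<bar> \<le> exp (K * s) / \<bar>E' u\<bar>"
        using E0[OF u(1)] E0[OF v(1)] by (simp add: field_simps)
      have Ds: "D * s + K * s \<le> D * \<bar>y - x\<bar>"
      proof -
        have "D * s + K * s \<le> lam * D * s" using mult_right_mono[OF D(2), of s] s_def by (simp add: algebra_simps)
        also have "\<dots> \<le> D * \<bar>y - x\<bar>" using mult_left_mono[OF s D(1)] by (simp add: algebra_simps)
        finally show ?thesis .
      qed
      have "push h y = h v / \<bar>E' v\<bar>" using v by (simp add: push_E)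
      also have "\<dots> \<le> (exp (D * s) * h u + jint J (indicator (closed_segment u v))) / \<bar>E' v\<bar>"
        using regD[OF h(1), of v u] by (intro divide_right_mono) (auto simp: s_def)
      also have "\<dots> = exp (D * s) * h u * (1 / \<bar>E' v\<bar>) + jint J (indicator (closed_segment u v)) / \<bar>E' v\<bar>"
        by (simp add: add_divide_distrib)
      also have "\<dots> \<le> exp (D * s) * h u * (exp (K * s) / \<bar>E' u\<bar>) + jint J ?I / lam"
        using u v h(2)[of u] by (intro add_mono mult_left_mono r sub) auto
      also have "exp (D * s) * h u * (exp (K * s) / \<bar>E' u\<bar>) = exp (D * s + K * s) * push h x"
        using u by (simp add: push_E exp_add)
      also have "\<dots> \<le> exp (D * \<bar>y - x\<bar>) * push h x"
        using Ds push0 by (intro mult_right_mono) auto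
      finally show ?thesis by simp
    next
      case False
      then have "E p \<in> closed_segment x y \<or> E q \<in> closed_segment x y"
        using v True unfolding image by (auto simp: closed_segment_eq_real_ivl split: if_splits)
      \<comment> \<open>\<open>e\<close> is the end of the branch interval whose image lies between
        \<open>x\<close> and \<open>y\<close>, and \<open>z\<close> is a point beyond
        \<open>e\<close>, where \<open>h\<close> vanishes. Within \<open>{p..q}\<close> the segment
        from \<open>z\<close> to \<open>v\<close> contains no more than the one from
        \<open>e\<close> to \<open>v\<close>, so the jumps between \<open>e\<close> and
        \<open>v\<close> alone bound \<open>h v\<close>.\<close>
      then obtain e z where e: "e \<in> {p..q}" "E e \<in> closed_segment x y" "z \<notin> {p..q}"
          "\<And>r. r \<in> {p..q} \<Longrightarrow> r \<in> closed_segment z v \<Longrightarrow> r \<in> closed_segment e v"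
      proof (elim disjE)
        assume "E p \<in> closed_segment x y"
        then show thesis
          using pq v by (intro that[of p "p - 1"]) (auto simp: closed_segment_eq_real_ivl)
      next
        assume "E q \<in> closed_segment x y"
        then show thesis
          using pq v by (intro that[of q "q + 1"]) (auto simp: closed_segment_eq_real_ivl)
      qed
      have "h v \<le> jint J (indicator (closed_segment z v))"
        using regD[OF h(1), of v z] h(3)[OF e(3)] by simp
      also have "\<dots> \<le> jint J (indicator (closed_segment e v))"
        by (rule jint_mono[OF J]) (use e(4) in \<open>auto simp: indicator_def\<close>)
      finally have "push h y \<le> jint J (indicator (closed_segment e v)) / \<bar>E' v\<bar>"
        using v by (simp add: push_E divide_right_mono)
      also have "\<dots> \<le> jint J ?I / lam" using e v by (intro sub) auto
      finally show ?thesis using False by (simp add: push_outside)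
    qed
  qed
qed

lemma cont_inv: "continuous_on (E ` {p..q}) inv_br"
  by (rule continuous_on_inv[OF cont]) auto

lemma image_borel [measurable]: "E ` {p..q} \<in> sets borel"
  unfolding image closed_segment_eq_real_ivl by auto

lemma push_measurable [measurable]:
  assumes [measurable]: "h \<in> borel_measurable borel"
  shows "push h \<in> borel_measurable borel"
proof -
  have [measurable]: "inv_br \<in> borel_measurable borel"
  proof -
    have "(\<lambda>y. if y \<in> E ` {p..q} then inv_br y else p) \<in> borel_measurable borel"
      by (intro borel_measurable_continuous_on_if cont_inv) auto
    moreover have "(\<lambda>y. if y \<in> E ` {p..q} then inv_br y else p) = inv_br"
      by (auto simp: inv_br_def)
    ultimately show ?thesis by simp
  qed
  have "(\<lambda>x. if x \<in> {p..q} then E' x else 0) \<in> borel_measurable borel"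
    by (intro borel_measurable_continuous_on_if cont') auto
  then have "(\<lambda>y. if y \<in> E ` {p..q} then h (inv_br y) / \<bar>(\<lambda>x. if x \<in> {p..q} then E' x else 0) (inv_br y)\<bar> else 0) \<in> borel_measurable borel"
    by measurable
  moreover have "(\<lambda>y. if y \<in> E ` {p..q} then h (inv_br y) / \<bar>(\<lambda>x. if x \<in> {p..q} then E' x else 0) (inv_br y)\<bar> else 0) = push h"
    by (auto simp: push_def fun_eq_iff)
  ultimately show ?thesis by simp
qed

text \<open>The Jacobian in the change of variables cancels the quotient in \<open>push\<close>. The
  change of variables formula concerns the completed measure, so integrability is carried over to
  \<open>lebesgue\<close> and back.\<close>

lemma push_integral:
  assumes [measurable]: "h \<in> borel_measurable borel" "g \<in> borel_measurable borel"
    and int: "integrable lborel (\<lambda>x. indicator {p..q} x * (g (E x) * h x))"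
  shows "integrable lborel (\<lambda>y. g y * push h y)"
    "(LINT y|lborel. g y * push h y) = (LINT x|lborel. indicator {p..q} x * (g (E x) * h x))"
proof -
  have mE: "(\<lambda>x. indicator {p..q} x * (g (E x) * h x)) \<in> borel_measurable borel"
    using int by auto
  let ?G = "\<lambda>x. \<bar>E' x\<bar> * (g (E x) * push h (E x))"
  have eq: "indicator {p..q} x *\<^sub>R ?G x = indicator {p..q} x * (g (E x) * h x)" for x
    using expand[of x] lam by (auto simp: push_E indicator_def)
  have "set_integrable lebesgue {p..q} ?G"
    unfolding set_integrable_def eq using int by (simp add: integrable_completion)
  moreover have "integral {p..q} ?G = (LINT x|lborel. indicator {p..q} x * (g (E x) * h x))"
    using set_lebesgue_integral_eq_integral(2)[OF calculation]
    unfolding set_lebesgue_integral_def eq by (simp add: integral_completion mE)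
  ultimately have A: "(\<lambda>y. g y * push h y) absolutely_integrable_on (E ` {p..q}) \<and>
      integral (E ` {p..q}) (\<lambda>y. g y * push h y) = (LINT x|lborel. indicator {p..q} x * (g (E x) * h x))"
    using has_absolute_integral_change_of_variables_1'[of "{p..q}" E E' "\<lambda>y. g y * push h y" "LINT x|lborel. indicator {p..q} x * (g (E x) * h x)"]
    using der inj by (auto intro: has_field_derivative_at_within)
  have eq2: "indicator (E ` {p..q}) y *\<^sub>R (g y * push h y) = g y * push h y" for y
    by (auto simp: indicator_def push_outside)
  have m2: "(\<lambda>y. g y * push h y) \<in> borel_measurable lborel" by measurable
  from A have 1: "integrable lebesgue (\<lambda>y. g y * push h y)"
    unfolding set_integrable_def eq2 by simp
  then show "integrable lborel (\<lambda>y. g y * push h y)"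
    using m2 by (simp add: integrable_completion)
  have "(LINT y|lebesgue. g y * push h y) = integral (E ` {p..q}) (\<lambda>y. g y * push h y)"
    using set_lebesgue_integral_eq_integral(2)[OF A[THEN conjunct1]]
    unfolding set_lebesgue_integral_def eq2 .
  then show "(LINT y|lborel. g y * push h y) = (LINT x|lborel. indicator {p..q} x * (g (E x) * h x))"
    using A m2 by (simp add: integral_completion)
qed

end

section \<open>Densities of probability measures as everywhere defined functions\<close>

definition dens :: "real set \<Rightarrow> (real \<Rightarrow> real) \<Rightarrow> bool" where
  "dens S f \<longleftrightarrow> f \<in> borel_measurable borel \<and> (\<forall>x. 0 \<le> f x) \<and> (\<forall>x. x \<notin> S \<longrightarrow> f x = 0) \<and>
     integrable lborel f \<and> (LINT x|lborel. f x) = 1"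

lemma dens_measurable [measurable_dest]: "dens S f \<Longrightarrow> f \<in> borel_measurable borel"
  by (simp add: dens_def)

lemma dens_nonneg: "dens S f \<Longrightarrow> 0 \<le> f x"
  by (simp add: dens_def)

lemma dens_mono: "dens S f \<Longrightarrow> S \<subseteq> S' \<Longrightarrow> dens S' f"
  by (auto simp: dens_def)

text \<open>A density has mass 1, so its mean over the window is at most \<open>1 / (v - u)\<close>;
  averaging the hypothesis over the window replaces the unknown \<open>f x\<close> by that. This
  turns relative estimates into absolute bounds.\<close>

lemma le_average:
  fixes f :: "real \<Rightarrow> real"
  assumes f: "dens S f" and uv: "u < v" and k: "0 \<le> k"
    and le: "\<And>x. u < x \<Longrightarrow> x < v \<Longrightarrow> a \<le> k * f x + m"
  shows "a \<le> k / (v - u) + m"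
proof -
  note [measurable] = dens_measurable[OF f]
  have int: "integrable lborel f" "(LINT x|lborel. f x) = 1" using f by (auto simp: dens_def)
  have i0: "integrable lborel (indicator {u<..<v} :: real \<Rightarrow> real)"
    by (intro integrable_real_indicator) (use uv in auto)
  have "(LINT x|lborel. indicator {u<..<v} x * (a - m)) \<le> (LINT x|lborel. k * f x)"
  proof (rule integral_mono)
    fix x
    show "indicator {u<..<v} x * (a - m) \<le> k * f x"
      using le[of x] k dens_nonneg[OF f, of x] by (auto simp: indicator_def)
  qed (use int i0 in auto)
  then have "(v - u) * (a - m) \<le> k" using int uv by simp
  then show ?thesis using uv by (simp add: field_simps)
qed

subsection \<open>The transfer operator\<close>

locale pw =
  fixes d :: nat and c :: "nat \<Rightarrow> real" and E E' :: "nat \<Rightarrow> real \<Rightarrow> real" and lam K :: real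
  assumes c0: "c 0 = 0" and cd: "c d = 1"
    and c_less: "\<And>i. i < d \<Longrightarrow> c i < c (Suc i)"
    and br: "\<And>i. i < d \<Longrightarrow> branch (c i) (c (Suc i)) (E i) (E' i) lam K"
    and range: "\<And>i x. i < d \<Longrightarrow> x \<in> {c i..c (Suc i)} \<Longrightarrow> E i x \<in> {0..1}"
begin

lemma d_pos: "0 < d" using c0 cd by (cases d) auto

lemma lam1: "1 < lam" and K0: "0 \<le> K"
  using br[OF d_pos] by (auto simp: branch_def)

lemma c_strict: "i < j \<Longrightarrow> j \<le> d \<Longrightarrow> c i < c j"
proof (induction j)
  case (Suc j)
  then show ?case using c_less[of j] by (cases "i = j") auto
qed auto

lemma c_mono: "i \<le> j \<Longrightarrow> j \<le> d \<Longrightarrow> c i \<le> c j"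
  using c_strict[of i j] by (cases "i = j") auto

lemma c_range: "i \<le> d \<Longrightarrow> c i \<in> {0..1}"
  using c_mono[of 0 i] c_mono[of i d] c0 cd by auto

definition gap :: "nat \<Rightarrow> real set" where "gap i = {c i<..<c (Suc i)}"

lemma gap_unique: "i < d \<Longrightarrow> j < d \<Longrightarrow> x \<in> gap i \<Longrightarrow> x \<in> gap j \<Longrightarrow> i = j"
proof (rule ccontr)
  assume *: "i < d" "j < d" "x \<in> gap i" "x \<in> gap j" "i \<noteq> j"
  then consider "Suc i \<le> j" | "Suc j \<le> i" by linarith
  then show False
    using * c_mono[of "Suc i" j] c_mono[of "Suc j" i] by cases (auto simp: gap_def)
qed

lemma gap_disj_crit: "i < d \<Longrightarrow> j \<le> d \<Longrightarrow> c j \<notin> gap i"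
  using c_mono[of j i] c_mono[of "Suc i" j] by (cases "j \<le> i") (auto simp: gap_def)

lemma gap_exists:
  assumes "x \<in> {0..1}" "x \<notin> c ` {..d}"
  obtains i where "i < d" "x \<in> gap i"
proof -
  have "\<exists>i<n. x \<in> gap i" if "n \<le> d" "x < c n" for n
    using that
  proof (induction n)
    case 0 then show ?case using assms c0 by auto
  next
    case (Suc n)
    have "x \<noteq> c n" using assms(2) Suc.prems by auto
    then consider "x < c n" | "c n < x" by linarith
    then show ?case using Suc by cases (auto simp: gap_def less_Suc_eq)
  qed
  moreover have "x \<noteq> c d" using assms(2) by auto
  then have "x < c d" using assms(1) cd by auto
  ultimately show thesis using that by blast
qed

text \<open>A fixed Borel version of the piecewise map, with value 0 at the critical points; on the
  unit interval it differs from the given map at finitely many points only.\<close>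

definition Tm :: "real \<Rightarrow> real" where
  "Tm x = (\<Sum>i<d. if x \<in> gap i then E i x else 0)"

lemma gap_sum:
  fixes h :: "nat \<Rightarrow> real"
  assumes "i < d" "x \<in> gap i"
  shows "(\<Sum>j<d. if x \<in> gap j then h j else 0) = h i"
proof -
  have "(x \<in> gap j) = (i = j)" if "j < d" for j
    using gap_unique[OF assms(1) that assms(2)] assms(2) by blast
  then have "(\<Sum>j<d. if x \<in> gap j then h j else 0) = (\<Sum>j<d. if i = j then h j else 0)"
    by (intro sum.cong) auto
  then show ?thesis using assms by simp
qed

lemma Tm_gap: "i < d \<Longrightarrow> x \<in> gap i \<Longrightarrow> Tm x = E i x"
  unfolding Tm_def by (rule gap_sum)

lemma Tm_measurable [measurable]: "Tm \<in> borel_measurable borel"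
proof -
  have "(\<lambda>x. if x \<in> gap i then E i x else 0) \<in> borel_measurable borel" if "i < d" for i
  proof -
    interpret branch "c i" "c (Suc i)" "E i" "E' i" lam K by (rule br[OF that])
    show ?thesis unfolding gap_def
      by (intro borel_measurable_continuous_on_if continuous_on_subset[OF cont]) auto
  qed
  then show ?thesis unfolding Tm_def[abs_def] by (intro borel_measurable_sum) auto
qed

text \<open>The Perron-Frobenius operator, a sum over preimages of
  \<open>f x / \<bar>E' x\<bar>\<close>. It is an honest function, not a class modulo null sets:
  preimages at the ends of the branch intervals count as zero, which makes every cut visible to
  \<open>reg\<close>.\<close>

definition L :: "(real \<Rightarrow> real) \<Rightarrow> real \<Rightarrow> real" where
  "L f y = (\<Sum>i<d. branch.push (c i) (c (Suc i)) (E i) (E' i)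
     (\<lambda>x. if c i < x \<and> x < c (Suc i) then f x else 0) y)"

lemma L_measurable [measurable]:
  assumes [measurable]: "f \<in> borel_measurable borel"
  shows "L f \<in> borel_measurable borel"
  unfolding L_def[abs_def]
  by (intro borel_measurable_sum branch.push_measurable[OF br]) auto

lemma L_nonneg: "(\<And>x. 0 \<le> f x) \<Longrightarrow> 0 \<le> L f y"
  unfolding L_def by (intro sum_nonneg branch.push_nonneg[OF br]) auto

lemma L_outside:
  assumes f: "\<And>x. x \<notin> S \<Longrightarrow> f x = 0" and y: "y \<notin> S"
    and inv: "\<And>i x. i < d \<Longrightarrow> x \<in> S \<Longrightarrow> x \<in> gap i \<Longrightarrow> E i x \<in> S"
  shows "L f y = 0"
  unfolding L_def
proof (intro sum.neutral ballI)
  fix i assume "i \<in> {..<d}"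
  then have i: "i < d" by auto
  interpret branch "c i" "c (Suc i)" "E i" "E' i" lam K by (rule br[OF i])
  show "push (\<lambda>x. if c i < x \<and> x < c (Suc i) then f x else 0) y = 0"
  proof (cases "y \<in> E i ` {c i..c (Suc i)}")
    case True
    then obtain x where x: "x \<in> {c i..c (Suc i)}" "y = E i x" by auto
    show ?thesis using x y inv[OF i, of x] f[of x] by (auto simp: push_E gap_def)
  qed (simp add: push_outside)
qed

lemma L_integral:
  assumes [measurable]: "f \<in> borel_measurable borel" "g \<in> borel_measurable borel"
    and f: "integrable lborel f" "\<And>x. x \<notin> {0..1} \<Longrightarrow> f x = 0" and g: "\<And>x. \<bar>g x\<bar> \<le> B"
  shows "integrable lborel (\<lambda>y. g y * L f y)"
    "(LINT y|lborel. g y * L f y) = (LINT x|lborel. g (Tm x) * f x)"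
proof -
  let ?h = "\<lambda>i x. if c i < x \<and> x < c (Suc i) then f x else 0"
  let ?P = "\<lambda>i. branch.push (c i) (c (Suc i)) (E i) (E' i)"
  have eq: "indicator {c i..c (Suc i)} x * (g (E i x) * ?h i x) = indicator (gap i) x * (g (Tm x) * f x)"
    if "i < d" for i x
    using Tm_gap[OF that] by (auto simp: indicator_def gap_def)
  have int0: "integrable lborel (\<lambda>x. g (Tm x) * f x)"
    by (rule Bochner_Integration.integrable_bound[where f = "\<lambda>x. B * f x"])
       (use f g in \<open>auto simp: abs_mult intro!: mult_mono order_trans[OF g]\<close>)
  have gm: "gap i \<in> sets lborel" for i by (simp add: gap_def)
  have int: "integrable lborel (\<lambda>x. indicator {c i..c (Suc i)} x * (g (E i x) * ?h i x))"
    if "i < d" for i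
    using eq[OF that] integrable_mult_indicator[OF gm int0, of i] by simp
  have P: "integrable lborel (\<lambda>y. g y * ?P i (?h i) y)"
    "(LINT y|lborel. g y * ?P i (?h i) y) = (LINT x|lborel. indicator (gap i) x * (g (Tm x) * f x))"
    if "i < d" for i
    using branch.push_integral[OF br[OF that], of "?h i" g] int[OF that] eq[OF that] by auto
  have Lg: "g y * L f y = (\<Sum>i<d. g y * ?P i (?h i) y)" for y
    by (simp add: L_def sum_distrib_left)
  show "integrable lborel (\<lambda>y. g y * L f y)"
    unfolding Lg by (intro Bochner_Integration.integrable_sum P) auto
  have "(LINT y|lborel. g y * L f y) = (\<Sum>i<d. LINT x|lborel. indicator (gap i) x * (g (Tm x) * f x))"
    unfolding Lg using P by (subst Bochner_Integration.integral_sum) auto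
  also have "\<dots> = (LINT x|lborel. (\<Sum>i<d. indicator (gap i) x * (g (Tm x) * f x)))"
    using integrable_mult_indicator[OF gm int0] by (subst Bochner_Integration.integral_sum) auto
  also have "\<dots> = (LINT x|lborel. g (Tm x) * f x)"
  proof (rule integral_cong_AE)
    have "AE x in lborel. x \<notin> c ` {..d}"
      by (rule AE_not_in) (auto intro!: finite_imp_null_set_lborel)
    then show "AE x in lborel. (\<Sum>i<d. indicator (gap i) x * (g (Tm x) * f x)) = g (Tm x) * f x"
    proof eventually_elim
      fix x assume x: "x \<notin> c ` {..d}"
      show "(\<Sum>i<d. indicator (gap i) x * (g (Tm x) * f x)) = g (Tm x) * f x"
      proof (cases "x \<in> {0..1}")
        case True
        then obtain i where i: "i < d" "x \<in> gap i" using gap_exists x by blast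
        have "(\<Sum>j<d. indicator (gap j) x * (g (Tm x) * f x)) = (\<Sum>j<d. if x \<in> gap j then g (Tm x) * f x else 0)"
          by (intro sum.cong) (auto simp: indicator_def)
        then show ?thesis using gap_sum[OF i] by simp
      qed (use f in auto)
    qed
  qed (auto simp: gap_def)
  finally show "(LINT y|lborel. g y * L f y) = (LINT x|lborel. g (Tm x) * f x)" .
qed

lemma dens_L:
  assumes f: "dens S f" and S: "S \<subseteq> {0..1}"
    and inv: "\<And>i x. i < d \<Longrightarrow> x \<in> S \<Longrightarrow> x \<in> gap i \<Longrightarrow> E i x \<in> S"
  shows "dens S (L f)"
proof -
  note [measurable] = dens_measurable[OF f]
  have *: "integrable lborel f" "\<And>x. x \<notin> {0..1} \<Longrightarrow> f x = 0" "(LINT x|lborel. f x) = 1"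
    using f S by (auto simp: dens_def)
  have "\<bar>(\<lambda>_. 1::real) x\<bar> \<le> 1" for x :: real by simp
  from L_integral[OF _ _ *(1,2) this] show ?thesis
    using f * L_outside[of S f] inv L_nonneg[of f] unfolding dens_def by auto
qed

subsection \<open>Evolution of the jumps\<close>

text \<open>
  Cutting \<open>f\<close> to the \<open>i\<close>-th branch interval creates jumps at its two ends, of sizes bounded by
  \<open>b1 i\<close> and \<open>b2 i\<close>; all jumps are then moved by the branch and shrink by the factor \<open>lam\<close>.
\<close>

definition newJ :: "(nat \<Rightarrow> real) \<Rightarrow> (nat \<Rightarrow> real) \<Rightarrow> (real \<times> real) list \<Rightarrow> (real \<times> real) list" where
  "newJ b1 b2 J = concat (map (\<lambda>i. map (\<lambda>a. (E i (fst a), snd a / lam))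
     (filter (\<lambda>a. c i < fst a \<and> fst a < c (Suc i)) J @ [(c i, b1 i), (c (Suc i), b2 i)])) [0..<d])"

lemma jint_newJ: "jint (newJ b1 b2 J) g =
    (\<Sum>i<d. jint J (\<lambda>r. if r \<in> gap i then g (E i r) else 0) + b1 i * g (E i (c i)) +
      b2 i * g (E i (c (Suc i)))) / lam"
  unfolding newJ_def jint_concat_upt jint_map sum_divide_distrib
  by (simp add: gap_def jint_filter[of "\<lambda>r. c i < r \<and> r < c (Suc i)" for i] add.assoc)

lemma newJ_memE:
  assumes "z \<in> set (newJ b1 b2 J)"
  obtains i a where "i < d" "z = (E i (fst a), snd a / lam)"
    "a \<in> set (filter (\<lambda>a. c i < fst a \<and> fst a < c (Suc i)) J @ [(c i, b1 i), (c (Suc i), b2 i)])"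
proof -
  from assms obtain xs where xs: "xs \<in> set (map (\<lambda>i. map (\<lambda>a. (E i (fst a), snd a / lam))
     (filter (\<lambda>a. c i < fst a \<and> fst a < c (Suc i)) J @ [(c i, b1 i), (c (Suc i), b2 i)])) [0..<d])"
    and z: "z \<in> set xs"
    unfolding newJ_def set_concat by blast
  from xs obtain i where "i \<in> set [0..<d]" "xs = map (\<lambda>a. (E i (fst a), snd a / lam))
     (filter (\<lambda>a. c i < fst a \<and> fst a < c (Suc i)) J @ [(c i, b1 i), (c (Suc i), b2 i)])"
    unfolding set_map by blast
  with z show thesis using that[of i] unfolding set_map by force
qed

lemma newJ_ok:
  assumes "jumps_ok S J" "\<And>i. i < d \<Longrightarrow> 0 \<le> b1 i" "\<And>i. i < d \<Longrightarrow> 0 \<le> b2 i"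
  shows "jumps_ok {0..1} (newJ b1 b2 J)"
proof -
  have "0 \<le> fst z \<and> fst z \<le> 1 \<and> 0 \<le> snd z" if "z \<in> set (newJ b1 b2 J)" for z
  proof -
    from newJ_memE[OF that] obtain i a where i: "i < d" "z = (E i (fst a), snd a / lam)"
      and a: "a \<in> set (filter (\<lambda>a. c i < fst a \<and> fst a < c (Suc i)) J @ [(c i, b1 i), (c (Suc i), b2 i)])" .
    have "fst a \<in> {c i..c (Suc i)} \<and> 0 \<le> snd a"
      using assms a i c_less[of i] unfolding jumps_ok_def by auto
    then show ?thesis using i range[of i "fst a"] lam1 by auto
  qed
  then show ?thesis by (auto simp: jumps_ok_def)
qed

lemma reg_L:
  assumes f: "reg D f J" "\<And>x. 0 \<le> f x" and J: "jumps_ok S J"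
    and D: "0 \<le> D" "D + K \<le> lam * D"
    and b: "\<And>i. i < d \<Longrightarrow> 0 \<le> b1 i" "\<And>i. i < d \<Longrightarrow> 0 \<le> b2 i"
    and b1: "\<And>i z. i < d \<Longrightarrow> z \<in> gap i \<Longrightarrow> f z \<le> b1 i + jint J (indicator {c i<..z})"
    and b2: "\<And>i z. i < d \<Longrightarrow> z \<in> gap i \<Longrightarrow> f z \<le> b2 i + jint J (indicator {z..<c (Suc i)})"
  shows "reg D (L f) (newJ b1 b2 J)"
  unfolding L_def[abs_def] newJ_def
proof (rule reg_sum)
  fix i assume i: "i < d"
  interpret branch "c i" "c (Suc i)" "E i" "E' i" lam K by (rule br[OF i])
  show "reg D (\<lambda>x. push (\<lambda>x. if c i < x \<and> x < c (Suc i) then f x else 0) x)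
    (map (\<lambda>a. (E i (fst a), snd a / lam)) (filter (\<lambda>a. c i < fst a \<and> fst a < c (Suc i)) J @
      [(c i, b1 i), (c (Suc i), b2 i)]))"
  proof (rule reg_push)
    show "reg D (\<lambda>x. if c i < x \<and> x < c (Suc i) then f x else 0)
      (filter (\<lambda>a. c i < fst a \<and> fst a < c (Suc i)) J @ [(c i, b1 i), (c (Suc i), b2 i)])"
      using f J b[OF i] b1[OF i] b2[OF i] by (intro reg_restrict) (auto simp: gap_def)
    show "jumps_ok {c i..c (Suc i)} (filter (\<lambda>a. c i < fst a \<and> fst a < c (Suc i)) J @ [(c i, b1 i), (c (Suc i), b2 i)])"
      using J b[OF i] c_less[OF i] by (auto simp: jumps_ok_def)
  qed (use f D in auto)
qed

text \<open>The possible positions of jumps created within the last \<open>m\<close> steps. Only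
  points inside an open branch interval are carried on, since a jump that sits at a critical point
  is removed by the cut and replaced by new ones.\<close>

primrec PC :: "nat \<Rightarrow> real set" where
  "PC 0 = {}"
| "PC (Suc m) = (\<Union>i<d. {E i (c i), E i (c (Suc i))} \<union> E i ` (PC m \<inter> gap i))"

text \<open>
  The weight \<open>V\<close> of the jumps caused in one step by a unit jump at \<open>r\<close>: its own image and, when \<open>r\<close>
  is \<open>ell\<close>-close to an interior critical point, a jump at the image of that point, as the jump at \<open>r\<close>
  then enters the bound for the one-sided value of the density there. A jump at \<open>0\<close> or \<open>1\<close> accounts
  for the density vanishing outside the unit interval, so that these two points never create new
  jumps; hence a fixed endpoint does no harm.
\<close>

definition Aop :: "real \<Rightarrow> (real \<Rightarrow> real) \<Rightarrow> real \<Rightarrow> real" where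
  "Aop ell V r = (\<Sum>i<d. (if r \<in> gap i then V (E i r) else 0) +
     (if i = 0 then indicator {0} r else indicator {c i<..<c i + ell} r) * V (E i (c i)) +
     (if Suc i = d then indicator {1} r else indicator {c (Suc i) - ell<..<c (Suc i)} r) * V (E i (c (Suc i))))"

lemma sum_gap_le: "(\<Sum>i<d. if r \<in> gap i then 1 else 0) \<le> (1::real)"
proof (cases "\<exists>i<d. r \<in> gap i")
  case True
  then obtain i where i: "i < d" "r \<in> gap i" by auto
  then show ?thesis using gap_sum[OF i, of "\<lambda>_. 1"] by simp
next
  case False
  then have "(\<Sum>i<d. if r \<in> gap i then 1 else (0::real)) = 0" by (intro sum.neutral) auto
  then show ?thesis by simp
qed

end

text \<open>\<open>A_le\<close> says that \<open>V\<close> is a supersolution of the jump operator: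
  one step multiplies the \<open>V\<close>-weighted mass of the jumps by at most
  \<open>kap / lam\<close>, up to an additive constant. The bounds by 1 and \<open>Vm\<close> make
  this mass comparable to the plain one.\<close>

locale pw_pot = pw +
  fixes ell kap Vm :: real and V :: "real \<Rightarrow> real"
  assumes ell: "0 < ell" "\<And>i. i < d \<Longrightarrow> ell \<le> c (Suc i) - c i"
    and kap: "0 < kap" "kap < lam"
    and V1: "\<And>r. r \<in> {0..1} \<Longrightarrow> 1 \<le> V r" and Vm: "\<And>r. r \<in> {0..1} \<Longrightarrow> V r \<le> Vm"
    and A_le: "\<And>r. r \<in> {0..1} \<Longrightarrow> Aop ell V r \<le> kap * V r"
begin

text \<open>The solution of \<open>D + K = lam * D\<close>, hence the least constant that
  \<open>reg_push\<close> allows.\<close>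

definition D where "D = K / (lam - 1)"

text \<open>There are \<open>2 * d\<close> cuts. At each, the density contributes at most its mean
  over a window of length \<open>ell\<close>, distorted by \<open>exp D\<close>; the new jump has
  weight at most \<open>Vm\<close> and is divided by \<open>lam\<close>.\<close>

definition "C1 = 2 * real d * exp D * Vm / (ell * lam)"

lemma D: "0 \<le> D" "D + K \<le> lam * D"
  using lam1 K0 by (auto simp: D_def field_simps)

lemma Vm1: "1 \<le> Vm" using V1[of 0] Vm[of 0] by simp

lemma V_nonneg: "r \<in> {0..1} \<Longrightarrow> 0 \<le> V r" using V1[of r] by simp

lemma C1: "0 \<le> C1" unfolding C1_def using Vm1 ell lam1 by simp

text \<open>The mean of \<open>f\<close> over the whole unit interval is 1; the way from there to
  \<open>y\<close> costs the factor \<open>exp D\<close> and the jumps, whose plain mass is at most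
  the weighted one.\<close>

lemma sup_le:
  assumes f: "dens {0..1} f" "reg D f J" and J: "jumps_ok {0..1} J" "jint J V \<le> B"
  shows "f y \<le> exp D + B"
proof -
  have m: "jint J (indicator A) \<le> B" for A
  proof -
    have "jint J (indicator A) \<le> jint J V"
      by (rule jint_mono[OF J(1)]) (use V1 in \<open>auto simp: indicator_def intro: order_trans[of _ 1]\<close>)
    then show ?thesis using J(2) by simp
  qed
  have B0: "0 \<le> B" using jint_nonneg[OF J(1), of V] V_nonneg J(2) by force
  show ?thesis
  proof (cases "y \<in> {0..1}")
    case True
    have "f y \<le> exp D / (1 - 0) + B"
    proof (rule le_average[OF f(1)])
      fix x :: real assume x: "0 < x" "x < 1"
      have "f y \<le> exp (D * \<bar>y - x\<bar>) * f x + B" using regD[OF f(2), of y x] m[of "closed_segment x y"] by simp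
      also have "\<dots> \<le> exp D * f x + B"
        using x True D(1) dens_nonneg[OF f(1), of x] by (intro add_mono mult_right_mono) (auto intro: mult_left_le)
      finally show "f y \<le> exp D * f x + B" .
    qed auto
    then show ?thesis by simp
  next
    case False
    then show ?thesis using f(1) B0 by (auto simp: dens_def intro: add_nonneg_nonneg)
  qed
qed

text \<open>The analogue of the Lasota-Yorke inequality. The size of the cut at an interior critical
  point is bounded by the mean of \<open>f\<close> over the adjacent window of length
  \<open>ell\<close>, plus the jumps in that window; it is these jumps that \<open>Aop\<close>
  counts a second time.\<close>

lemma mass_step:
  assumes f: "dens {0..1} f" "reg D f J" and J: "jumps_ok {0..1} J"
  obtains J' where "reg D (L f) J'" "jumps_ok {0..1} J'" "jint J' V \<le> kap / lam * jint J V + C1"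
proof -
  define j1 where "j1 i = (if i = 0 then indicator {0} else indicator {c i<..<c i + ell} :: real \<Rightarrow> real)" for i
  define j2 where "j2 i = (if Suc i = d then indicator {1} else indicator {c (Suc i) - ell<..<c (Suc i)} :: real \<Rightarrow> real)" for i
  define b1 where "b1 i = jint J (j1 i) + exp D / ell" for i
  define b2 where "b2 i = jint J (j2 i) + exp D / ell" for i
  have nn: "0 \<le> jint J (indicator A)" for A by (rule jint_nonneg[OF J]) auto
  have j12: "0 \<le> jint J (j1 i)" "0 \<le> jint J (j2 i)" for i by (auto simp: j1_def j2_def nn)
  have b: "0 \<le> b1 i" "0 \<le> b2 i" for i using j12 ell by (auto simp: b1_def b2_def)
  have sub: "jint J (indicator A) \<le> jint J (indicator B) + jint J (indicator C)"
    if "A \<inter> {0..1} \<subseteq> B \<union> C" for A B C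
    unfolding jint_add[symmetric] by (rule jint_mono[OF J]) (use that in \<open>auto simp: indicator_def\<close>)
  have out: "f x = 0" if "x \<notin> {0..1}" for x using f(1) that by (auto simp: dens_def)
  have avg: "f z \<le> exp D / ell + (jint J (indicator A) + jint J (indicator B))"
    if "v = u + ell" "0 \<le> u" "v \<le> 1" "z \<in> {0..1}"
      "\<And>x. u < x \<Longrightarrow> x < v \<Longrightarrow> closed_segment x z \<subseteq> A \<union> B" for u v z A B
  proof -
    have "f z \<le> exp D / (v - u) + (jint J (indicator A) + jint J (indicator B))"
    proof (rule le_average[OF f(1)])
      fix x assume x: "u < x" "x < v"
      have "f z \<le> exp (D * \<bar>z - x\<bar>) * f x + jint J (indicator (closed_segment x z))" by (rule regD[OF f(2)])
      also have "\<dots> \<le> exp D * f x + (jint J (indicator A) + jint J (indicator B))"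
        using x that D(1) dens_nonneg[OF f(1), of x]
        by (intro add_mono mult_right_mono sub) (auto intro: mult_left_le)
      finally show "f z \<le> exp D * f x + (jint J (indicator A) + jint J (indicator B))" .
    qed (use that ell in auto)
    then show ?thesis using that by simp
  qed
  have 1: "f z \<le> b1 i + jint J (indicator {c i<..z})" if i: "i < d" "z \<in> gap i" for i z
  proof (cases "i = 0")
    case True
    \<comment> \<open>At the left end of the unit interval no window is used: \<open>f\<close>
      vanishes at -1, so the jump recorded at 0 and the jumps after it bound
      \<open>f z\<close>.\<close>
    have "f z \<le> jint J (indicator (closed_segment (-1) z))" using regD[OF f(2), of z "-1"] out[of "-1"] by simp
    also have "\<dots> \<le> jint J (indicator {0}) + jint J (indicator {c i<..z})"
      using i True c0 by (intro sub) (auto simp: closed_segment_eq_real_ivl gap_def)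
    finally show ?thesis using True ell by (simp add: b1_def j1_def add.assoc) (smt (verit) divide_nonneg_pos exp_ge_zero)
  next
    case False
    have "f z \<le> exp D / ell + (jint J (indicator {c i<..<c i + ell}) + jint J (indicator {c i<..z}))"
      using i ell(2)[OF i(1)] c_range[of i] c_range[of "Suc i"]
      by (intro avg[of "c i + ell" "c i"]) (auto simp: gap_def closed_segment_eq_real_ivl split: if_splits)
    then show ?thesis using False by (simp add: b1_def j1_def)
  qed
  have 2: "f z \<le> b2 i + jint J (indicator {z..<c (Suc i)})" if i: "i < d" "z \<in> gap i" for i z
  proof (cases "Suc i = d")
    case True
    have "f z \<le> jint J (indicator (closed_segment 2 z))" using regD[OF f(2), of z 2] out[of 2] by simp
    also have "\<dots> \<le> jint J (indicator {1}) + jint J (indicator {z..<c (Suc i)})"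
      using i True cd by (intro sub) (auto simp: closed_segment_eq_real_ivl gap_def)
    finally show ?thesis using True ell by (simp add: b2_def j2_def add.assoc) (smt (verit) divide_nonneg_pos exp_ge_zero)
  next
    case False
    have "f z \<le> exp D / ell + (jint J (indicator {c (Suc i) - ell<..<c (Suc i)}) + jint J (indicator {z..<c (Suc i)}))"
      using i ell(2)[OF i(1)] c_range[of i] c_range[of "Suc i"]
      by (intro avg[of "c (Suc i)" "c (Suc i) - ell"]) (auto simp: gap_def closed_segment_eq_real_ivl split: if_splits)
    then show ?thesis using False by (simp add: b2_def j2_def)
  qed
  have V': "0 \<le> V (E i (c i)) \<and> V (E i (c i)) \<le> Vm" "0 \<le> V (E i (c (Suc i))) \<and> V (E i (c (Suc i))) \<le> Vm"
    if "i < d" for i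
    using V_nonneg Vm range[OF that] c_less[OF that] by (auto simp del: atLeastAtMost_iff simp: atLeastAtMost_iff[of _ "c i"])
  have "jint (newJ b1 b2 J) V * lam =
     (\<Sum>i<d. jint J (\<lambda>r. if r \<in> gap i then V (E i r) else 0) + b1 i * V (E i (c i)) + b2 i * V (E i (c (Suc i))))"
    using lam1 by (simp add: jint_newJ)
  also have "\<dots> \<le> (\<Sum>i<d. jint J (\<lambda>r. (if r \<in> gap i then V (E i r) else 0) + j1 i r * V (E i (c i)) + j2 i r * V (E i (c (Suc i))))
      + 2 * (exp D / ell * Vm))"
  proof (intro sum_mono)
    fix i assume "i \<in> {..<d}"
    then have i: "i < d" by auto
    have "jint J (\<lambda>r. (if r \<in> gap i then V (E i r) else 0) + j1 i r * V (E i (c i)) + j2 i r * V (E i (c (Suc i))))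
      = jint J (\<lambda>r. if r \<in> gap i then V (E i r) else 0) + jint J (j1 i) * V (E i (c i)) + jint J (j2 i) * V (E i (c (Suc i)))"
      using jint_cmult[of J "V (E i (c i))" "j1 i"] jint_cmult[of J "V (E i (c (Suc i)))" "j2 i"]
      by (simp add: jint_add mult.commute)
    moreover define q where "q = exp D / ell"
    moreover have "exp D / ell * V (E i (c i)) \<le> exp D / ell * Vm" "exp D / ell * V (E i (c (Suc i))) \<le> exp D / ell * Vm"
      using V'[OF i] ell by (auto intro!: mult_left_mono divide_right_mono)
    ultimately show "jint J (\<lambda>r. if r \<in> gap i then V (E i r) else 0) + b1 i * V (E i (c i)) + b2 i * V (E i (c (Suc i)))
      \<le> jint J (\<lambda>r. (if r \<in> gap i then V (E i r) else 0) + j1 i r * V (E i (c i)) + j2 i r * V (E i (c (Suc i))))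
      + 2 * (exp D / ell * Vm)"
      unfolding b1_def b2_def distrib_right q_def[symmetric] by linarith
  qed
  also have "\<dots> = jint J (Aop ell V) + 2 * real d * exp D / ell * Vm"
    unfolding Aop_def[abs_def] jint_sum by (subst sum.distrib) (simp add: j1_def j2_def if_distribR)
  also have "jint J (Aop ell V) \<le> jint J (\<lambda>r. kap * V r)" by (rule jint_mono[OF J A_le])
  finally have "jint (newJ b1 b2 J) V * lam \<le> kap * jint J V + 2 * real d * exp D / ell * Vm"
    by (simp add: jint_cmult)
  then have "jint (newJ b1 b2 J) V \<le> (kap * jint J V + 2 * real d * exp D / ell * Vm) / lam"
    using lam1 by (subst pos_le_divide_eq) auto
  also have "\<dots> = kap / lam * jint J V + C1" by (simp add: C1_def add_divide_distrib)
  finally have "jint (newJ b1 b2 J) V \<le> kap / lam * jint J V + C1" .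
  then show thesis
    using that[OF reg_L[OF f(2) dens_nonneg[OF f(1)] J D b 1 2] newJ_ok[OF J b]] by auto
qed

text \<open>\<open>C1 / (1 - kap / lam)\<close> is the fixed point of the affine bound in
  \<open>mass_step\<close>, so a mass below \<open>Bd m\<close> stays below it.\<close>

definition "Bd m = max m (C1 / (1 - kap / lam))"

lemma Bd: "m \<le> Bd m" "0 \<le> Bd m" "kap / lam * Bd m + C1 \<le> Bd m"
proof -
  have k: "0 < 1 - kap / lam" using kap by simp
  show "m \<le> Bd m" by (simp add: Bd_def)
  show "0 \<le> Bd m" using k C1 by (simp add: Bd_def max.coboundedI2)
  have "C1 / (1 - kap / lam) \<le> Bd m" by (simp add: Bd_def)
  then have "C1 \<le> Bd m * (1 - kap / lam)" using k by (simp add: pos_divide_le_eq)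
  then show "kap / lam * Bd m + C1 \<le> Bd m" by (simp add: algebra_simps)
qed

lemma dens_pow:
  assumes f: "dens S f" and S: "S \<subseteq> {0..1}"
    and inv: "\<And>i x. i < d \<Longrightarrow> x \<in> S \<Longrightarrow> x \<in> gap i \<Longrightarrow> E i x \<in> S"
  shows "dens S ((L ^^ n) f)"
  by (induction n) (auto intro!: dens_L f S inv)

lemma mass_pow:
  assumes f: "dens {0..1} f" "reg D f J" and J: "jumps_ok {0..1} J" "jint J V \<le> m"
  shows "\<exists>J'. reg D ((L ^^ n) f) J' \<and> jumps_ok {0..1} J' \<and> jint J' V \<le> Bd m"
proof (induction n)
  case 0
  show ?case using f J Bd(1)[of m] by auto
next
  case (Suc n)
  then obtain J' where J': "reg D ((L ^^ n) f) J'" "jumps_ok {0..1} J'" "jint J' V \<le> Bd m" by auto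
  have "dens {0..1} ((L ^^ n) f)" using range by (intro dens_pow f) (auto simp: gap_def)
  from mass_step[OF this J'(1,2)] obtain J2 where
    J2: "reg D (L ((L ^^ n) f)) J2" "jumps_ok {0..1} J2" "jint J2 V \<le> kap / lam * jint J' V + C1" by auto
  have "kap / lam * jint J' V \<le> kap / lam * Bd m"
    using J'(3) kap lam1 by (intro mult_left_mono) auto
  then show ?case using J2 Bd(3)[of m] by (intro exI[of _ J2]) auto
qed

definition "supb m = exp D + Bd m"

text \<open>Jumps have two ages. Those made in the last \<open>k\<close> steps may be large, but
  their positions are known. An older one has been moved \<open>k\<close> times without being
  multiplied, because each point lies in at most one open branch interval, so it has shrunk by the
  factor \<open>lam ^ k\<close>.\<close>

lemma split_pow:
  assumes f: "dens {0..1} f" "reg D f J" and J: "jumps_ok {0..1} J" "jint J V \<le> m"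
  shows "n \<ge> k \<Longrightarrow> \<exists>P R. reg D ((L ^^ n) f) (P @ R) \<and> jumps_ok {0..1} P \<and> jumps_ok {0..1} R \<and>
    fst ` set P \<subseteq> PC k \<and> jint R (\<lambda>_. 1) \<le> Bd m / lam ^ k"
proof (induction k arbitrary: n)
  case 0
  from mass_pow[OF assms, of n] obtain J' where
    J': "reg D ((L ^^ n) f) J'" "jumps_ok {0..1} J'" "jint J' V \<le> Bd m" by auto
  moreover have "jint J' (\<lambda>_. 1) \<le> jint J' V" by (rule jint_mono[OF J'(2)]) (rule V1)
  ultimately show ?case by (intro exI[of _ "[]"] exI[of _ J']) (auto simp: jumps_ok_def)
next
  case (Suc k)
  then obtain n' where n': "n = Suc n'" "n' \<ge> k" by (cases n) auto
  from Suc.IH[OF n'(2)] obtain P R where PR: "reg D ((L ^^ n') f) (P @ R)" "jumps_ok {0..1} P"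
    "jumps_ok {0..1} R" "fst ` set P \<subseteq> PC k" "jint R (\<lambda>_. 1) \<le> Bd m / lam ^ k" by auto
  let ?g = "(L ^^ n') f"
  have g: "dens {0..1} ?g" using range by (intro dens_pow f) (auto simp: gap_def)
  from mass_pow[OF assms, of n'] have sup: "?g y \<le> supb m" for y
    using sup_le[OF g] by (auto simp: supb_def)
  have supb0: "0 \<le> supb m" using Bd(2)[of m] by (simp add: supb_def add_nonneg_nonneg)
  \<comment> \<open>Here each cut is bounded by the supremum of the density alone, so that its size
    does not refer to the old jumps: no old jump is counted twice, and \<open>R\<close> merely
    moves.\<close>
  let ?b = "\<lambda>_. supb m :: real" and ?z = "\<lambda>_. 0 :: real"
  have ok: "jumps_ok {0..1} (P @ R)" using PR by simp
  have nn: "0 \<le> jint (P @ R) (indicator A)" for A by (rule jint_nonneg[OF ok]) auto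
  have "reg D (L ?g) (newJ ?b ?b (P @ R))"
    by (rule reg_L[OF PR(1) dens_nonneg[OF g] ok D]) (use supb0 sup nn in \<open>auto intro!: add_increasing2 simp del: jint_simps\<close>)
  \<comment> \<open>All new jumps are attributed to \<open>P\<close>; the zero cut sizes for
    \<open>R\<close> only produce entries of size 0.\<close>
  moreover have "jint (newJ ?b ?b (P @ R)) h = jint (newJ ?b ?b P @ newJ ?z ?z R) h" for h
    by (simp add: jint_newJ add_divide_distrib[symmetric] sum.distrib algebra_simps)
  ultimately have 1: "reg D (L ?g) (newJ ?b ?b P @ newJ ?z ?z R)" unfolding reg_def by metis
  have 2: "fst ` set (newJ ?b ?b P) \<subseteq> PC (Suc k)"
  proof
    fix z assume "z \<in> fst ` set (newJ ?b ?b P)"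
    then obtain z' where z': "z' \<in> set (newJ ?b ?b P)" "z = fst z'" by auto
    obtain i a where i: "i < d" "z' = (E i (fst a), snd a / lam)"
      and a: "a \<in> set (filter (\<lambda>a. c i < fst a \<and> fst a < c (Suc i)) P @ [(c i, supb m), (c (Suc i), supb m)])"
      using newJ_memE[OF z'(1)] .
    from a consider "a \<in> set P" "fst a \<in> gap i" | "fst a = c i" | "fst a = c (Suc i)"
      by (auto simp: gap_def)
    then show "z \<in> PC (Suc k)" using i z'(2) PR(4) by cases auto
  qed
  have "jint (newJ ?z ?z R) (\<lambda>_. 1) = jint R (\<lambda>r. \<Sum>i<d. if r \<in> gap i then 1 else 0) / lam"
    by (simp add: jint_newJ jint_sum)
  also have "\<dots> \<le> jint R (\<lambda>_. 1) / lam"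
    using lam1 by (intro divide_right_mono jint_mono[OF PR(3)] sum_gap_le) auto
  also have "\<dots> \<le> Bd m / lam ^ k / lam" using PR(5) lam1 by (intro divide_right_mono) auto
  finally have 3: "jint (newJ ?z ?z R) (\<lambda>_. 1) \<le> Bd m / lam ^ Suc k" by (simp add: mult.commute)
  show ?case
    using 1 2 3 n' newJ_ok[OF PR(2), of ?b ?b] newJ_ok[OF PR(3), of ?z ?z] supb0
    by (intro exI[of _ "newJ ?b ?b P"] exI[of _ "newJ ?z ?z R"]) auto
qed

end

declare sum_mult_indicator [simp del] sum_indicator_mult [simp del]

subsection \<open>Compactness in \<open>L\<^sup>1\<close>\<close>

definition cell :: "nat \<Rightarrow> nat \<Rightarrow> real set" where
  "cell N k = {real k / real N..<real (Suc k) / real N}"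

text \<open>Conditional expectation with respect to the partition of the unit interval into
  \<open>N\<close> equal cells.\<close>

definition cavg :: "nat \<Rightarrow> (real \<Rightarrow> real) \<Rightarrow> real \<Rightarrow> real" where
  "cavg N f x = (\<Sum>k<N. indicator (cell N k) x * (real N * (LINT y|lborel. indicator (cell N k) y * f y)))"

text \<open>Approximation by cell averages at rate \<open>1 / N\<close> replaces bounded variation.
  Apart from \<open>dens\<close>, the condition depends only on the class of \<open>f\<close> modulo
  null sets, and it passes to limits in L^1 and to averages with the same constants.\<close>

definition tight :: "real \<Rightarrow> real \<Rightarrow> (real \<Rightarrow> real) \<Rightarrow> bool" where
  "tight M B f \<longleftrightarrow> dens {0..1} f \<and> (AE x in lborel. f x \<le> M) \<and>
     (\<forall>N\<ge>1. (LINT x|lborel. \<bar>f x - cavg N f x\<bar>) \<le> B / real N)"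

lemma cell_measurable [measurable]: "cell N k \<in> sets borel"
  by (simp add: cell_def)

lemma cell_measure: "0 < N \<Longrightarrow> emeasure lborel (cell N k) = ennreal (1 / N)" "0 < N \<Longrightarrow> measure lborel (cell N k) = 1 / N"
  unfolding cell_def by (simp_all add: divide_right_mono diff_divide_distrib[symmetric])

lemma cell_integrable [simp]: "0 < N \<Longrightarrow> integrable lborel (indicator (cell N k) :: real \<Rightarrow> real)"
  by (intro integrable_real_indicator) (simp_all add: cell_measure)

lemma cell_unique: "0 < N \<Longrightarrow> x \<in> cell N k \<Longrightarrow> x \<in> cell N j \<Longrightarrow> j = k"
proof (rule ccontr)
  assume *: "0 < N" "x \<in> cell N k" "x \<in> cell N j" "j \<noteq> k"
  then have "real k \<le> x * N" "x * N < real (Suc k)" "real j \<le> x * N" "x * N < real (Suc j)"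
    by (auto simp: cell_def field_simps)
  then have "real k < real (Suc j)" "real j < real (Suc k)" by linarith+
  then show False using * by linarith
qed

lemma cell_exists: "0 < N \<Longrightarrow> 0 \<le> x \<Longrightarrow> x < 1 \<Longrightarrow> \<exists>k<N. x \<in> cell N k"
proof -
  assume *: "0 < N" "0 \<le> x" "x < 1"
  let ?k = "nat \<lfloor>x * N\<rfloor>"
  have "real ?k \<le> x * N" "x * N < real ?k + 1" using * by auto
  moreover have "x * N < N" using * by simp
  ultimately have "real ?k < real N" "x \<in> cell N ?k"
    using * by (linarith, simp add: cell_def field_simps)
  moreover from this(1) have "?k < N" by linarith
  ultimately show ?thesis by blast
qed

lemma cell_sub: "k < N \<Longrightarrow> cell N k \<subseteq> {0..<1}"
proof -
  assume "k < N"
  then have "real (Suc k) / N \<le> 1" by (simp add: divide_le_eq)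
  then show ?thesis by (auto simp: cell_def intro: order_trans[of _ "real k / real N"])
qed

lemma sum_cell:
  fixes h :: "nat \<Rightarrow> real"
  assumes "0 < N" "k < N" "x \<in> cell N k"
  shows "(\<Sum>j<N. indicator (cell N j) x * h j) = h k"
proof -
  have "(\<Sum>j<N. indicator (cell N j) x * h j) = (\<Sum>j<N. if k = j then h j else 0)"
  proof (rule sum.cong[OF refl])
    fix j
    have "x \<in> cell N j \<longleftrightarrow> k = j" using cell_unique[OF assms(1,3)] assms(3) by blast
    then show "indicator (cell N j) x * h j = (if k = j then h j else 0)" by (simp add: indicator_def)
  qed
  then show ?thesis using assms by simp
qed

lemma sum_cell_le1: "0 < N \<Longrightarrow> (\<Sum>j<N. indicator (cell N j) x) \<le> (1::real)"
proof (cases "\<exists>k<N. x \<in> cell N k")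
  case True
  assume "0 < N"
  with True show ?thesis using sum_cell[of N _ x "\<lambda>_. 1"] by auto
next
  case False
  then have "(\<Sum>j<N. indicator (cell N j) x) = (0::real)" by (intro sum.neutral) auto
  then show ?thesis by simp
qed

lemma cavg_measurable [measurable]: "cavg N f \<in> borel_measurable borel"
  unfolding cavg_def[abs_def] by measurable

lemma cavg_integrable: "0 < N \<Longrightarrow> integrable lborel (cavg N f)"
  unfolding cavg_def[abs_def] by (intro Bochner_Integration.integrable_sum integrable_mult_left) auto

lemma int_ind: "integrable lborel f \<Longrightarrow> A \<in> sets borel \<Longrightarrow> integrable lborel (\<lambda>y. indicator A y * (f y :: real))"
  using integrable_mult_indicator[of A lborel f] by simp

lemma cavg_diff:
  assumes N: "0 < N"
  shows "(LINT x|lborel. \<bar>cavg N f x - cavg N g x\<bar>) \<le>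
    (\<Sum>k<N. \<bar>(LINT y|lborel. indicator (cell N k) y * f y) - (LINT y|lborel. indicator (cell N k) y * g y)\<bar>)"
proof -
  let ?a = "\<lambda>k. (LINT y|lborel. indicator (cell N k) y * f y) - (LINT y|lborel. indicator (cell N k) y * g y)"
  have "(LINT x|lborel. \<bar>cavg N f x - cavg N g x\<bar>) \<le> (LINT x|lborel. (\<Sum>k<N. indicator (cell N k) x * (real N * \<bar>?a k\<bar>)))"
  proof (rule integral_mono)
    fix x
    have "cavg N f x - cavg N g x = (\<Sum>k<N. indicator (cell N k) x * (real N * ?a k))"
      by (simp add: cavg_def sum_subtractf[symmetric] algebra_simps)
    also have "\<bar>\<dots>\<bar> \<le> (\<Sum>k<N. \<bar>indicator (cell N k) x * (real N * ?a k)\<bar>)" by (rule sum_abs)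
    finally show "\<bar>cavg N f x - cavg N g x\<bar> \<le> (\<Sum>k<N. indicator (cell N k) x * (real N * \<bar>?a k\<bar>))"
      by (simp add: abs_mult)
  next
    show "integrable lborel (\<lambda>x. \<bar>cavg N f x - cavg N g x\<bar>)" using N by (intro integrable_abs Bochner_Integration.integrable_diff cavg_integrable)
  qed (use N in \<open>auto intro!: Bochner_Integration.integrable_sum integrable_mult_left\<close>)
  also have "\<dots> = (\<Sum>k<N. \<bar>?a k\<bar>)"
    using N by (subst Bochner_Integration.integral_sum) (auto simp: cell_measure)
  finally show ?thesis .
qed

lemma cavg_contract:
  assumes N: "0 < N" and f: "integrable lborel f" and g: "integrable lborel g"
  shows "(LINT x|lborel. \<bar>cavg N f x - cavg N g x\<bar>) \<le> (LINT x|lborel. \<bar>f x - g x\<bar>)"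
proof -
  have "(LINT x|lborel. \<bar>cavg N f x - cavg N g x\<bar>) \<le>
    (\<Sum>k<N. \<bar>(LINT y|lborel. indicator (cell N k) y * f y) - (LINT y|lborel. indicator (cell N k) y * g y)\<bar>)"
    by (rule cavg_diff[OF N])
  also have "\<dots> \<le> (\<Sum>k<N. LINT y|lborel. indicator (cell N k) y * \<bar>f y - g y\<bar>)"
  proof (rule sum_mono)
    fix k
    have "(LINT y|lborel. indicator (cell N k) y * f y) - (LINT y|lborel. indicator (cell N k) y * g y) =
      (LINT y|lborel. indicator (cell N k) y * (f y - g y))"
      using f g by (subst Bochner_Integration.integral_diff[symmetric]) (auto intro!: int_ind simp: right_diff_distrib)
    also have "\<bar>\<dots>\<bar> \<le> (LINT y|lborel. \<bar>indicator (cell N k) y * (f y - g y)\<bar>)" by (rule integral_abs_bound)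
    finally show "\<bar>(LINT y|lborel. indicator (cell N k) y * f y) - (LINT y|lborel. indicator (cell N k) y * g y)\<bar> \<le>
      (LINT y|lborel. indicator (cell N k) y * \<bar>f y - g y\<bar>)" by (simp add: abs_mult)
  qed
  also have "\<dots> = (LINT y|lborel. (\<Sum>k<N. indicator (cell N k) y) * \<bar>f y - g y\<bar>)"
    unfolding sum_distrib_right using f g by (subst Bochner_Integration.integral_sum) (auto intro!: int_ind)
  also have "\<dots> \<le> (LINT y|lborel. \<bar>f y - g y\<bar>)"
  proof (rule integral_mono)
    fix y show "(\<Sum>k<N. indicator (cell N k) y) * \<bar>f y - g y\<bar> \<le> \<bar>f y - g y\<bar>"
      using sum_cell_le1[OF N, of y] by (simp add: mult_left_le_one_le sum_nonneg)
  qed (use f g in \<open>auto simp: sum_distrib_right intro!: int_ind Bochner_Integration.integrable_sum\<close>)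
  finally show ?thesis .
qed

lemma L1_triangle:
  assumes "integrable lborel f" "integrable lborel g" "integrable lborel h"
  shows "(LINT x|lborel. \<bar>f x - h x\<bar>) \<le> (LINT x|lborel. \<bar>f x - g x\<bar>) + (LINT x|lborel. \<bar>g x - (h x::real)\<bar>)"
proof -
  have "(LINT x|lborel. \<bar>f x - h x\<bar>) \<le> (LINT x|lborel. \<bar>f x - g x\<bar> + \<bar>g x - h x\<bar>)"
    using assms by (intro integral_mono) auto
  then show ?thesis using assms by simp
qed

lemma L1_sym: "(LINT x|lborel. \<bar>f x - g x\<bar>) = (LINT x|lborel. \<bar>g x - (f x::real)\<bar>)"
  by (simp add: abs_minus_commute)

lemma integrable_dens: "dens S f \<Longrightarrow> integrable lborel f"
  by (simp add: dens_def)

lemma tight_limit: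
  assumes f: "dens {0..1} f" "AE x in lborel. f x \<le> M" and u: "\<And>n. tight M B (u n)"
    and lim: "(\<lambda>n. LINT x|lborel. \<bar>u n x - f x\<bar>) \<longlonglongrightarrow> 0"
  shows "tight M B f"
  unfolding tight_def
proof (intro conjI allI impI f)
  fix N :: nat assume "1 \<le> N"
  then have N: "0 < N" by simp
  have ui: "integrable lborel (u n)" for n using u[of n] by (auto simp: tight_def dens_def)
  have fi: "integrable lborel f" using f by (auto simp: dens_def)
  have le: "(LINT x|lborel. \<bar>f x - cavg N f x\<bar>) \<le> B / N + 2 * (LINT x|lborel. \<bar>u n x - f x\<bar>)" for n
  proof -
    have "(LINT x|lborel. \<bar>f x - cavg N f x\<bar>) \<le> (LINT x|lborel. \<bar>f x - u n x\<bar>) + (LINT x|lborel. \<bar>u n x - cavg N f x\<bar>)"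
      by (intro L1_triangle fi ui cavg_integrable N)
    moreover have "(LINT x|lborel. \<bar>u n x - cavg N f x\<bar>) \<le> (LINT x|lborel. \<bar>u n x - cavg N (u n) x\<bar>) + (LINT x|lborel. \<bar>cavg N (u n) x - cavg N f x\<bar>)"
      by (intro L1_triangle fi ui cavg_integrable N)
    moreover have "(LINT x|lborel. \<bar>u n x - cavg N (u n) x\<bar>) \<le> B / N"
      using u[of n] \<open>1 \<le> N\<close> by (auto simp: tight_def)
    ultimately show ?thesis using cavg_contract[OF N ui fi, of n] L1_sym[of f "u n"] by linarith
  qed
  have "(\<lambda>n. B / N + 2 * (LINT x|lborel. \<bar>u n x - f x\<bar>)) \<longlonglongrightarrow> B / N + 2 * 0"
    by (intro tendsto_intros lim)
  then show "(LINT x|lborel. \<bar>f x - cavg N f x\<bar>) \<le> B / N"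
    using le by (auto intro: LIMSEQ_le_const)
qed

lemma integral_le_1:
  assumes "dens S f" "A \<in> sets borel"
  shows "0 \<le> (LINT x|lborel. indicator A x * f x)" "(LINT x|lborel. indicator A x * f x) \<le> 1"
proof -
  show "0 \<le> (LINT x|lborel. indicator A x * f x)"
    using assms by (intro integral_nonneg_AE) (auto simp: dens_def)
  have "(LINT x|lborel. indicator A x * f x) \<le> (LINT x|lborel. f x)"
    using assms by (intro integral_mono int_ind integrable_dens) (auto simp: dens_def indicator_def)
  then show "(LINT x|lborel. indicator A x * f x) \<le> 1" using assms by (simp add: dens_def)
qed

text \<open>A diagonal argument makes the distribution functions converge at every rational. Cell
  integrals are differences of these values, so for fixed \<open>N\<close> the cell averages are
  Cauchy in L^1; \<open>tight\<close> controls the remainder by \<open>2 * B / N\<close>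
  uniformly.\<close>

lemma tight_cauchy_subseq:
  assumes u: "\<And>n. tight M B (u n)"
  obtains k :: "nat \<Rightarrow> nat" where "strict_mono k"
    "\<forall>e>0. \<exists>n0. \<forall>i\<ge>n0. \<forall>j\<ge>n0. (LINT x|lborel. norm (u (k i) x - u (k j) x)) < e"
proof -
  have d: "dens {0..1} (u n)" for n using u by (auto simp: tight_def)
  have ui: "integrable lborel (u n)" for n using d integrable_dens by blast
  let ?F = "\<lambda>n q. LINT y|lborel. indicator {..<q} y * u n y"
  have "norm (?F n q) \<le> 1" for n q using integral_le_1[OF d[of n], of "{..<q}"] by simp
  then obtain k where k: "strict_mono k" "\<And>q. q \<in> \<rat> \<Longrightarrow> \<exists>l. (\<lambda>n. ?F (k n) q) \<longlonglongrightarrow> l"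
    using function_convergent_subsequence[OF countable_rat, of ?F 1] by blast
  have conv: "convergent (\<lambda>n. LINT y|lborel. indicator (cell N j) y * u (k n) y)" if N: "0 < N" for N j
  proof -
    let ?a = "real j / real N" and ?b = "real (Suc j) / real N"
    have ab: "?a \<le> ?b" using N by (simp add: divide_right_mono)
    have "(LINT y|lborel. indicator (cell N j) y * u n y) = ?F n ?b - ?F n ?a" for n
    proof -
      have "?F n ?b - ?F n ?a = (LINT y|lborel. indicator {..<?b} y * u n y - indicator {..<?a} y * u n y)"
        by (rule Bochner_Integration.integral_diff[symmetric]) (intro int_ind ui, simp)+
      also have "\<dots> = (LINT y|lborel. indicator (cell N j) y * u n y)"
        using ab by (intro Bochner_Integration.integral_cong) (auto simp: cell_def indicator_def)
      finally show ?thesis by simp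
    qed
    moreover have "convergent (\<lambda>n. ?F (k n) ?b - ?F (k n) ?a)"
      by (rule convergent_diff) (use k(2)[of ?a] k(2)[of ?b] in \<open>auto simp: convergent_def\<close>)
    ultimately show ?thesis by simp
  qed
  show thesis
  proof (rule that[OF k(1)], intro allI impI)
    fix e :: real assume e: "e > 0"
    obtain N :: nat where N: "0 < N" "2 * B / N < e / 2"
    proof -
      obtain N :: nat where "4 * \<bar>B\<bar> / e < N" using reals_Archimedean2 by blast
      then have N: "4 * \<bar>B\<bar> < e * N" using e by (simp add: field_simps)
      then have "0 < N" using e by (cases N) auto
      then show thesis using N that[of N] e by (simp add: field_simps abs_if split: if_splits)
    qed
    let ?a = "\<lambda>n j. LINT y|lborel. indicator (cell N j) y * u (k n) y"
    have "\<exists>n0. \<forall>j<N. \<forall>m\<ge>n0. \<forall>n\<ge>n0. \<bar>?a m j - ?a n j\<bar> < e / (2 * N)"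
    proof -
      have e': "0 < e / (2 * N)" using e N by simp
      have "\<exists>n0. \<forall>m\<ge>n0. \<forall>n\<ge>n0. \<bar>?a m j - ?a n j\<bar> < e / (2 * N)" for j
        using CauchyD[OF convergent_Cauchy[OF conv[OF N(1), of j]] e'] by simp
      then obtain n0 where n0: "\<And>j m n. m \<ge> n0 j \<Longrightarrow> n \<ge> n0 j \<Longrightarrow> \<bar>?a m j - ?a n j\<bar> < e / (2 * N)" by metis
      have m: "n0 j \<le> (\<Sum>j<N. n0 j)" if "j < N" for j using that by (intro member_le_sum) auto
      show ?thesis
        by (rule exI[of _ "\<Sum>j<N. n0 j"]) (intro allI impI n0 order_trans[OF m])
    qed
    then obtain n0 where n0: "\<And>j m n. j < N \<Longrightarrow> m \<ge> n0 \<Longrightarrow> n \<ge> n0 \<Longrightarrow> \<bar>?a m j - ?a n j\<bar> < e / (2 * N)" by blast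
    have "(LINT x|lborel. norm (u (k m) x - u (k n) x)) < e" if "m \<ge> n0" "n \<ge> n0" for m n
    proof -
      have 1: "(LINT x|lborel. \<bar>u n x - cavg N (u n) x\<bar>) \<le> B / N" for n
        using u[of n] N by (auto simp: tight_def)
      have "(LINT x|lborel. \<bar>cavg N (u (k m)) x - cavg N (u (k n)) x\<bar>) \<le> (\<Sum>j<N. \<bar>?a m j - ?a n j\<bar>)"
        by (rule cavg_diff[OF N(1)])
      also have "\<dots> < (\<Sum>j<N. e / (2 * N))" using n0 that N by (intro sum_strict_mono) auto
      finally have 2: "(LINT x|lborel. \<bar>cavg N (u (k m)) x - cavg N (u (k n)) x\<bar>) < e / 2" using N by simp
      have "(LINT x|lborel. \<bar>u (k m) x - u (k n) x\<bar>) \<le> (LINT x|lborel. \<bar>u (k m) x - cavg N (u (k m)) x\<bar>)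
          + (LINT x|lborel. \<bar>cavg N (u (k m)) x - u (k n) x\<bar>)"
        by (intro L1_triangle ui cavg_integrable N)
      moreover have "(LINT x|lborel. \<bar>cavg N (u (k m)) x - u (k n) x\<bar>) \<le>
          (LINT x|lborel. \<bar>cavg N (u (k m)) x - cavg N (u (k n)) x\<bar>) + (LINT x|lborel. \<bar>cavg N (u (k n)) x - u (k n) x\<bar>)"
        by (intro L1_triangle ui cavg_integrable N)
      ultimately show ?thesis
        using 1[of "k m"] 1[of "k n"] 2 N(2) L1_sym[of "cavg N (u (k n))" "u (k n)"] by simp
    qed
    then show "\<exists>n0. \<forall>i\<ge>n0. \<forall>j\<ge>n0. (LINT x|lborel. norm (u (k i) x - u (k j) x)) < e" by blast
  qed
qed

text \<open>A further subsequence converges almost everywhere, and the bound \<open>M\<close> on the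
  unit interval dominates, so the limit is also one in L^1. The convergence almost everywhere is
  kept in the conclusion because oscillation bounds are passed to the limit with it.\<close>

lemma tight_subseq:
  assumes u: "\<And>n. tight M B (u n)" and S: "\<And>n. dens S (u n)" "S \<in> sets borel"
  obtains k :: "nat \<Rightarrow> nat" and f where "strict_mono k" "dens S f" "tight M B f"
    "(\<lambda>n. LINT x|lborel. \<bar>u (k n) x - f x\<bar>) \<longlonglongrightarrow> 0"
    "AE x in lborel. (\<lambda>n. u (k n) x) \<longlonglongrightarrow> f x"
proof -
  have d: "dens {0..1} (u n)" and M: "AE x in lborel. u n x \<le> M" for n using u by (auto simp: tight_def)
  have ui: "integrable lborel (u n)" for n using d integrable_dens by blast
  note [measurable] = dens_measurable[OF d] and [measurable] = S(2)
  obtain k1 :: "nat \<Rightarrow> nat" where k1: "strict_mono k1"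
    "\<forall>e>0. \<exists>n0. \<forall>i\<ge>n0. \<forall>j\<ge>n0. (LINT x|lborel. norm (u (k1 i) x - u (k1 j) x)) < e"
    using tight_cauchy_subseq[of M B u, OF u] .
  obtain k2 :: "nat \<Rightarrow> nat" where k2: "strict_mono k2" "AE x in lborel. Cauchy (\<lambda>i. u (k1 (k2 i)) x)"
    using cauchy_L1_AE_cauchy_subseq[of lborel "\<lambda>i. u (k1 i)", OF ui k1(2)[rule_format]] .
  define k where "k = k1 \<circ> k2"
  have k: "strict_mono k" unfolding k_def using k1(1) k2(1) by (rule strict_mono_o)
  \<comment> \<open>Truncation at 0 and outside \<open>S\<close> makes the limit a nonnegative
    function supported in \<open>S\<close> at every point, also where the sequence diverges.\<close>
  define f where "f x = (if x \<in> S \<and> x \<in> {0..1} then max 0 (lim (\<lambda>n. u (k n) x)) else 0)" for x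
  have [measurable]: "f \<in> borel_measurable borel" unfolding f_def[abs_def] by measurable
  have AE: "AE x in lborel. (\<lambda>n. u (k n) x) \<longlonglongrightarrow> f x"
    using k2(2)
  proof eventually_elim
    fix x assume "Cauchy (\<lambda>i. u (k1 (k2 i)) x)"
    then have lim: "(\<lambda>n. u (k n) x) \<longlonglongrightarrow> lim (\<lambda>n. u (k n) x)"
      by (simp add: Cauchy_convergent_iff convergent_LIMSEQ_iff k_def)
    show "(\<lambda>n. u (k n) x) \<longlonglongrightarrow> f x"
    proof (cases "x \<in> S \<and> x \<in> {0..1}")
      case True
      have "0 \<le> lim (\<lambda>n. u (k n) x)" using lim dens_nonneg[OF d] by (intro LIMSEQ_le_const[OF lim]) auto
      then show ?thesis using lim True by (simp add: f_def max_def)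
    next
      case False
      then have "u n x = 0" for n using S(1)[of n] d[of n] by (auto simp: dens_def)
      then show ?thesis using False by (simp add: f_def)
    qed
  qed
  have M': "AE x in lborel. \<forall>n. u n x \<le> M" using M by (simp add: AE_all_countable)
  have fM: "AE x in lborel. f x \<le> M"
    using AE M'
  proof eventually_elim
    fix x assume "(\<lambda>n. u (k n) x) \<longlonglongrightarrow> f x" "\<forall>n. u n x \<le> M"
    then show "f x \<le> M" by (auto intro: LIMSEQ_le_const2)
  qed
  have f0: "0 \<le> f x" for x by (simp add: f_def)
  let ?w = "\<lambda>x::real. M * indicator {0..1} x :: real"
  have w: "integrable lborel ?w" by (intro integrable_mult_right integrable_real_indicator) auto
  have fi: "integrable lborel f"
  proof (rule Bochner_Integration.integrable_bound[OF w])
    show "AE x in lborel. norm (f x) \<le> norm (?w x)"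
      using fM by eventually_elim (auto simp: f_def indicator_def)
  qed simp
  have lim: "(\<lambda>n. LINT x|lborel. \<bar>u (k n) x - f x\<bar>) \<longlonglongrightarrow> (LINT x::real|lborel. (0::real))"
  proof (rule integral_dominated_convergence[where w = ?w])
    show "AE x in lborel. (\<lambda>n. \<bar>u (k n) x - f x\<bar>) \<longlonglongrightarrow> 0"
      using AE by eventually_elim (metis LIM_zero_iff tendsto_rabs_zero)
    fix n
    show "AE x in lborel. norm \<bar>u (k n) x - f x\<bar> \<le> ?w x"
      using fM M'
    proof eventually_elim
      fix x assume *: "f x \<le> M" "\<forall>n. u n x \<le> M"
      have out: "u (k n) x = 0" "f x = 0" if "x \<notin> {0..1}" using that d[of "k n"] by (auto simp: dens_def f_def)
      have "u (k n) x \<le> M" using * by simp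
      with *(1) have "\<bar>u (k n) x - f x\<bar> \<le> M"
        using dens_nonneg[OF d, of "k n" x] f0[of x] by linarith
      then show "norm \<bar>u (k n) x - f x\<bar> \<le> ?w x" using out
        by (cases "x \<in> {0..1}") auto
    qed
  qed (use w in auto)
  have "(\<lambda>n. LINT x|lborel. u (k n) x) \<longlonglongrightarrow> (LINT x|lborel. f x)"
  proof (rule LIM_zero_cancel, rule Lim_null_comparison[OF always_eventually])
    show "\<forall>n. norm ((LINT x|lborel. u (k n) x) - (LINT x|lborel. f x)) \<le> (LINT x|lborel. \<bar>u (k n) x - f x\<bar>)"
    proof
      fix n
      have "(LINT x|lborel. u (k n) x) - (LINT x|lborel. f x) = (LINT x|lborel. u (k n) x - f x)"
        using ui fi by simp
      then show "norm ((LINT x|lborel. u (k n) x) - (LINT x|lborel. f x)) \<le> (LINT x|lborel. \<bar>u (k n) x - f x\<bar>)"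
        using integral_abs_bound[of lborel "\<lambda>x. u (k n) x - f x"] by simp
    qed
  qed (use lim in simp)
  moreover have "(LINT x|lborel. u (k n) x) = 1" for n using d by (simp add: dens_def)
  ultimately have "(LINT x|lborel. f x) = 1" by (simp add: LIMSEQ_const_iff)
  then have fd: "dens S f" "dens {0..1} f" using fi f0 by (auto simp: dens_def f_def)
  have lim0: "(\<lambda>n. LINT x|lborel. \<bar>u (k n) x - f x\<bar>) \<longlonglongrightarrow> 0" using lim by simp
  show thesis
    by (rule that[OF k fd(1) tight_limit[OF fd(2) fM u lim0] lim0 AE])
qed

text \<open>Within one cell \<open>f\<close> varies by at most \<open>(exp (D / N) - 1) * M\<close>
  plus the jump mass of that cell. The cells are disjoint, so the jump masses add up to at most
  \<open>m\<close>, and each is multiplied by the cell length \<open>1 / N\<close>.\<close>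

lemma tight_reg:
  assumes f: "dens {0..1} f" "reg D f J" "0 \<le> D" and M: "\<And>x. f x \<le> M"
    and J: "jumps_ok S J" "jint J (\<lambda>_. 1) \<le> m"
  shows "tight M (D * exp D * M + m) f"
  unfolding tight_def
proof (intro conjI allI impI f)
  show "AE x in lborel. f x \<le> M" using M by simp
  fix N :: nat assume "1 \<le> N"
  then have N: "0 < N" by simp
  have M0: "0 \<le> M" using M[of 0] dens_nonneg[OF f(1), of 0] by linarith
  have fi: "integrable lborel f" using f(1) by (rule integrable_dens)
  define k0 where "k0 = (exp (D / N) - 1) * M"
  define ov where "ov k = k0 + jint J (indicator (cell N k))" for k
  have ov: "f y \<le> f x + ov k" if "x \<in> cell N k" "y \<in> cell N k" for x y k
  proof -
    have xy: "\<bar>y - x\<bar> \<le> 1 / N" using that N by (auto simp: cell_def abs_le_iff add_divide_distrib)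
    have e: "exp (D * \<bar>y - x\<bar>) \<le> exp (D / N)" using xy mult_left_mono[OF xy f(3)] by simp
    have "jint J (indicator (closed_segment x y)) \<le> jint J (indicator (cell N k))"
      by (rule jint_mono[OF J(1)]) (use that in \<open>auto simp: indicator_def cell_def closed_segment_eq_real_ivl split: if_splits\<close>)
    then have "f y \<le> exp (D / N) * f x + jint J (indicator (cell N k))"
      using regD[OF f(2), of y x] mult_right_mono[OF e dens_nonneg[OF f(1), of x]] by linarith
    also have "exp (D / N) * f x = f x + (exp (D / N) - 1) * f x" by (simp add: algebra_simps)
    also have "(exp (D / N) - 1) * f x \<le> k0"
      unfolding k0_def using M f(3) by (intro mult_left_mono) auto
    finally show ?thesis by (simp add: ov_def)
  qed
  have pt: "\<bar>f x - cavg N f x\<bar> \<le> ov k" if k: "k < N" "x \<in> cell N k" for x k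
  proof -
    let ?I = "LINT y|lborel. indicator (cell N k) y * f y"
    have c: "cavg N f x = N * ?I" unfolding cavg_def by (rule sum_cell[OF N k])
    have ci: "(LINT y|lborel. indicator (cell N k) y * (a::real)) = a / N" for a
      using N by (simp add: cell_measure)
    have ii: "integrable lborel (\<lambda>y. indicator (cell N k) y * (a::real))" for a
      using N by (intro integrable_mult_left) auto
    have "(LINT y|lborel. indicator (cell N k) y * (f x - ov k)) \<le> ?I"
      by (intro integral_mono ii int_ind fi) (use ov[of _ k x] k in \<open>auto simp: indicator_def algebra_simps\<close>)
    moreover have "?I \<le> (LINT y|lborel. indicator (cell N k) y * (f x + ov k))"
      by (intro integral_mono ii int_ind fi) (use ov[of x k] k in \<open>auto simp: indicator_def algebra_simps\<close>)
    ultimately have "f x - ov k \<le> N * ?I" "N * ?I \<le> f x + ov k"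
      using N unfolding ci by (auto simp: field_simps)
    then show ?thesis unfolding c by (simp add: abs_le_iff)
  qed
  have "(LINT x|lborel. \<bar>f x - cavg N f x\<bar>) \<le> (LINT x|lborel. (\<Sum>k<N. indicator (cell N k) x * ov k))"
  proof (rule integral_mono_AE)
    have "AE x in lborel. x \<noteq> (1::real)" by (rule AE_lborel_singleton)
    then show "AE x in lborel. \<bar>f x - cavg N f x\<bar> \<le> (\<Sum>k<N. indicator (cell N k) x * ov k)"
    proof eventually_elim
      fix x :: real assume x1: "x \<noteq> 1"
      show "\<bar>f x - cavg N f x\<bar> \<le> (\<Sum>k<N. indicator (cell N k) x * ov k)"
      proof (cases "x \<in> {0..1}")
        case True
        then obtain k where "k < N" "x \<in> cell N k" using cell_exists[OF N, of x] x1 by auto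
        then show ?thesis using pt[of k x] sum_cell[OF N, of k x ov] by simp
      next
        case False
        then have "x \<notin> cell N k" if "k < N" for k using cell_sub[OF that] by auto
        then show ?thesis using False f(1) by (auto simp: cavg_def dens_def)
      qed
    qed
  qed (use N fi in \<open>auto intro!: Bochner_Integration.integrable_sum integrable_mult_left cavg_integrable\<close>)
  also have "\<dots> = (\<Sum>k<N. ov k / N)"
    using N by (subst Bochner_Integration.integral_sum) (auto simp: cell_measure intro!: integrable_mult_left)
  also have "\<dots> = k0 + jint J (\<lambda>x. \<Sum>k<N. indicator (cell N k) x) / N"
    using N by (simp add: ov_def add_divide_distrib sum.distrib sum_divide_distrib jint_sum)
  also have "jint J (\<lambda>x. \<Sum>k<N. indicator (cell N k) x) \<le> jint J (\<lambda>_. 1)"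
    by (rule jint_mono[OF J(1)]) (rule sum_cell_le1[OF N])
  also have "\<dots> \<le> m" by (rule J(2))
  also have "k0 \<le> D / N * exp D * M"
  proof -
    have "1 - D / N \<le> exp (- (D / N))" using exp_ge_add_one_self[of "- (D / N)"] by simp
    then have "exp (D / N) * (1 - D / N) \<le> exp (D / N) * exp (- (D / N))" by (intro mult_left_mono) auto
    also have "\<dots> = 1" by (simp add: exp_minus)
    finally have "exp (D / N) - 1 \<le> D / N * exp (D / N)" by (simp add: algebra_simps)
    also have "\<dots> \<le> D / N * exp D" using f(3) N by (intro mult_left_mono) (auto simp: divide_le_eq mult_le_cancel_left1)
    finally show ?thesis unfolding k0_def using M0 by (intro mult_right_mono)
  qed
  finally show "(LINT x|lborel. \<bar>f x - cavg N f x\<bar>) \<le> (D * exp D * M + m) / N"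
    using N by (simp add: divide_right_mono add_divide_distrib)
qed

section \<open>Averages of finitely many densities\<close>

lemma cavg_average:
  assumes u: "\<And>i. i < n \<Longrightarrow> integrable lborel (u i)"
  shows "cavg N (\<lambda>x. (\<Sum>i<n. u i x) / real n) x = (\<Sum>i<n. cavg N (u i) x) / real n"
proof -
  have "(LINT y|lborel. indicator (cell N k) y * ((\<Sum>i<n. u i y) / real n)) =
      (\<Sum>i<n. LINT y|lborel. indicator (cell N k) y * u i y) / real n" for k
  proof -
    have "(LINT y|lborel. indicator (cell N k) y * ((\<Sum>i<n. u i y) / real n)) =
      (LINT y|lborel. (\<Sum>i<n. indicator (cell N k) y * u i y) / real n)"
      by (simp add: sum_distrib_left)
    also have "\<dots> = (\<Sum>i<n. LINT y|lborel. indicator (cell N k) y * u i y) / real n"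
      using u by (subst integral_divide_zero, subst Bochner_Integration.integral_sum) (auto intro!: int_ind)
    finally show ?thesis .
  qed
  then have "cavg N (\<lambda>x. (\<Sum>i<n. u i x) / real n) x =
      (\<Sum>k<N. \<Sum>i<n. indicator (cell N k) x * (real N * (LINT y|lborel. indicator (cell N k) y * u i y)) / real n)"
    by (simp add: cavg_def sum_distrib_left sum_divide_distrib)
  also have "\<dots> = (\<Sum>i<n. \<Sum>k<N. indicator (cell N k) x * (real N * (LINT y|lborel. indicator (cell N k) y * u i y)) / real n)"
    by (rule sum.swap)
  finally show ?thesis by (simp add: cavg_def sum_divide_distrib)
qed

lemma dens_average:
  assumes n: "0 < n" and u: "\<And>i. i < n \<Longrightarrow> dens S (u i)"
  shows "dens S (\<lambda>x. (\<Sum>i<n. u i x) / real n)"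
proof -
  have i: "integrable lborel (u i)" "(LINT x|lborel. u i x) = 1" if "i < n" for i using u[OF that] by (auto simp: dens_def)
  have "(LINT x|lborel. (\<Sum>i<n. u i x) / real n) = 1" using i n by simp
  moreover have "(\<lambda>x. (\<Sum>i<n. u i x) / real n) \<in> borel_measurable borel"
    using u by (intro borel_measurable_divide borel_measurable_sum) (auto simp: dens_def)
  moreover have "integrable lborel (\<lambda>x. (\<Sum>i<n. u i x) / real n)"
    using i by (intro integrable_divide Bochner_Integration.integrable_sum) auto
  ultimately show ?thesis using u unfolding dens_def by (auto intro!: sum_nonneg divide_nonneg_nonneg)
qed

lemma tight_average:
  assumes n: "0 < n" and u: "\<And>i. i < n \<Longrightarrow> tight M B (u i)"
  shows "tight M B (\<lambda>x. (\<Sum>i<n. u i x) / real n)"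
  unfolding tight_def
proof (intro conjI allI impI)
  have d: "dens {0..1} (u i)" if "i < n" for i using u[OF that] by (simp add: tight_def)
  then show "dens {0..1} (\<lambda>x. (\<Sum>i<n. u i x) / real n)" by (rule dens_average[OF n])
  have "AE x in lborel. \<forall>i\<in>{..<n}. u i x \<le> M"
    using u by (intro AE_ball_countable[THEN iffD2]) (auto simp: tight_def)
  then show "AE x in lborel. (\<Sum>i<n. u i x) / real n \<le> M"
  proof eventually_elim
    fix x assume "\<forall>i\<in>{..<n}. u i x \<le> M"
    then have "(\<Sum>i<n. u i x) \<le> (\<Sum>i<n. M)" by (intro sum_mono) auto
    then show "(\<Sum>i<n. u i x) / real n \<le> M" using n by (simp add: divide_le_eq mult.commute)
  qed
  fix N :: nat assume N: "1 \<le> N"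
  have i: "integrable lborel (u i)" if "i < n" for i using d[OF that] by (rule integrable_dens)
  have ci: "integrable lborel (cavg N f)" for f using N by (intro cavg_integrable) auto
  have "(LINT x|lborel. \<bar>(\<Sum>i<n. u i x) / real n - cavg N (\<lambda>x. (\<Sum>i<n. u i x) / real n) x\<bar>)
    \<le> (LINT x|lborel. (\<Sum>i<n. \<bar>u i x - cavg N (u i) x\<bar>) / real n)"
  proof (rule integral_mono)
    fix x
    have "(\<Sum>i<n. u i x) / real n - cavg N (\<lambda>x. (\<Sum>i<n. u i x) / real n) x = (\<Sum>i<n. u i x - cavg N (u i) x) / real n"
      using i by (simp add: cavg_average sum_subtractf diff_divide_distrib)
    also have "\<bar>\<dots>\<bar> \<le> (\<Sum>i<n. \<bar>u i x - cavg N (u i) x\<bar>) / real n"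
      using n by (simp add: divide_right_mono sum_abs)
    finally show "\<bar>(\<Sum>i<n. u i x) / real n - cavg N (\<lambda>x. (\<Sum>i<n. u i x) / real n) x\<bar> \<le> (\<Sum>i<n. \<bar>u i x - cavg N (u i) x\<bar>) / real n" .
  next
    show "integrable lborel (\<lambda>x. \<bar>(\<Sum>i<n. u i x) / real n - cavg N (\<lambda>x. (\<Sum>i<n. u i x) / real n) x\<bar>)"
      using i ci by (intro integrable_abs Bochner_Integration.integrable_diff integrable_divide Bochner_Integration.integrable_sum) auto
    show "integrable lborel (\<lambda>x. (\<Sum>i<n. \<bar>u i x - cavg N (u i) x\<bar>) / real n)"
      using i ci by (intro integrable_divide Bochner_Integration.integrable_sum) auto
  qed
  also have "\<dots> = (\<Sum>i<n. LINT x|lborel. \<bar>u i x - cavg N (u i) x\<bar>) / real n"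
    using i ci by (simp add: Bochner_Integration.integral_sum)
  also have "\<dots> \<le> (\<Sum>i<n. B / N) / real n"
    using u N by (intro divide_right_mono sum_mono) (auto simp: tight_def)
  also have "\<dots> = B / N" using n by simp
  finally show "(LINT x|lborel. \<bar>(\<Sum>i<n. u i x) / real n - cavg N (\<lambda>x. (\<Sum>i<n. u i x) / real n) x\<bar>) \<le> B / N" .
qed

lemma L1_close:
  assumes "integrable lborel f" "integrable lborel g" "B \<in> sets borel"
  shows "\<bar>(LINT x|lborel. indicator B x * f x) - (LINT x|lborel. indicator B x * g x)\<bar> \<le> (LINT x|lborel. \<bar>f x - (g x::real)\<bar>)"
proof -
  have "(LINT x|lborel. indicator B x * f x) - (LINT x|lborel. indicator B x * g x) = (LINT x|lborel. indicator B x * (f x - g x))"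
    using assms by (subst Bochner_Integration.integral_diff[symmetric]) (auto intro!: int_ind simp: right_diff_distrib)
  also have "\<bar>\<dots>\<bar> \<le> (LINT x|lborel. \<bar>indicator B x * (f x - g x)\<bar>)" by (rule integral_abs_bound)
  also have "\<dots> \<le> (LINT x|lborel. \<bar>f x - g x\<bar>)"
    using assms by (intro integral_mono integrable_abs int_ind) (auto simp: indicator_def)
  finally show ?thesis .
qed

text \<open>A bound on the essential oscillation over \<open>U\<close>. One null set serves all
  pairs, so that the property survives changes on null sets and limits almost everywhere.\<close>

definition osc :: "real set \<Rightarrow> real \<Rightarrow> (real \<Rightarrow> real) \<Rightarrow> bool" where
  "osc U e f \<longleftrightarrow> (\<exists>Z\<in>null_sets lborel. \<forall>x\<in>U - Z. \<forall>y\<in>U - Z. f y \<le> f x + e)"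

lemma osc_limit:
  assumes lim: "AE x in lborel. (\<lambda>n. u n x) \<longlonglongrightarrow> f x"
    and u: "\<forall>\<^sub>F n in sequentially. \<forall>x\<in>U. \<forall>y\<in>U. u n y \<le> u n x + e"
  shows "osc U e f"
proof -
  from AE_E[OF lim] obtain Z where Z: "{x \<in> space lborel. \<not> (\<lambda>n. u n x) \<longlonglongrightarrow> f x} \<subseteq> Z" "emeasure lborel Z = 0" "Z \<in> sets lborel"
    by blast
  show ?thesis unfolding osc_def
  proof (intro bexI[of _ Z] ballI)
    fix x y assume xy: "x \<in> U - Z" "y \<in> U - Z"
    then have "(\<lambda>n. u n x) \<longlonglongrightarrow> f x" "(\<lambda>n. u n y) \<longlonglongrightarrow> f y" using Z(1) by auto
    then show "f y \<le> f x + e"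
      by (intro tendsto_le[OF _ tendsto_add[OF _ tendsto_const]]) (use u xy in \<open>auto elim: eventually_mono\<close>)
  qed (use Z in auto)
qed

subsection \<open>Invariant densities\<close>

lemma dens_emeasure:
  assumes f: "dens S f" and A: "A \<in> sets borel"
  shows "emeasure (density lborel (\<lambda>x. ennreal (f x))) A = ennreal (LINT x|lborel. indicator A x * f x)"
proof -
  note [measurable] = dens_measurable[OF f] A
  have "emeasure (density lborel (\<lambda>x. ennreal (f x))) A = (\<integral>\<^sup>+x. ennreal (f x) * indicator A x \<partial>lborel)"
    by (rule emeasure_density) auto
  also have "\<dots> = (\<integral>\<^sup>+x. ennreal (indicator A x * f x) \<partial>lborel)"
    by (intro nn_integral_cong) (auto simp: indicator_def)
  also have "\<dots> = ennreal (LINT x|lborel. indicator A x * f x)"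
    using f by (intro nn_integral_eq_integral int_ind integrable_dens A) (auto simp: dens_def)
  finally show ?thesis .
qed

lemma dens_AE_eq:
  assumes "dens S f" "dens S' g" "density lborel (\<lambda>x. ennreal (f x)) = density lborel (\<lambda>x. ennreal (g x))"
  shows "AE x in lborel. f x = g x"
proof -
  have [measurable]: "f \<in> borel_measurable borel" "g \<in> borel_measurable borel" using assms(1,2) by (auto simp: dens_def)
  have "AE x in lborel. ennreal (f x) = ennreal (g x)"
    using assms(3) sigma_finite_measure.density_unique_iff[OF sigma_finite_lborel, of "\<lambda>x. ennreal (f x)" "\<lambda>x. ennreal (g x)"] by auto
  then show ?thesis by eventually_elim (use assms(1,2) in \<open>auto simp: dens_def\<close>)
qed

lemma dens_integral_full:
  assumes "dens S f" shows "(LINT x|lborel. indicator S x * f x) = 1"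
proof -
  have "(\<lambda>x. indicator S x * f x) = f" using assms by (auto simp: dens_def indicator_def fun_eq_iff)
  then show ?thesis using assms by (simp add: dens_def)
qed

lemma osc_cong_AE:
  assumes "osc U e f" "AE x in lborel. f x = g x"
  shows "osc U e g"
proof -
  obtain Z where Z: "Z \<in> null_sets lborel" "\<forall>x\<in>U - Z. \<forall>y\<in>U - Z. f y \<le> f x + e" using assms(1) by (auto simp: osc_def)
  from AE_E[OF assms(2)] obtain Z' where Z': "{x \<in> space lborel. f x \<noteq> g x} \<subseteq> Z'" "Z' \<in> null_sets lborel"
    by (metis null_setsI)
  show ?thesis unfolding osc_def
  proof (intro bexI[of _ "Z \<union> Z'"] ballI)
    fix x y assume xy: "x \<in> U - (Z \<union> Z')" "y \<in> U - (Z \<union> Z')"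
    then have "f x = g x" "f y = g y" using Z'(1) by auto
    moreover have "f y \<le> f x + e" using Z(2) xy by blast
    ultimately show "g y \<le> g x + e" by simp
  qed (use Z Z' in auto)
qed

lemma tight_cong_AE:
  assumes f: "tight M B f" and eq: "AE x in lborel. f x = g x" and g: "dens {0..1} g"
  shows "tight M B g"
  unfolding tight_def
proof (intro conjI allI impI g)
  note [measurable] = dens_measurable[OF g]
  have fd: "dens {0..1} f" using f by (simp add: tight_def)
  note [measurable] = dens_measurable[OF fd]
  show "AE x in lborel. g x \<le> M" using f eq unfolding tight_def by auto
  fix N :: nat assume N: "1 \<le> N"
  have "(LINT y|lborel. indicator (cell N k) y * f y) = (LINT y|lborel. indicator (cell N k) y * g y)" for k
    by (rule integral_cong_AE) (use eq in \<open>measurable, auto\<close>)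
  then have c: "cavg N f = cavg N g" by (auto simp: cavg_def fun_eq_iff)
  have "(LINT x|lborel. \<bar>g x - cavg N g x\<bar>) = (LINT x|lborel. \<bar>f x - cavg N f x\<bar>)"
    unfolding c by (rule integral_cong_AE) (use eq in \<open>measurable, auto\<close>)
  then show "(LINT x|lborel. \<bar>g x - cavg N g x\<bar>) \<le> B / N" using f N by (auto simp: tight_def)
qed

lemma has_density_dens:
  assumes "prob_space \<mu>" "has_density \<mu> S \<phi>"
  shows "dens S \<phi>"
proof -
  interpret prob_space \<mu> by fact
  have \<phi>: "\<phi> \<in> borel_measurable borel" "\<And>x. 0 \<le> \<phi> x" "\<And>x. x \<notin> S \<Longrightarrow> \<phi> x = 0" "\<mu> = density lborel (\<lambda>x. ennreal (\<phi> x))"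
    using assms(2) by (auto simp: has_density_def)
  have "emeasure \<mu> (space \<mu>) = 1" by (rule emeasure_space_1)
  then have "(\<integral>\<^sup>+x. ennreal (\<phi> x) \<partial>lborel) = ennreal 1" using \<phi> by (simp add: emeasure_density)
  then have "has_bochner_integral lborel \<phi> 1" using \<phi> by (intro has_bochner_integral_nn_integral) auto
  then show ?thesis using \<phi> by (auto simp: dens_def has_bochner_integral_iff)
qed

context pw
begin

text \<open>\<open>T\<close> and \<open>Tm\<close> agree on \<open>S\<close> off the critical
  points. The part of the preimage lying in this finite set is Borel whatever \<open>T\<close> does
  there, and it carries no Lebesgue measure.\<close>

lemma preimage_eq:
  assumes S: "S \<in> sets borel" "S \<subseteq> {0..1}" and A: "A \<in> sets borel"
    and T: "\<And>i x. i < d \<Longrightarrow> x \<in> gap i \<Longrightarrow> T x = E i x"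
  shows "T -` A \<inter> S \<in> sets borel"
    "AE x in lborel. x \<in> S \<longrightarrow> x \<notin> c ` {..d} \<and> T x = Tm x"
    "dens S f \<Longrightarrow> (LINT x|lborel. indicator (T -` A \<inter> S) x * f x) = (LINT x|lborel. indicator A (Tm x) * f x)"
proof -
  have eq: "T x = Tm x" if x: "x \<in> S" "x \<notin> c ` {..d}" for x
  proof -
    from x S obtain i where "i < d" "x \<in> gap i" using gap_exists by blast
    then show ?thesis using T Tm_gap by simp
  qed
  have "T -` A \<inter> S = (Tm -` A \<inter> S \<inter> - (c ` {..d})) \<union> (T -` A \<inter> S \<inter> c ` {..d})"
    using eq by auto
  moreover have "Tm -` A \<in> sets borel" using measurable_sets[OF Tm_measurable A] by simp
  moreover have "T -` A \<inter> S \<inter> c ` {..d} \<in> sets borel" by (intro borel_closed finite_imp_closed) auto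
  moreover have "- (c ` {..d}) \<in> sets borel" by (intro borel_open open_Compl finite_imp_closed) auto
  ultimately show b: "T -` A \<inter> S \<in> sets borel" using S(1) by (metis sets.Int sets.Un)
  have "AE x in lborel. x \<notin> c ` {..d}" by (rule AE_not_in) (auto intro!: finite_imp_null_set_lborel)
  then show ae: "AE x in lborel. x \<in> S \<longrightarrow> x \<notin> c ` {..d} \<and> T x = Tm x"
    by eventually_elim (use eq in auto)
  assume f: "dens S f"
  note [measurable] = b A dens_measurable[OF f]
  show "(LINT x|lborel. indicator (T -` A \<inter> S) x * f x) = (LINT x|lborel. indicator A (Tm x) * f x)"
  proof (rule integral_cong_AE)
    show "AE x in lborel. indicator (T -` A \<inter> S) x * f x = indicator A (Tm x) * f x"
      using ae by eventually_elim (use f in \<open>auto simp: dens_def indicator_def\<close>)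
  qed measurable
qed

lemma acimI:
  assumes S: "S \<in> sets borel" "S \<subseteq> {0..1}" and f: "dens S f"
    and T: "\<And>i x. i < d \<Longrightarrow> x \<in> gap i \<Longrightarrow> T x = E i x"
    and inv: "\<And>A. A \<in> sets borel \<Longrightarrow> (LINT x|lborel. indicator A (Tm x) * f x) = (LINT x|lborel. indicator A x * f x)"
  shows "acim T S (density lborel (\<lambda>x. ennreal (f x)))"
proof -
  note [measurable] = dens_measurable[OF f]
  let ?\<mu> = "density lborel (\<lambda>x. ennreal (f x))"
  have "prob_space ?\<mu>"
    by (rule prob_spaceI) (use dens_emeasure[OF f, of UNIV] f in \<open>simp add: dens_def\<close>)
  moreover have "measure ?\<mu> S = 1"
    using dens_emeasure[OF f S(1)] dens_integral_full[OF f] by (simp add: measure_def)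
  moreover have "emeasure ?\<mu> (T -` A \<inter> S) = emeasure ?\<mu> A" if A: "A \<in> sets borel" for A
    using preimage_eq(1,3)[OF S A T] f inv[OF A] by (simp add: dens_emeasure A)
  ultimately show ?thesis unfolding acim_def by (auto intro!: absolutely_continuousI_density)
qed

lemma acimD:
  assumes S: "S \<in> sets borel" "S \<subseteq> {0..1}" and \<mu>: "acim T S \<mu>" "has_density \<mu> S f"
    and T: "\<And>i x. i < d \<Longrightarrow> x \<in> gap i \<Longrightarrow> T x = E i x"
  shows "dens S f"
    and "\<And>A. A \<in> sets borel \<Longrightarrow> (LINT x|lborel. indicator A (Tm x) * f x) = (LINT x|lborel. indicator A x * f x)"
proof -
  show f: "dens S f" using \<mu> by (intro has_density_dens[of \<mu>]) (auto simp: acim_def)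
  have \<mu>f: "\<mu> = density lborel (\<lambda>x. ennreal (f x))" using \<mu> by (simp add: has_density_def)
  fix A :: "real set" assume A: "A \<in> sets borel"
  have "emeasure \<mu> (T -` A \<inter> S) = emeasure \<mu> A" using \<mu> A by (auto simp: acim_def)
  then have "ennreal (LINT x|lborel. indicator (T -` A \<inter> S) x * f x) = ennreal (LINT x|lborel. indicator A x * f x)"
    unfolding \<mu>f using preimage_eq(1)[OF S A T] A by (simp add: dens_emeasure[OF f])
  then have "(LINT x|lborel. indicator (T -` A \<inter> S) x * f x) = (LINT x|lborel. indicator A x * f x)"
    by (subst (asm) ennreal_inj) (use integral_le_1(1)[OF f preimage_eq(1)[OF S A T]] integral_le_1(1)[OF f A] in auto)
  then show "(LINT x|lborel. indicator A (Tm x) * f x) = (LINT x|lborel. indicator A x * f x)"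
    using preimage_eq(3)[OF S A T f] by simp
qed

end

text \<open>The starting density. Its two jumps have the height of the function, since it vanishes
  outside \<open>{s..t}\<close>.\<close>

lemma reg_indicator:
  assumes "s < t" "0 \<le> D"
  shows "reg D (\<lambda>x. indicator {s..t} x / (t - s)) [(s, 1 / (t - s)), (t, 1 / (t - s))]"
  unfolding reg_def
proof (intro allI)
  fix x y
  have e: "1 \<le> exp (D * \<bar>y - x\<bar>)" using assms by simp
  have *: "0 < 1 / (t - s)" using assms by simp
  have "1 / (t - s) \<le> exp (D * \<bar>y - x\<bar>) * (1 / (t - s))"
    using mult_right_mono[OF e, of "1 / (t - s)"] * by simp
  moreover have "s \<in> closed_segment x y \<or> t \<in> closed_segment x y" if "y \<in> {s..t}" "x \<notin> {s..t}"
    using that by (auto simp: closed_segment_eq_real_ivl split: if_splits)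
  ultimately show "indicator {s..t} y / (t - s) \<le> exp (D * \<bar>y - x\<bar>) * (indicator {s..t} x / (t - s)) +
      jint [(s, 1 / (t - s)), (t, 1 / (t - s))] (indicator (closed_segment x y))"
    using * by (auto simp: indicator_def)
qed

context pw_pot
begin

text \<open>Iterating the normalized Lebesgue measure on \<open>{s..t}\<close> gives densities with
  uniform bounds. A limit of their averages is an invariant density, hence equals
  \<open>\<phi>\<close> almost everywhere by uniqueness, and inherits the bounds. Uniqueness is thus
  what transfers estimates for an explicit orbit to the given density.\<close>

theorem unique_acim_bounds:
  assumes st: "0 \<le> s" "s < t" "t \<le> 1"
    and inv: "\<And>i x. i < d \<Longrightarrow> x \<in> {s..t} \<Longrightarrow> x \<in> gap i \<Longrightarrow> E i x \<in> {s..t}"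
    and T: "\<And>i x. i < d \<Longrightarrow> x \<in> gap i \<Longrightarrow> T x = E i x"
    and uniq: "\<exists>!\<nu>. acim T {s..t} \<nu>" and \<mu>: "acim T {s..t} \<mu>" "has_density \<mu> {s..t} \<phi>"
    and m: "2 * Vm / (t - s) \<le> m"
  shows "tight (supb m) (D * exp D * supb m + Bd m) \<phi>"
    and "\<And>k x1 x2. {x1<..<x2} \<inter> PC k = {} \<Longrightarrow>
      osc {x1<..<x2} ((exp (D * (x2 - x1)) - 1) * supb m + Bd m / lam ^ k) \<phi>"
proof -
  let ?S = "{s..t}"
  have S: "?S \<in> sets borel" "?S \<subseteq> {0..1}" using st by auto
  define f0 where "f0 x = indicator ?S x / (t - s)" for x
  define J0 where "J0 = [(s, 1 / (t - s)), (t, 1 / (t - s))]"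
  define u where "u n = (L ^^ n) f0" for n
  have f0: "dens ?S f0"
    using st unfolding dens_def f0_def[abs_def] by (auto intro!: integrable_divide integrable_real_indicator)
  have r0: "reg D f0 J0" unfolding f0_def[abs_def] J0_def by (rule reg_indicator[OF st(2) D(1)])
  have J0: "jumps_ok {0..1} J0" using st by (auto simp: J0_def jumps_ok_def)
  have "V s \<le> Vm" "V t \<le> Vm" using st Vm by auto
  then have "(V s + V t) / (t - s) \<le> 2 * Vm / (t - s)" using st by (intro divide_right_mono) auto
  then have J0m: "jint J0 V \<le> m" using m by (simp add: J0_def add_divide_distrib)
  have f01: "dens {0..1} f0" using dens_mono[OF f0 S(2)] .
  have uS: "dens ?S (u n)" for n unfolding u_def by (rule dens_pow[OF f0 S(2) inv])
  have u1: "dens {0..1} (u n)" for n using dens_mono[OF uS S(2)] .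
  have usup: "u n x \<le> supb m" and ut: "tight (supb m) (D * exp D * supb m + Bd m) (u n)" for n x
  proof -
    obtain J where J: "reg D (u n) J" "jumps_ok {0..1} J" "jint J V \<le> Bd m"
      using mass_pow[OF f01 r0 J0 J0m, of n] unfolding u_def by blast
    show sup: "u n x \<le> supb m" for x unfolding supb_def using sup_le[OF u1 J] .
    have "jint J (\<lambda>_. 1) \<le> jint J V" by (rule jint_mono[OF J(2)]) (rule V1)
    then have "jint J (\<lambda>_. 1) \<le> Bd m" using J(3) by simp
    then show "tight (supb m) (D * exp D * supb m + Bd m) (u n)"
      using tight_reg[OF u1 J(1) D(1) sup J(2)] by simp
  qed
  \<comment> \<open>The average runs over the iterates from \<open>n + 1\<close> to
    \<open>2 * n + 1\<close>. Starting late ensures that all its terms have been iterated at least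
    \<open>j\<close> times once \<open>n \<ge> j\<close>, as the splitting of jumps demands, and the
    growing length still yields invariance.\<close>
  define a where "a n x = (\<Sum>i<Suc n. u (Suc n + i) x) / real (Suc n)" for n x
  have aS: "dens ?S (a n)" for n unfolding a_def[abs_def] by (intro dens_average uS) auto
  have at: "tight (supb m) (D * exp D * supb m + Bd m) (a n)" for n
    unfolding a_def[abs_def] by (intro tight_average ut) auto
  obtain k f where k: "strict_mono k" and f: "dens ?S f" "tight (supb m) (D * exp D * supb m + Bd m) f"
    and lim: "(\<lambda>n. LINT x|lborel. \<bar>a (k n) x - f x\<bar>) \<longlonglongrightarrow> 0" "AE x in lborel. (\<lambda>n. a (k n) x) \<longlonglongrightarrow> f x"
    by (rule tight_subseq[OF at aS S(1)])
  have ai: "integrable lborel (a n)" for n using integrable_dens[OF aS] .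
  have fi: "integrable lborel f" using integrable_dens[OF f(1)] .
  have "acim T ?S (density lborel (\<lambda>x. ennreal (f x)))"
  proof (rule acimI[OF S f(1) T])
    fix A :: "real set" assume A: "A \<in> sets borel"
    let ?I = "\<lambda>h. LINT x|lborel. indicator A x * h x" and ?J = "\<lambda>h. LINT x|lborel. indicator A (Tm x) * h x"
    have Am: "Tm -` A \<in> sets borel" using measurable_sets[OF Tm_measurable A] by simp
    have Jeq: "?J h = (LINT x|lborel. indicator (Tm -` A) x * h x)" for h :: "real \<Rightarrow> real"
      by (auto intro!: Bochner_Integration.integral_cong simp: indicator_def)
    have step: "?J (u n) = ?I (u (Suc n))" for n
      using L_integral(2)[of "u n" "indicator A" 1] u1[of n] A
      by (auto simp: u_def dens_def indicator_def)
    have avg: "(LINT x|lborel. indicator B x * a n x) = (\<Sum>i<Suc n. LINT x|lborel. indicator B x * u (Suc n + i) x) / real (Suc n)"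
      if "B \<in> sets borel" for B n
    proof -
      have "(LINT x|lborel. indicator B x * a n x) = (LINT x|lborel. (\<Sum>i<Suc n. indicator B x * u (Suc n + i) x) / real (Suc n))"
        unfolding a_def by (simp only: sum_distrib_left times_divide_eq_right)
      also have "\<dots> = (\<Sum>i<Suc n. LINT x|lborel. indicator B x * u (Suc n + i) x) / real (Suc n)"
        by (subst integral_divide_zero, subst Bochner_Integration.integral_sum)
          (auto intro!: int_ind integrable_dens[OF uS] that)
      finally show ?thesis .
    qed
    \<comment> \<open>The averages before and after one application of the map differ by a
      telescoping sum of which two terms remain, both in the unit interval.\<close>
    have bd: "\<bar>?J (a n) - ?I (a n)\<bar> \<le> 1 / real (Suc n)" for n
    proof -
      have "?J (a n) = (\<Sum>i<Suc n. ?I (u (Suc n + Suc i))) / real (Suc n)"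
        unfolding Jeq avg[OF Am] by (simp only: Jeq[symmetric] step add_Suc_right)
      moreover have "?I (a n) = (\<Sum>i<Suc n. ?I (u (Suc n + i))) / real (Suc n)" by (rule avg[OF A])
      moreover have "(\<Sum>i<Suc n. ?I (u (Suc n + Suc i))) - (\<Sum>i<Suc n. ?I (u (Suc n + i))) =
          ?I (u (Suc n + Suc n)) - ?I (u (Suc n + 0))"
        unfolding sum_subtractf[symmetric] by (rule sum_lessThan_telescope)
      ultimately have "?J (a n) - ?I (a n) = (?I (u (Suc n + Suc n)) - ?I (u (Suc n + 0))) / real (Suc n)"
        by (simp only: diff_divide_distrib[symmetric])
      moreover have "\<bar>?I (u (Suc n + Suc n)) - ?I (u (Suc n + 0))\<bar> \<le> 1"
        using integral_le_1[OF uS[of "Suc n + Suc n"] A] integral_le_1[OF uS[of "Suc n + 0"] A] by linarith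
      ultimately show ?thesis by (simp add: divide_right_mono)
    qed
    note close = L1_close[OF ai fi]
    have "\<bar>?J f - ?I f\<bar> \<le> 2 * (LINT x|lborel. \<bar>a (k n) x - f x\<bar>) + 1 / real (Suc n)" for n
    proof -
      have "1 / real (Suc (k n)) \<le> 1 / real (Suc n)" using seq_suble[OF k, of n] by (simp add: frac_le)
      then show ?thesis
        using bd[of "k n"] close[OF A, of "k n"] close[OF Am, of "k n"] unfolding Jeq by linarith
    qed
    moreover have "(\<lambda>n. 2 * (LINT x|lborel. \<bar>a (k n) x - f x\<bar>) + 1 / real (Suc n)) \<longlonglongrightarrow> 2 * 0 + 0"
      by (intro tendsto_intros lim LIMSEQ_Suc[OF lim_1_over_n])
    ultimately have "\<bar>?J f - ?I f\<bar> \<le> 0" by (intro LIMSEQ_le_const[where X = "\<lambda>n. 2 * (LINT x|lborel. \<bar>a (k n) x - f x\<bar>) + 1 / real (Suc n)"]) auto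
    then show "?J f = ?I f" by simp
  qed
  then have "density lborel (\<lambda>x. ennreal (f x)) = \<mu>" using uniq \<mu> by auto
  then have eq: "density lborel (\<lambda>x. ennreal (f x)) = density lborel (\<lambda>x. ennreal (\<phi> x))"
    using \<mu> by (simp add: has_density_def)
  have \<phi>: "dens ?S \<phi>" using \<mu> by (intro has_density_dens[of \<mu>]) (auto simp: acim_def)
  have ae: "AE x in lborel. f x = \<phi> x" by (rule dens_AE_eq[OF f(1) \<phi> eq])
  show "tight (supb m) (D * exp D * supb m + Bd m) \<phi>"
    by (rule tight_cong_AE[OF f(2) ae dens_mono[OF \<phi> S(2)]])
  fix j x1 x2 assume U: "{x1<..<x2} \<inter> PC j = {}"
  let ?e = "(exp (D * (x2 - x1)) - 1) * supb m + Bd m / lam ^ j"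
  have ue: "u n y \<le> u n x + ?e" if n: "n \<ge> j" and xy: "x \<in> {x1<..<x2}" "y \<in> {x1<..<x2}" for n x y
  proof -
    obtain P R where PR: "reg D (u n) (P @ R)" "jumps_ok {0..1} P" "jumps_ok {0..1} R"
      "fst ` set P \<subseteq> PC j" "jint R (\<lambda>_. 1) \<le> Bd m / lam ^ j"
      using split_pow[OF f01 r0 J0 J0m n] unfolding u_def by blast
    have seg: "closed_segment x y \<subseteq> {x1<..<x2}" using xy by (auto simp: closed_segment_eq_real_ivl)
    \<comment> \<open>The recent jumps all lie in \<open>PC j\<close>, which the interval avoids;
      only the small old jumps remain.\<close>
    have "jint P (indicator (closed_segment x y)) = jint P (\<lambda>_. 0)"
      using PR(4) U seg by (intro jint_cong) (auto simp: indicator_def)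
    then have p0: "jint P (indicator (closed_segment x y)) = 0" by (simp add: jint_def)
    have r: "jint R (indicator (closed_segment x y)) \<le> jint R (\<lambda>_. 1)"
      by (rule jint_mono[OF PR(3)]) (auto simp: indicator_def)
    have ex: "exp (D * \<bar>y - x\<bar>) \<le> exp (D * (x2 - x1))"
      using D(1) xy by (auto intro!: mult_left_mono)
    have "exp (D * \<bar>y - x\<bar>) * u n x \<le> exp (D * (x2 - x1)) * u n x"
      using mult_right_mono[OF ex dens_nonneg[OF uS]] .
    also have "\<dots> = u n x + (exp (D * (x2 - x1)) - 1) * u n x" by (simp add: algebra_simps)
    also have "(exp (D * (x2 - x1)) - 1) * u n x \<le> (exp (D * (x2 - x1)) - 1) * supb m"
      using D(1) xy usup by (intro mult_left_mono) auto
    finally show ?thesis using regD[OF PR(1), of y x] p0 r PR(5) by simp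
  qed
  have ae': "a n y \<le> a n x + ?e" if n: "n \<ge> j" and xy: "x \<in> {x1<..<x2}" "y \<in> {x1<..<x2}" for n x y
  proof -
    have "(\<Sum>i<Suc n. u (Suc n + i) y) \<le> (\<Sum>i<Suc n. u (Suc n + i) x + ?e)"
      using n by (intro sum_mono ue xy) auto
    also have "\<dots> = (\<Sum>i<Suc n. u (Suc n + i) x) + real (Suc n) * ?e" by (subst sum.distrib) simp
    finally have "a n y \<le> ((\<Sum>i<Suc n. u (Suc n + i) x) + real (Suc n) * ?e) / real (Suc n)"
      unfolding a_def by (rule divide_right_mono) simp
    also have "\<dots> = a n x + ?e" unfolding a_def by (simp only: add_divide_distrib) simp
    finally show ?thesis .
  qed
  have "osc {x1<..<x2} ?e f"
  proof (rule osc_limit[OF lim(2)])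
    show "\<forall>\<^sub>F n in sequentially. \<forall>x\<in>{x1<..<x2}. \<forall>y\<in>{x1<..<x2}. a (k n) y \<le> a (k n) x + ?e"
      using eventually_ge_at_top[of j]
    proof eventually_elim
      fix n assume "j \<le> n"
      then have "j \<le> k n" using seq_suble[OF k, of n] by simp
      then show "\<forall>x\<in>{x1<..<x2}. \<forall>y\<in>{x1<..<x2}. a (k n) y \<le> a (k n) x + ?e" using ae' by blast
    qed
  qed
  then show "osc {x1<..<x2} ?e \<phi>" by (rule osc_cong_AE[OF _ ae])
qed

end

subsection \<open>Families of maps: shadowing and the jump potential\<close>

text \<open>The filter \<open>at_right 0\<close> is used for statements that persist when
  \<open>\<delta>\<close> shrinks, where one \<open>\<delta>\<close> bounds the parameter, the
  window and the distance at the same time. Finitely many of them then hold together.\<close>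

lemma small_evI:
  assumes "(\<delta>0::real) > 0" "\<And>\<delta>. 0 < \<delta> \<Longrightarrow> \<delta> \<le> \<delta>0 \<Longrightarrow> Q \<delta>"
  shows "eventually Q (at_right 0)"
  unfolding eventually_at_right_field using assms by (intro exI[of _ \<delta>0]) auto

lemma small_evE:
  assumes "eventually Q (at_right (0::real))"
  obtains \<delta> where "\<delta> > 0" "\<And>\<delta>'. 0 < \<delta>' \<Longrightarrow> \<delta>' \<le> \<delta> \<Longrightarrow> Q \<delta>'"
proof -
  obtain b where b: "b > 0" "\<And>y. 0 < y \<Longrightarrow> y < b \<Longrightarrow> Q y" using assms unfolding eventually_at_right_field by auto
  show thesis using b by (intro that[of "b / 2"]) auto
qed

lemma small_evD: "eventually Q (at_right (0::real)) \<Longrightarrow> \<exists>\<delta>>0. Q \<delta>"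
  by (meson small_evE order_refl)

lemma compact_uniform:
  fixes P :: "real \<Rightarrow> real \<Rightarrow> bool"
  assumes K: "compact K" and loc: "\<And>q. q \<in> K \<Longrightarrow> \<exists>\<delta>>0. \<forall>r\<in>K. \<bar>r - q\<bar> < \<delta> \<longrightarrow> P \<delta> r"
    and mono: "\<And>\<delta> \<delta>' r. 0 < \<delta>' \<Longrightarrow> \<delta>' \<le> \<delta> \<Longrightarrow> P \<delta> r \<Longrightarrow> P \<delta>' r"
  shows "\<exists>\<delta>>0. \<forall>r\<in>K. P \<delta> r"
proof -
  from loc obtain D where D: "\<And>q. q \<in> K \<Longrightarrow> 0 < D q" "\<And>q r. q \<in> K \<Longrightarrow> r \<in> K \<Longrightarrow> \<bar>r - q\<bar> < D q \<Longrightarrow> P (D q) r"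
    by metis
  have "K \<subseteq> (\<Union>q\<in>K. ball q (D q))" using D(1) by auto
  then obtain F where F: "F \<subseteq> K" "finite F" "K \<subseteq> (\<Union>q\<in>F. ball q (D q))"
    using compactE_image[OF K, of K "\<lambda>q. ball q (D q)"] by auto
  define m where "m = Min (insert 1 (D ` F))"
  have m: "0 < m" using F D(1) by (auto simp: m_def)
  have "P m r" if r: "r \<in> K" for r
  proof -
    obtain q where q: "q \<in> F" "\<bar>r - q\<bar> < D q" using F(3) r by (auto simp: dist_real_def abs_minus_commute)
    have "m \<le> D q" using q F by (auto simp: m_def)
    then show ?thesis using mono[OF m _ D(2)[of q r]] q F(1) r by auto
  qed
  then show ?thesis using m by blast
qed

section \<open>Pointwise bounds for the jump operator and its iterates\<close>

context pw
begin

lemma Aop_gap: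
  assumes i: "i < d" "r \<in> gap i" and ell: "0 < ell" "\<And>i. i < d \<Longrightarrow> ell \<le> c (Suc i) - c i"
  shows "Aop ell V r = V (E i r) + (if 0 < i \<and> r < c i + ell then V (E i (c i)) else 0) +
    (if Suc i < d \<and> c (Suc i) - ell < r then V (E i (c (Suc i))) else 0)"
proof -
  have r01: "r \<noteq> 0" "r \<noteq> 1"
    using gap_disj_crit[OF i(1), of 0] gap_disj_crit[OF i(1), of d] i(2) c0 cd by auto
  let ?t = "\<lambda>j. (if r \<in> gap j then V (E j r) else 0) +
     (if j = 0 then indicator {0} r else indicator {c j<..<c j + ell} r) * V (E j (c j)) +
     (if Suc j = d then indicator {1} r else indicator {c (Suc j) - ell<..<c (Suc j)} r) * V (E j (c (Suc j)))"
  have z: "?t j = 0" if j: "j \<in> {..<d} - {i}" for j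
  proof -
    have n: "r \<notin> gap j" using gap_unique[of i j r] i j by auto
    have "{c j<..<c j + ell} \<subseteq> gap j" "{c (Suc j) - ell<..<c (Suc j)} \<subseteq> gap j"
      using ell(2)[of j] j by (auto simp: gap_def)
    then have "r \<notin> {c j<..<c j + ell}" "r \<notin> {c (Suc j) - ell<..<c (Suc j)}" using n by blast+
    then have "indicator {c j<..<c j + ell} r = (0::real)" "indicator {c (Suc j) - ell<..<c (Suc j)} r = (0::real)"
      by (simp_all only: indicator_eq_0_iff not_False_eq_True)
    moreover have "indicator {0} r = (0::real)" "indicator {1} r = (0::real)" using r01 by auto
    ultimately show ?thesis using n by (simp only: if_False if_cancel mult_zero_left add_0_right)
  qed
  have "Aop ell V r = ?t i" unfolding Aop_def using i z by (subst sum.remove[of _ i]) auto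
  then show ?thesis using i r01 by (auto simp: indicator_def gap_def)
qed

text \<open>A jump at an interior critical point disappears in the cut and lies in none of the open
  windows; only at 0 and 1 is it passed on, to the one-sided image of that end.\<close>

lemma Aop_crit:
  assumes r: "r = c j" "j \<le> d" and ell: "0 < ell" "\<And>i. i < d \<Longrightarrow> ell \<le> c (Suc i) - c i"
  shows "Aop ell V r = (if j = 0 then V (E 0 0) else if j = d then V (E (d - 1) 1) else 0)"
proof -
  have n: "r \<notin> gap i" if "i < d" for i using gap_disj_crit[OF that r(2)] r by simp
  have n1: "r \<notin> {c i<..<c i + ell}" "r \<notin> {c (Suc i) - ell<..<c (Suc i)}" if "i < d" for i
  proof -
    have "{c i<..<c i + ell} \<subseteq> gap i" "{c (Suc i) - ell<..<c (Suc i)} \<subseteq> gap i"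
      using ell(2)[OF that] by (auto simp: gap_def)
    then show "r \<notin> {c i<..<c i + ell}" "r \<notin> {c (Suc i) - ell<..<c (Suc i)}" using n[OF that] by blast+
  qed
  have r0: "r = 0 \<longleftrightarrow> j = 0" using c_strict[of 0 j] r c0 by (cases "j = 0") auto
  have r1: "r = 1 \<longleftrightarrow> j = d" using c_strict[of j d] r cd by (cases "j = d") auto
  have "Aop ell V r = (\<Sum>i<d. (if i = 0 then if j = 0 then V (E 0 0) else 0 else 0) + (if i = d - 1 then if j = d then V (E (d - 1) 1) else 0 else 0))"
    unfolding Aop_def
  proof (rule sum.cong[OF refl])
    fix i assume "i \<in> {..<d}"
    then have i: "i < d" by simp
    then have "Suc i = d \<longleftrightarrow> i = d - 1" by auto
    then show "(if r \<in> gap i then V (E i r) else 0) +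
     (if i = 0 then indicator {0} r else indicator {c i<..<c i + ell} r) * V (E i (c i)) +
     (if Suc i = d then indicator {1} r else indicator {c (Suc i) - ell<..<c (Suc i)} r) * V (E i (c (Suc i))) =
     (if i = 0 then if j = 0 then V (E 0 0) else 0 else 0) + (if i = d - 1 then if j = d then V (E (d - 1) 1) else 0 else 0)"
      using n[OF i] n1[OF i] r0 r1 c0 cd i by (auto simp: indicator_def)
  qed
  then show ?thesis using d_pos by (auto simp: sum.distrib)
qed

text \<open>Since the branch intervals have length at least \<open>2 * ell\<close>, a point is close
  to at most one end of its interval: at most two of the three terms are present, and away from
  interior critical points only one.\<close>

lemma Aop_bounds:
  assumes r: "r \<in> {0..1}" and ell: "0 < ell" "\<And>i. i < d \<Longrightarrow> 2 * ell \<le> c (Suc i) - c i"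
    and V: "\<And>x. x \<in> {0..1} \<Longrightarrow> 0 \<le> V x"
    and B: "\<And>i x. i < d \<Longrightarrow> x \<in> {c i..c (Suc i)} \<Longrightarrow> \<bar>x - r\<bar> \<le> ell \<Longrightarrow> V (E i x) \<le> B" "0 \<le> B"
  shows "0 \<le> Aop ell V r" "Aop ell V r \<le> 2 * B"
    "(\<And>i. 0 < i \<Longrightarrow> i < d \<Longrightarrow> ell \<le> \<bar>c i - r\<bar>) \<Longrightarrow> Aop ell V r \<le> B"
proof -
  have ell': "\<And>i. i < d \<Longrightarrow> ell \<le> c (Suc i) - c i" using ell(1) ell(2) by force
  have V': "0 \<le> V (E i x)" if "i < d" "x \<in> {c i..c (Suc i)}" for i x using V range[OF that] by auto
  have "0 \<le> Aop ell V r \<and> Aop ell V r \<le> 2 * B \<and> ((\<forall>i. 0 < i \<longrightarrow> i < d \<longrightarrow> ell \<le> \<bar>c i - r\<bar>) \<longrightarrow> Aop ell V r \<le> B)"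
  proof (cases "r \<in> c ` {..d}")
    case True
    then obtain j where j: "r = c j" "j \<le> d" by auto
    have "0 \<le> V (E 0 0)" "j = 0 \<Longrightarrow> V (E 0 0) \<le> B" using V'[of 0 0] B(1)[of 0 0] d_pos c0 c_less[of 0] j ell by auto
    moreover have "0 \<le> V (E (d - 1) 1)" "j = d \<Longrightarrow> V (E (d - 1) 1) \<le> B"
      using V'[of "d - 1" 1] B(1)[of "d - 1" 1] d_pos cd c_less[of "d - 1"] j ell by auto
    ultimately show ?thesis using Aop_crit[OF j ell(1) ell', where V = V] B(2) by auto
  next
    case False
    then obtain i where i: "i < d" "r \<in> gap i" using gap_exists[OF r] by blast
    have ri: "c i < r" "r < c (Suc i)" using i by (auto simp: gap_def)
    have 1: "0 \<le> V (E i r)" "V (E i r) \<le> B" using V'[of i r] B(1)[of i r] i ri ell by auto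
    have 2: "0 \<le> V (E i (c i))" "r < c i + ell \<Longrightarrow> V (E i (c i)) \<le> B"
      using V'[of i "c i"] B(1)[of i "c i"] i ri by auto
    have 3: "0 \<le> V (E i (c (Suc i)))" "c (Suc i) - ell < r \<Longrightarrow> V (E i (c (Suc i))) \<le> B"
      using V'[of i "c (Suc i)"] B(1)[of i "c (Suc i)"] i ri by auto
    have far: "\<not> (r < c i + ell \<and> c (Suc i) - ell < r)" using ell(2)[OF i(1)] by auto
    have "Aop ell V r = V (E i r) + (if 0 < i \<and> r < c i + ell then V (E i (c i)) else 0) +
      (if Suc i < d \<and> c (Suc i) - ell < r then V (E i (c (Suc i))) else 0)"
      by (rule Aop_gap[OF i ell(1)]) (rule ell')
    then show ?thesis
      using 1 2 3 far ri B(2) i by (auto simp: abs_if split: if_splits)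
  qed
  then show "0 \<le> Aop ell V r" "Aop ell V r \<le> 2 * B"
    "(\<And>i. 0 < i \<Longrightarrow> i < d \<Longrightarrow> ell \<le> \<bar>c i - r\<bar>) \<Longrightarrow> Aop ell V r \<le> B" by blast+
qed

lemma Aop_sum: "Aop ell (\<lambda>x. \<Sum>n\<in>I. a n * f n x) r = (\<Sum>n\<in>I. a n * Aop ell (f n) r)"
proof -
  have "Aop ell (\<lambda>x. \<Sum>n\<in>I. a n * f n x) r = (\<Sum>i<d. \<Sum>n\<in>I. a n * ((if r \<in> gap i then f n (E i r) else 0) +
     (if i = 0 then indicator {0} r else indicator {c i<..<c i + ell} r) * f n (E i (c i)) +
     (if Suc i = d then indicator {1} r else indicator {c (Suc i) - ell<..<c (Suc i)} r) * f n (E i (c (Suc i)))))"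
    unfolding Aop_def
    by (intro sum.cong refl) (auto simp: sum.distrib ring_distribs sum_distrib_left mult_ac)
  then show ?thesis by (subst (asm) sum.swap) (simp add: Aop_def sum_distrib_left)
qed

lemma Aop_pow_bounds:
  assumes ell: "0 < ell" "\<And>i. i < d \<Longrightarrow> 2 * ell \<le> c (Suc i) - c i" and r: "r \<in> {0..1}"
  shows "0 \<le> (Aop ell ^^ n) (\<lambda>_. 1) r \<and> (Aop ell ^^ n) (\<lambda>_. 1) r \<le> 2 ^ n"
  using r
proof (induction n arbitrary: r)
  case (Suc n)
  have "0 \<le> Aop ell ((Aop ell ^^ n) (\<lambda>_. 1)) r" "Aop ell ((Aop ell ^^ n) (\<lambda>_. 1)) r \<le> 2 * 2 ^ n"
    by (rule Aop_bounds[OF Suc.prems ell], use Suc.IH range in auto)+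
  then show ?case by simp
qed auto

text \<open>A geometrically weighted sum of iterates turns the bound on the \<open>N\<close>-th iterate of
  \<open>Aop\<close> into a one-step bound.\<close>

lemma potential_exists:
  assumes ell: "0 < ell" "\<And>i. i < d \<Longrightarrow> 2 * ell \<le> c (Suc i) - c i"
    and kap: "1 < kap" "kap < lam" and N: "0 < N"
    and A: "\<And>r. r \<in> {0..1} \<Longrightarrow> (Aop ell ^^ N) (\<lambda>_. 1) r \<le> kap ^ N"
  shows "\<exists>V. pw_pot d c E E' lam K ell kap (2 ^ N) V"
proof -
  let ?A = "\<lambda>n. (Aop ell ^^ n) (\<lambda>_. 1)"
  define V where "V r = (\<Sum>n<N. (1 / kap ^ n) * ?A n r)" for r
  have nn: "0 \<le> ?A n r" "?A n r \<le> 2 ^ n" if "r \<in> {0..1}" for n r using Aop_pow_bounds[OF ell that, of n] by auto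
  have "pw_pot d c E E' lam K ell kap (2 ^ N) V"
  proof (intro pw_pot.intro pw_axioms pw_pot_axioms.intro)
    fix r :: real assume r: "r \<in> {0..1}"
    have "1 = (1 / kap ^ 0) * ?A 0 r" by simp
    also have "\<dots> \<le> V r" unfolding V_def
      using N nn[OF r] kap by (intro member_le_sum) auto
    finally show "1 \<le> V r" .
    have "(1 / kap ^ n) * ?A n r \<le> 1 * 2 ^ n" for n
      using nn[OF r, of n] kap by (intro mult_mono) (auto simp: divide_le_eq one_le_power)
    then have "V r \<le> (\<Sum>n<N. 2 ^ n)" unfolding V_def by (intro sum_mono) simp
    also have "\<dots> \<le> 2 ^ N" by (induction N) auto
    finally show "V r \<le> 2 ^ N" .
    have V1: "Aop ell V r = (\<Sum>n<N. (1 / kap ^ n) * ?A (Suc n) r)"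
      unfolding V_def[abs_def] by (subst Aop_sum) simp
    have eq: "1 / kap ^ n * x = kap * (1 / kap ^ Suc n * x)" for n and x :: real using kap by simp
    have V2: "Aop ell V r = kap * (\<Sum>n<N. (1 / kap ^ Suc n) * ?A (Suc n) r)"
      unfolding V1 sum_distrib_left by (intro sum.cong refl eq)
    also have "(\<Sum>n<N. (1 / kap ^ Suc n) * ?A (Suc n) r) = V r - 1 + (1 / kap ^ N) * ?A N r"
      unfolding V_def using sum.lessThan_Suc_shift[of "\<lambda>n. (1 / kap ^ n) * ?A n r" N]
        sum.lessThan_Suc[of "\<lambda>n. (1 / kap ^ n) * ?A n r" N] by simp
    also have "(1 / kap ^ N) * ?A N r \<le> 1" using A[OF r] kap by (simp add: divide_le_eq)
    finally show "Aop ell V r \<le> kap * V r" using kap by simp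
  qed (use ell kap in \<open>force+\<close>)
  then show ?thesis by blast
qed

end

section \<open>Perturbed orbits near multivalued orbits of the unperturbed map\<close>

locale pw_family =
  fixes d :: nat and c :: "nat \<Rightarrow> real \<Rightarrow> real" and E E' :: "nat \<Rightarrow> real \<Rightarrow> real \<Rightarrow> real"
    and lam K e0 :: real and T :: "real \<Rightarrow> real \<Rightarrow> real"
  assumes e0: "0 < e0"
    and pw: "\<And>e. 0 \<le> e \<Longrightarrow> e < e0 \<Longrightarrow> pw d (\<lambda>i. c i e) (\<lambda>i. E i e) (\<lambda>i. E' i e) lam K"
    and T_E: "\<And>e i x. 0 \<le> e \<Longrightarrow> e < e0 \<Longrightarrow> i < d \<Longrightarrow> x \<in> {c i e<..<c (Suc i) e} \<Longrightarrow> T e x = E i e x"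
    and c_near: "\<And>\<eta>. 0 < \<eta> \<Longrightarrow> \<exists>\<delta>>0. \<forall>e\<in>{0..<\<delta>}. \<forall>i\<le>d. \<bar>c i e - c i 0\<bar> < \<eta>"
    and E_near: "\<And>i \<eta>. i < d \<Longrightarrow> 0 < \<eta> \<Longrightarrow> \<exists>\<delta>>0. \<forall>e\<in>{0..<\<delta>}. \<forall>r\<in>{c i e..c (Suc i) e}.
      \<forall>q\<in>{c i 0..c (Suc i) 0}. \<bar>r - q\<bar> < \<delta> \<longrightarrow> \<bar>E i e r - E i 0 q\<bar> < \<eta>"
begin

interpretation Z: pw d "\<lambda>i. c i 0" "\<lambda>i. E i 0" "\<lambda>i. E' i 0" lam K using pw e0 by simp

text \<open>The one-sided values of the unperturbed map.\<close>

definition mv :: "real \<Rightarrow> real set" where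
  "mv q = {E i 0 q | i. i < d \<and> q \<in> {c i 0..c (Suc i) 0}}"

definition Mv :: "real set \<Rightarrow> real set" where "Mv A = (\<Union>q\<in>A. mv q)"

lemma mv_finite: "finite (mv q)" unfolding mv_def by simp

lemma mv_range: "mv q \<subseteq> {0..1}" unfolding mv_def using Z.range by auto

lemma c_near_ev:
  assumes "0 < \<eta>"
  shows "\<forall>\<^sub>F \<delta> in at_right 0. \<forall>e\<in>{0..<\<delta>}. \<forall>i\<le>d. \<bar>c i e - c i 0\<bar> < \<eta>"
proof -
  obtain \<delta>0 where "\<delta>0 > 0" "\<forall>e\<in>{0..<\<delta>0}. \<forall>i\<le>d. \<bar>c i e - c i 0\<bar> < \<eta>" using c_near[OF assms] by blast
  then show ?thesis by (intro small_evI[of \<delta>0]) auto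
qed

text \<open>If \<open>q\<close> belongs to the closed \<open>i\<close>-th interval, this is joint
  continuity of the branch. Otherwise that interval, which moves continuously, keeps a positive
  distance from \<open>q\<close>. At a critical point both adjacent branches have to be allowed,
  hence the set \<open>mv q\<close>.\<close>

lemma shadow:
  assumes \<eta>: "0 < \<eta>"
  shows "\<forall>\<^sub>F \<delta> in at_right 0. \<forall>e\<in>{0..<\<delta>}. \<forall>i<d. \<forall>r\<in>{c i e..c (Suc i) e}. \<bar>r - q\<bar> < \<delta> \<longrightarrow>
    (\<exists>y\<in>mv q. \<bar>E i e r - y\<bar> < \<eta>)"
proof -
  have "\<forall>\<^sub>F \<delta> in at_right 0. \<forall>e\<in>{0..<\<delta>}. \<forall>r\<in>{c i e..c (Suc i) e}. \<bar>r - q\<bar> < \<delta> \<longrightarrow>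
    (\<exists>y\<in>mv q. \<bar>E i e r - y\<bar> < \<eta>)" if i: "i \<in> {..<d}" for i
  proof (cases "q \<in> {c i 0..c (Suc i) 0}")
    case True
    obtain \<delta>0 where \<delta>0: "\<delta>0 > 0" "\<forall>e\<in>{0..<\<delta>0}. \<forall>r\<in>{c i e..c (Suc i) e}.
      \<forall>q\<in>{c i 0..c (Suc i) 0}. \<bar>r - q\<bar> < \<delta>0 \<longrightarrow> \<bar>E i e r - E i 0 q\<bar> < \<eta>" using E_near[OF _ \<eta>, of i] i by auto
    have "E i 0 q \<in> mv q" using i True by (auto simp: mv_def)
    show ?thesis
    proof (rule small_evI[OF \<delta>0(1)], intro ballI impI)
      fix \<delta> e r assume *: "\<delta> \<le> \<delta>0" "e \<in> {0..<\<delta>}" "r \<in> {c i e..c (Suc i) e}" "\<bar>r - q\<bar> < \<delta>"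
      then have "\<bar>E i e r - E i 0 q\<bar> < \<eta>" using \<delta>0(2) True by auto
      then show "\<exists>y\<in>mv q. \<bar>E i e r - y\<bar> < \<eta>" using \<open>E i 0 q \<in> mv q\<close> by blast
    qed
  next
    case False
    define h where "h = max (c i 0 - q) (q - c (Suc i) 0)"
    have h: "0 < h" using False by (auto simp: h_def)
    have "\<forall>\<^sub>F \<delta> in at_right 0. \<delta> < h / 2" using h by (intro small_evI[of "h/4"]) auto
    then show ?thesis using c_near_ev[of "h / 2", OF divide_pos_pos[OF h zero_less_numeral]]
    proof eventually_elim
      case (elim \<delta>)
      have "\<not> \<bar>r - q\<bar> < \<delta>" if "e \<in> {0..<\<delta>}" "r \<in> {c i e..c (Suc i) e}" for e r
      proof -
        have "\<bar>c i e - c i 0\<bar> < h / 2" "\<bar>c (Suc i) e - c (Suc i) 0\<bar> < h / 2" using elim(2) that(1) i by auto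
        moreover have "h = c i 0 - q \<or> h = q - c (Suc i) 0" by (auto simp: h_def)
        ultimately show ?thesis using that(2) elim(1) by (smt (verit) atLeastAtMost_iff field_sum_of_halves)
      qed
      then show ?case by blast
    qed
  qed
  then have "\<forall>\<^sub>F \<delta> in at_right 0. \<forall>i\<in>{..<d}. \<forall>e\<in>{0..<\<delta>}. \<forall>r\<in>{c i e..c (Suc i) e}. \<bar>r - q\<bar> < \<delta> \<longrightarrow>
    (\<exists>y\<in>mv q. \<bar>E i e r - y\<bar> < \<eta>)" by (intro eventually_ball_finite) auto
  then show ?thesis by eventually_elim auto
qed

definition PCe :: "nat \<Rightarrow> real \<Rightarrow> real set" where
  "PCe m e = pw.PC d (\<lambda>i. c i e) (\<lambda>i. E i e) m"

text \<open>Images under 1 to \<open>m\<close> steps, all one-sided values being followed: a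
  perturbed orbit may pass a critical point of the limit map on either side.\<close>

definition G :: "nat \<Rightarrow> real set" where
  "G m = (\<Union>j\<in>{1..m}. (Mv ^^ j) ((\<lambda>i. c i 0) ` {..d}))"

lemma Mv_pow_finite: "finite A \<Longrightarrow> finite ((Mv ^^ j) A)"
  by (induction j) (auto simp: Mv_def mv_finite)

lemma G_finite: "finite (G m)" unfolding G_def by (auto intro: Mv_pow_finite)

lemma mv_G: "q \<in> G m \<Longrightarrow> mv q \<subseteq> G (Suc m)"
proof -
  assume "q \<in> G m"
  then obtain j where "j \<in> {1..m}" "q \<in> (Mv ^^ j) ((\<lambda>i. c i 0) ` {..d})" by (auto simp: G_def)
  then have "Suc j \<in> {1..Suc m}" "mv q \<subseteq> (Mv ^^ Suc j) ((\<lambda>i. c i 0) ` {..d})" by (auto simp: Mv_def)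
  then show ?thesis unfolding G_def by blast
qed

lemma mv_crit_G: "i \<le> d \<Longrightarrow> mv (c i 0) \<subseteq> G (Suc m)"
proof -
  assume "i \<le> d"
  then have "mv (c i 0) \<subseteq> (Mv ^^ 1) ((\<lambda>i. c i 0) ` {..d})" by (auto simp: Mv_def)
  moreover have "1 \<in> {1..Suc m}" by simp
  ultimately show ?thesis unfolding G_def by blast
qed

text \<open>A point of \<open>PCe\<close> arises from a critical point of the perturbed map or from
  an earlier point of \<open>PCe\<close>; by induction both are close to points whose values
  \<open>mv\<close> lie in \<open>G (Suc m)\<close>.\<close>

lemma PC_near:
  assumes "0 < \<eta>"
  shows "\<forall>\<^sub>F \<delta> in at_right 0. \<forall>e\<in>{0..<\<delta>}. \<forall>p\<in>PCe m e. \<exists>y\<in>G m. \<bar>p - y\<bar> < \<eta>"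
  using assms
proof (induction m arbitrary: \<eta>)
  case 0
  have "\<forall>\<^sub>F \<delta> in at_right (0::real). \<delta> < e0" using e0 by (intro small_evI[of "e0/2"]) auto
  then show ?case
  proof eventually_elim
    case (elim \<delta>)
    show ?case
    proof
      fix e assume "e \<in> {0..<\<delta>}"
      then interpret P: pw d "\<lambda>i. c i e" "\<lambda>i. E i e" "\<lambda>i. E' i e" lam K using pw elim by auto
      show "\<forall>p\<in>PCe 0 e. \<exists>y\<in>G 0. \<bar>p - y\<bar> < \<eta>" by (simp add: PCe_def)
    qed
  qed
next
  case (Suc m)
  have "\<forall>\<^sub>F \<delta> in at_right 0. \<forall>q\<in>G m \<union> (\<lambda>i. c i 0) ` {..d}. \<forall>e\<in>{0..<\<delta>}. \<forall>i<d. \<forall>r\<in>{c i e..c (Suc i) e}. \<bar>r - q\<bar> < \<delta> \<longrightarrow>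
    (\<exists>y\<in>mv q. \<bar>E i e r - y\<bar> < \<eta>)"
    using G_finite by (intro eventually_ball_finite ballI shadow Suc.prems) auto
  then obtain \<delta>1 where \<delta>1: "\<delta>1 > 0" "\<And>q e i r. q \<in> G m \<union> (\<lambda>i. c i 0) ` {..d} \<Longrightarrow> e \<in> {0..<\<delta>1} \<Longrightarrow> i < d \<Longrightarrow>
     r \<in> {c i e..c (Suc i) e} \<Longrightarrow> \<bar>r - q\<bar> < \<delta>1 \<Longrightarrow> \<exists>y\<in>mv q. \<bar>E i e r - y\<bar> < \<eta>"
    by (elim small_evE) (metis order_refl)
  have "\<forall>\<^sub>F \<delta> in at_right (0::real). \<delta> \<le> min e0 \<delta>1" using e0 \<delta>1 by (intro small_evI[of "min e0 \<delta>1"]) auto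
  then show ?case using Suc.IH[OF \<delta>1(1)] c_near_ev[OF \<delta>1(1)]
  proof eventually_elim
    case (elim \<delta>)
    show ?case
    proof (intro ballI)
      fix e p assume e: "e \<in> {0..<\<delta>}" and p: "p \<in> PCe (Suc m) e"
      interpret P: pw d "\<lambda>i. c i e" "\<lambda>i. E i e" "\<lambda>i. E' i e" lam K using pw e elim by auto
      from p obtain i r where ir: "i < d" "p = E i e r" "r \<in> {c i e, c (Suc i) e} \<or> r \<in> PCe m e \<inter> P.gap i"
        by (auto simp: PCe_def)
      have rI: "r \<in> {c i e..c (Suc i) e}" using ir P.c_less[OF ir(1)] by (auto simp: P.gap_def)
      have "\<exists>q \<in> G m \<union> (\<lambda>i. c i 0) ` {..d}. \<bar>r - q\<bar> < \<delta>1 \<and> mv q \<subseteq> G (Suc m)"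
        using ir(3)
      proof (elim disjE)
        assume "r \<in> {c i e, c (Suc i) e}"
        then obtain j where "j \<le> d" "r = c j e" using ir(1)
          by (metis Suc_leI insert_iff less_imp_le_nat singletonD)
        then show ?thesis using elim(3) e mv_crit_G by (intro bexI[of _ "c j 0"]) auto
      next
        assume "r \<in> PCe m e \<inter> P.gap i"
        then obtain y where "y \<in> G m" "\<bar>r - y\<bar> < \<delta>1" using elim(2) e by blast
        then show ?thesis using mv_G by (intro bexI[of _ y]) auto
      qed
      then obtain q where q: "q \<in> G m \<union> (\<lambda>i. c i 0) ` {..d}" "\<bar>r - q\<bar> < \<delta>1" "mv q \<subseteq> G (Suc m)" by blast
      have "e \<in> {0..<\<delta>1}" using e elim(1) by auto
      from \<delta>1(2)[OF q(1) this ir(1) rI q(2)] show "\<exists>y\<in>G (Suc m). \<bar>p - y\<bar> < \<eta>" using q(3) ir(2) by blast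
    qed
  qed
qed

section \<open>Counting doublings along orbits, uniformly in the parameter\<close>

definition Ae :: "real \<Rightarrow> real \<Rightarrow> (real \<Rightarrow> real) \<Rightarrow> real \<Rightarrow> real" where
  "Ae e = pw.Aop d (\<lambda>i. c i e) (\<lambda>i. E i e)"

lemma gaps_ev: "\<forall>\<^sub>F \<delta> in at_right 0. \<forall>e\<in>{0..<\<delta>}. \<forall>i<d. 2 * \<delta> \<le> c (Suc i) e - c i e"
proof -
  define g where "g = Min ((\<lambda>i. c (Suc i) 0 - c i 0) ` {..<d})"
  have g: "0 < g" "\<And>i. i < d \<Longrightarrow> g \<le> c (Suc i) 0 - c i 0"
  proof -
    have ne: "(\<lambda>i. c (Suc i) 0 - c i 0) ` {..<d} \<noteq> {}" using Z.d_pos by auto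
    show "0 < g" unfolding g_def by (subst Min_gr_iff) (use ne Z.c_less in auto)
    show "g \<le> c (Suc i) 0 - c i 0" if "i < d" for i unfolding g_def using that by (intro Min_le) auto
  qed
  have "\<forall>\<^sub>F \<delta> in at_right (0::real). \<delta> \<le> g / 4" using g by (intro small_evI[of "g/4"]) auto
  then show ?thesis using c_near_ev[of "g / 4", OF divide_pos_pos[OF g(1) zero_less_numeral]]
  proof eventually_elim
    case (elim \<delta>)
    show ?case
    proof (intro ballI allI impI)
      fix e i assume *: "e \<in> {0..<\<delta>}" "i < d"
      then have "\<bar>c i e - c i 0\<bar> < g / 4" "\<bar>c (Suc i) e - c (Suc i) 0\<bar> < g / 4" using elim(2) by auto
      then show "2 * \<delta> \<le> c (Suc i) e - c i e" using g(2)[OF *(2)] elim(1) by linarith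
    qed
  qed
qed

definition Ci :: "real set" where "Ci = {c i 0 | i. 0 < i \<and> i < d}"

text \<open>The term \<open>j = 0\<close> counts \<open>q\<close> itself, so that leaving an
  interior critical point removes it from the set when no such point is periodic.\<close>

definition reach :: "real \<Rightarrow> real set" where "reach q = (\<Union>j. (Mv ^^ j) {q}) \<inter> Ci"

lemma Ci_finite: "finite Ci" and Ci_card: "card Ci \<le> d"
proof -
  have e: "Ci = (\<lambda>i. c i 0) ` {0<..<d}" by (auto simp: Ci_def)
  show "finite Ci" unfolding e by simp
  show "card Ci \<le> d" unfolding e using card_image_le[of "{0<..<d}" "\<lambda>i. c i 0"] by simp
qed

lemma reach_finite: "finite (reach q)" and reach_card: "card (reach q) \<le> d"
  using Ci_finite Ci_card card_mono[of Ci "reach q"] by (auto simp: reach_def)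

lemma Mv_mono1: "A \<subseteq> B \<Longrightarrow> Mv A \<subseteq> Mv B"
  unfolding Mv_def by blast

lemma Mv_mono: "A \<subseteq> B \<Longrightarrow> (Mv ^^ j) A \<subseteq> (Mv ^^ j) B"
proof (induction j)
  case (Suc j)
  then show ?case by (simp add: Mv_mono1)
qed auto

lemma Mv_pow_mv: "y \<in> mv q \<Longrightarrow> (Mv ^^ j) {y} \<subseteq> (Mv ^^ Suc j) {q}"
proof -
  assume "y \<in> mv q"
  then have "{y} \<subseteq> Mv {q}" by (simp add: Mv_def)
  from Mv_mono[OF this, of j] show ?thesis by (simp add: funpow_swap1)
qed

lemma reach_mv: "y \<in> mv q \<Longrightarrow> reach y \<subseteq> reach q"
  using Mv_pow_mv unfolding reach_def by blast

text \<open>The number of jumps spawned along an orbit at most doubles at each visit close to an interior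
  critical point, and, without periodic critical points, each of these is visited at most once.\<close>

lemma A_pow_reach:
  assumes np: "\<And>x n. x \<in> Ci \<Longrightarrow> 0 < n \<Longrightarrow> x \<notin> (Mv ^^ n) {x}" and q: "q \<in> {0..1}"
  shows "\<forall>\<^sub>F \<delta> in at_right 0. \<forall>e\<in>{0..<\<delta>}. \<forall>ell. 0 < ell \<and> ell < \<delta> \<longrightarrow> (\<forall>r\<in>{0..1}. \<bar>r - q\<bar> < \<delta> \<longrightarrow>
    (Ae e ell ^^ n) (\<lambda>_. 1) r \<le> 2 ^ card (reach q))"
  using q
proof (induction n arbitrary: q)
  case 0
  show ?case by (rule always_eventually) auto
next
  case (Suc n)
  have "\<forall>\<^sub>F \<delta> in at_right 0. \<forall>y\<in>mv q. \<forall>e\<in>{0..<\<delta>}. \<forall>ell. 0 < ell \<and> ell < \<delta> \<longrightarrow> (\<forall>r\<in>{0..1}. \<bar>r - y\<bar> < \<delta> \<longrightarrow>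
    (Ae e ell ^^ n) (\<lambda>_. 1) r \<le> 2 ^ card (reach y))"
    using mv_range by (intro eventually_ball_finite mv_finite ballI Suc.IH) blast
  then obtain \<delta>1 where \<delta>1: "\<delta>1 > 0" "\<And>y e ell r. y \<in> mv q \<Longrightarrow> e \<in> {0..<\<delta>1} \<Longrightarrow> 0 < ell \<Longrightarrow> ell < \<delta>1 \<Longrightarrow>
      r \<in> {0..1} \<Longrightarrow> \<bar>r - y\<bar> < \<delta>1 \<Longrightarrow> (Ae e ell ^^ n) (\<lambda>_. 1) r \<le> 2 ^ card (reach y)"
    by (elim small_evE) (metis order_refl)
  obtain \<delta>2 where \<delta>2: "\<delta>2 > 0" "\<And>e i r. e \<in> {0..<\<delta>2} \<Longrightarrow> i < d \<Longrightarrow> r \<in> {c i e..c (Suc i) e} \<Longrightarrow> \<bar>r - q\<bar> < \<delta>2 \<Longrightarrow>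
    \<exists>y\<in>mv q. \<bar>E i e r - y\<bar> < \<delta>1"
    using shadow[OF \<delta>1(1), of q] by (elim small_evE) (metis order_refl)
  \<comment> \<open>\<open>h\<close> keeps all interior critical points other than \<open>q\<close>
    out of the windows around points near \<open>q\<close>.\<close>
  define h where "h = Min (insert 1 ((\<lambda>x. \<bar>x - q\<bar>) ` (Ci - {q})))"
  have h: "0 < h" "\<And>x. x \<in> Ci \<Longrightarrow> x \<noteq> q \<Longrightarrow> h \<le> \<bar>x - q\<bar>" using Ci_finite by (auto simp: h_def)
  have "\<forall>\<^sub>F \<delta> in at_right (0::real). \<delta> \<le> min (min e0 \<delta>1) (min (\<delta>2 / 2) (h / 4))"
    using e0 \<delta>1 \<delta>2 h by (intro small_evI[of "min (min e0 \<delta>1) (min (\<delta>2 / 2) (h / 4))"]) auto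
  then show ?case using gaps_ev c_near_ev[of "h / 4", OF divide_pos_pos[OF h(1) zero_less_numeral]]
  proof eventually_elim
    case (elim \<delta>)
    show ?case
    proof (intro ballI allI impI)
      fix e ell r assume e: "e \<in> {0..<\<delta>}" and ell: "0 < ell \<and> ell < \<delta>" and r: "r \<in> {0..1}" "\<bar>r - q\<bar> < \<delta>"
      interpret P: pw d "\<lambda>i. c i e" "\<lambda>i. E i e" "\<lambda>i. E' i e" lam K using pw e elim by auto
      let ?f = "(Ae e ell ^^ n) (\<lambda>_. 1)"
      have ell2: "2 * ell \<le> c (Suc i) e - c i e" if "i < d" for i using elim(2) e ell that by force
      have f0: "0 \<le> ?f x" if "x \<in> {0..1}" for x using P.Aop_pow_bounds[of ell x n] ell ell2 that by (auto simp: Ae_def)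
      \<comment> \<open>The bound at the images of points near \<open>q\<close>. If \<open>q\<close>
        is an interior critical point, its images reach fewer such points, since \<open>q\<close>
        itself is lost, which compensates the factor 2; otherwise no window at an interior critical
        point is met and no doubling occurs.\<close>
      define B where "B = (if q \<in> Ci then 2 ^ (card (reach q) - 1) else 2 ^ card (reach q) :: real)"
      have fB: "?f (E i e x) \<le> B" if x: "i < d" "x \<in> {c i e..c (Suc i) e}" "\<bar>x - r\<bar> \<le> ell" for i x
      proof -
        have "\<bar>x - q\<bar> < \<delta>2" "e \<in> {0..<\<delta>2}" using x(3) r(2) ell elim(1) e by auto
        then obtain y where y: "y \<in> mv q" "\<bar>E i e x - y\<bar> < \<delta>1" using \<delta>2(2)[of e i x] x by auto
        have "?f (E i e x) \<le> 2 ^ card (reach y)"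
          using \<delta>1(2)[OF y(1), of e ell "E i e x"] y(2) P.range[OF x(1,2)] ell e elim(1) by auto
        also have "\<dots> \<le> B"
        proof (cases "q \<in> Ci")
          case True
          have "q \<notin> reach y"
          proof
            assume "q \<in> reach y"
            then obtain j where "q \<in> (Mv ^^ j) {y}" by (auto simp: reach_def)
            then have "q \<in> (Mv ^^ Suc j) {q}" using Mv_pow_mv[OF y(1)] by blast
            then show False using np[OF True, of "Suc j"] by simp
          qed
          moreover have "q \<in> reach q" using True unfolding reach_def by (auto intro!: exI[of _ 0])
          ultimately have "reach y \<subset> reach q" using reach_mv[OF y(1)] by blast
          then have "card (reach y) < card (reach q)" by (rule psubset_card_mono[OF reach_finite])
          then show ?thesis using True by (simp add: B_def)
        next
          case False
          have "card (reach y) \<le> card (reach q)" by (rule card_mono[OF reach_finite reach_mv[OF y(1)]])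
          then show ?thesis using False by (simp add: B_def)
        qed
        finally show ?thesis .
      qed
      have B0: "0 \<le> B" by (simp add: B_def)
      have ell0: "0 < ell" using ell by simp
      note bounds = P.Aop_bounds[where V = "?f" and B = B and r = r and ell = ell, OF r(1) ell0 ell2 f0 fB B0]
      have "Ae e ell ?f r \<le> 2 ^ card (reach q)"
      proof (cases "q \<in> Ci")
        case True
        have "q \<in> reach q" using True unfolding reach_def by (auto intro!: exI[of _ 0])
        then have "0 < card (reach q)" using reach_finite card_gt_0_iff by blast
        then have "2 * B = 2 ^ card (reach q)" using True by (simp add: B_def power_eq_if)
        then show ?thesis using bounds(2) ell by (simp add: Ae_def)
      next
        case False
        have "ell \<le> \<bar>c i e - r\<bar>" if i: "0 < i" "i < d" for i
        proof -
          have "c i 0 \<in> Ci" using i by (auto simp: Ci_def)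
          then have "h \<le> \<bar>c i 0 - q\<bar>" using h(2) False by metis
          moreover have "\<bar>c i e - c i 0\<bar> < h / 4" using elim(3) e i by auto
          moreover have "ell < h / 4" "\<bar>r - q\<bar> < h / 4" using r(2) ell elim(1) by auto
          ultimately show ?thesis by linarith
        qed
        then show ?thesis using bounds(3) ell False by (simp add: Ae_def B_def)
      qed
      then show "(Ae e ell ^^ Suc n) (\<lambda>_. 1) r \<le> 2 ^ card (reach q)" by simp
    qed
  qed
qed

text \<open>Compactness of the unit interval makes \<open>\<delta>\<close> independent of the base
  point. It depends on \<open>n\<close>, while the bound \<open>2 ^ d\<close> does not, so
  \<open>n\<close> may be chosen large enough for \<open>kap ^ n\<close> to win.\<close>

lemma A_pow_uniform:
  assumes np: "\<And>x n. x \<in> Ci \<Longrightarrow> 0 < n \<Longrightarrow> x \<notin> (Mv ^^ n) {x}"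
  shows "\<exists>\<delta>>0. \<forall>r\<in>{0..1}. \<forall>e\<in>{0..<\<delta>}. \<forall>ell. 0 < ell \<and> ell < \<delta> \<longrightarrow> (Ae e ell ^^ n) (\<lambda>_. 1) r \<le> 2 ^ d"
proof (rule compact_uniform)
  fix q :: real assume q: "q \<in> {0..1}"
  obtain \<delta> where \<delta>: "\<delta> > 0" "\<forall>e\<in>{0..<\<delta>}. \<forall>ell. 0 < ell \<and> ell < \<delta> \<longrightarrow> (\<forall>r\<in>{0..1}. \<bar>r - q\<bar> < \<delta> \<longrightarrow>
    (Ae e ell ^^ n) (\<lambda>_. 1) r \<le> 2 ^ card (reach q))"
    using small_evD[OF A_pow_reach[OF np q]] by blast
  have "(2::real) ^ card (reach q) \<le> 2 ^ d" using reach_card by (intro power_increasing) auto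
  with \<delta> show "\<exists>\<delta>>0. \<forall>r\<in>{0..1}. \<bar>r - q\<bar> < \<delta> \<longrightarrow>
    (\<forall>e\<in>{0..<\<delta>}. \<forall>ell. 0 < ell \<and> ell < \<delta> \<longrightarrow> (Ae e ell ^^ n) (\<lambda>_. 1) r \<le> 2 ^ d)"
    by (meson order_trans)
qed auto

text \<open>With expansion above 2, one step and \<open>kap = 2\<close> suffice. Otherwise
  \<open>kap\<close> is placed between 1 and \<open>lam\<close>, and an exponent is fixed whose
  power exceeds \<open>2 ^ d\<close>. The constants do not depend on the parameter, only the weight
  \<open>V\<close> does.\<close>

lemma potentials:
  assumes "2 < lam \<or> (\<forall>x\<in>Ci. \<forall>n>0. x \<notin> (Mv ^^ n) {x})"
  shows "\<exists>ell kap Vm \<delta>. 0 < \<delta> \<and> \<delta> \<le> e0 \<and> (\<forall>e\<in>{0..<\<delta>}.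
    \<exists>V. pw_pot d (\<lambda>i. c i e) (\<lambda>i. E i e) (\<lambda>i. E' i e) lam K ell kap Vm V)"
proof -
  have "\<exists>kap N \<delta>. 1 < kap \<and> kap < lam \<and> 0 < N \<and> 0 < \<delta> \<and> \<delta> \<le> e0 \<and> (\<forall>e\<in>{0..<\<delta>}. \<forall>i<d. 2 * \<delta> \<le> c (Suc i) e - c i e) \<and>
    (\<forall>r\<in>{0..1}. \<forall>e\<in>{0..<\<delta>}. \<forall>ell. 0 < ell \<and> ell < \<delta> \<longrightarrow> (Ae e ell ^^ N) (\<lambda>_. 1) r \<le> kap ^ N)"
  proof -
    obtain \<delta>1 where \<delta>1: "\<delta>1 > 0" "\<And>\<delta>. 0 < \<delta> \<Longrightarrow> \<delta> \<le> \<delta>1 \<Longrightarrow> \<forall>e\<in>{0..<\<delta>}. \<forall>i<d. 2 * \<delta> \<le> c (Suc i) e - c i e"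
      using gaps_ev by (elim small_evE) blast
    from assms show ?thesis
    proof (elim disjE)
      assume "2 < lam"
      define \<delta> where "\<delta> = min e0 \<delta>1"
      have \<delta>: "0 < \<delta>" "\<delta> \<le> e0" "\<forall>e\<in>{0..<\<delta>}. \<forall>i<d. 2 * \<delta> \<le> c (Suc i) e - c i e" using e0 \<delta>1 by (auto simp: \<delta>_def)
      have "(Ae e ell ^^ 1) (\<lambda>_. 1) r \<le> 2 ^ 1" if *: "r \<in> {0..1}" "e \<in> {0..<\<delta>}" "0 < ell" "ell < \<delta>" for r e ell
      proof -
        interpret P: pw d "\<lambda>i. c i e" "\<lambda>i. E i e" "\<lambda>i. E' i e" lam K using pw * \<delta> by auto
        have "2 * ell \<le> c (Suc i) e - c i e" if "i < d" for i using \<delta>(3) that * by force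
        then show ?thesis using P.Aop_pow_bounds[of ell r 1] * unfolding Ae_def by auto
      qed
      then show ?thesis using \<delta> \<open>2 < lam\<close> by (intro exI[of _ 2] exI[of _ 1] exI[of _ \<delta>]) auto
    next
      assume np: "\<forall>x\<in>Ci. \<forall>n>0. x \<notin> (Mv ^^ n) {x}"
      define kap where "kap = (1 + lam) / 2"
      have kap: "1 < kap" "kap < lam" using Z.lam1 by (auto simp: kap_def)
      obtain N where N: "2 ^ d < kap ^ N" using real_arch_pow[OF kap(1)] by blast
      \<comment> \<open>\<open>Suc N\<close> in place of \<open>N\<close> because the exponent must
        be positive.\<close>
      have "(2::real) ^ d < kap ^ Suc N" using N kap power_increasing[of N "Suc N" kap] by linarith
      obtain \<delta>2 where \<delta>2: "\<delta>2 > 0" "\<forall>r\<in>{0..1}. \<forall>e\<in>{0..<\<delta>2}. \<forall>ell. 0 < ell \<and> ell < \<delta>2 \<longrightarrow> (Ae e ell ^^ Suc N) (\<lambda>_. 1) r \<le> 2 ^ d"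
        using A_pow_uniform[of "Suc N"] np by blast
      define \<delta> where "\<delta> = min (min e0 \<delta>1) \<delta>2"
      have \<delta>: "0 < \<delta>" "\<delta> \<le> e0" "\<delta> \<le> \<delta>2" "\<forall>e\<in>{0..<\<delta>}. \<forall>i<d. 2 * \<delta> \<le> c (Suc i) e - c i e" using e0 \<delta>1 \<delta>2 by (auto simp: \<delta>_def)
      have "(Ae e ell ^^ Suc N) (\<lambda>_. 1) r \<le> kap ^ Suc N" if *: "r \<in> {0..1}" "e \<in> {0..<\<delta>}" "0 < ell" "ell < \<delta>" for r e ell
      proof -
        have "(Ae e ell ^^ Suc N) (\<lambda>_. 1) r \<le> 2 ^ d" using \<delta>2(2) * \<delta>(3) by auto
        then show ?thesis using \<open>2 ^ d < kap ^ Suc N\<close> by linarith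
      qed
      then show ?thesis using \<delta> kap by (intro exI[of _ kap] exI[of _ "Suc N"] exI[of _ \<delta>]) auto
    qed
  qed
  then obtain kap N \<delta> where *: "1 < kap" "kap < lam" "0 < N" "0 < \<delta>" "\<delta> \<le> e0" "\<forall>e\<in>{0..<\<delta>}. \<forall>i<d. 2 * \<delta> \<le> c (Suc i) e - c i e"
    "\<forall>r\<in>{0..1}. \<forall>e\<in>{0..<\<delta>}. \<forall>ell. 0 < ell \<and> ell < \<delta> \<longrightarrow> (Ae e ell ^^ N) (\<lambda>_. 1) r \<le> kap ^ N" by blast
  have "\<exists>V. pw_pot d (\<lambda>i. c i e) (\<lambda>i. E i e) (\<lambda>i. E' i e) lam K (\<delta> / 2) kap (2 ^ N) V" if e: "e \<in> {0..<\<delta>}" for e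
  proof -
    interpret P: pw d "\<lambda>i. c i e" "\<lambda>i. E i e" "\<lambda>i. E' i e" lam K using pw e * by auto
    have "2 * (\<delta> / 2) \<le> c (Suc i) e - c i e" if "i < d" for i using *(4,6) e that by force
    moreover have "(P.Aop (\<delta> / 2) ^^ N) (\<lambda>_. 1) r \<le> kap ^ N" if "r \<in> {0..1}" for r
      using *(4,7) that e unfolding Ae_def by auto
    ultimately show ?thesis using * by (intro P.potential_exists) auto
  qed
  then show ?thesis using * by blast
qed

end

subsection \<open>The family of branches of a perturbation\<close>

lemma interior_deriv:
  assumes "(f has_real_derivative D) (at x within {a..b})" "a < x" "x < b"
  shows "(f has_real_derivative D) (at x)"
proof -
  have "x \<in> interior {a..b}" using assms by (simp add: interior_atLeastAtMost_real)
  then show ?thesis using assms(1) at_within_interior by metis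
qed

lemma C2_derivs_cont:
  assumes "C2_derivs S f f' f''"
  shows "continuous_on S f" "continuous_on S f'" "continuous_on S f''"
  using assms unfolding C2_derivs_def by (auto intro!: DERIV_continuous_on)

lemma uniform_limit_ev:
  fixes F :: "real \<Rightarrow> real \<Rightarrow> real"
  assumes "uniform_limit S F f (at_right 0)" "0 < \<eta>"
  shows "\<forall>\<^sub>F e in at_right 0. \<forall>x\<in>S. \<bar>F e x - f x\<bar> < \<eta>"
  using uniform_limitD[OF assms] by (simp add: dist_real_def)

lemma unif_cont:
  fixes f :: "real \<Rightarrow> real"
  assumes "continuous_on {a..b} f" "0 < \<eta>"
  obtains \<rho> where "\<rho> > 0" "\<And>x y. x \<in> {a..b} \<Longrightarrow> y \<in> {a..b} \<Longrightarrow> \<bar>x - y\<bar> < \<rho> \<Longrightarrow> \<bar>f x - f y\<bar> < \<eta>"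
proof -
  have "uniformly_continuous_on {a..b} f" using assms by (intro compact_uniformly_continuous) auto
  then obtain \<rho> where "\<rho> > 0" "\<forall>x\<in>{a..b}. \<forall>y\<in>{a..b}. dist y x < \<rho> \<longrightarrow> dist (f y) (f x) < \<eta>"
    using assms(2) unfolding uniformly_continuous_on_def by blast
  then show thesis by (intro that[of \<rho>]) (auto simp: dist_real_def abs_minus_commute)
qed

text \<open>\<open>T 0\<close> expands at least by \<open>m\<close> in the open intervals, hence its
  branches do so on the closed ones by continuity. The perturbed intervals stick out by less than
  \<open>\<rho>\<close>; moving back into the unperturbed interval costs \<open>\<eta>\<close> by
  uniform continuity, and replacing the perturbed derivative costs another \<open>\<eta>\<close>,
  which leaves \<open>lam\<close>.\<close>

lemma family_exists:
  assumes T0: "piecewise_C2 d (\<lambda>i. c i 0) (T 0)"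
    and L0: "1 \<le> L0" "L0 < min_expansion (crit d (\<lambda>i. c i 0)) (T 0)"
    and pert: "C2_small_perturbations d c T"
  shows "\<exists>E E' lam K e0. pw_family d c E E' lam K e0 T \<and> L0 < lam"
proof -
  define m where "m = min_expansion (crit d (\<lambda>i. c i 0)) (T 0)"
  have "\<exists>\<delta>>0. \<exists>\<epsilon>\<^sub>0>0. \<exists>E :: nat \<Rightarrow> real \<Rightarrow> real \<Rightarrow> real. \<forall>i<d.
        (\<forall>\<epsilon>\<in>{0..<\<epsilon>\<^sub>0}.
           {c i \<epsilon>..c (Suc i) \<epsilon>} \<subseteq> {c i 0 - \<delta>..c (Suc i) 0 + \<delta>} \<and>
           C2_on {c i 0 - \<delta>..c (Suc i) 0 + \<delta>} (E i \<epsilon>) \<and>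
           (\<forall>x\<in>{c i \<epsilon><..<c (Suc i) \<epsilon>}. E i \<epsilon> x = T \<epsilon> x)) \<and>
        C2_limit {c i 0 - \<delta>..c (Suc i) 0 + \<delta>} (E i) (E i 0) (at_right 0)"
    using pert unfolding C2_small_perturbations_def by (elim conjE)
  then obtain \<delta> \<epsilon>0 and E :: "nat \<Rightarrow> real \<Rightarrow> real \<Rightarrow> real" where
    \<delta>: "\<delta> > 0" and \<epsilon>0: "\<epsilon>0 > 0" and EE: "\<forall>i<d.
        (\<forall>\<epsilon>\<in>{0..<\<epsilon>0}.
           {c i \<epsilon>..c (Suc i) \<epsilon>} \<subseteq> {c i 0 - \<delta>..c (Suc i) 0 + \<delta>} \<and>
           C2_on {c i 0 - \<delta>..c (Suc i) 0 + \<delta>} (E i \<epsilon>) \<and>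
           (\<forall>x\<in>{c i \<epsilon><..<c (Suc i) \<epsilon>}. E i \<epsilon> x = T \<epsilon> x)) \<and>
        C2_limit {c i 0 - \<delta>..c (Suc i) 0 + \<delta>} (E i) (E i 0) (at_right 0)"
    by (elim exE conjE)
  have E1: "{c i e..c (Suc i) e} \<subseteq> {c i 0 - \<delta>..c (Suc i) 0 + \<delta>} \<and>
           (\<forall>x\<in>{c i e<..<c (Suc i) e}. E i e x = T e x)" if "i < d" "e \<in> {0..<\<epsilon>0}" for i e
    using EE[rule_format, OF that(1), THEN conjunct1, rule_format, OF that(2)] by (elim conjE) (intro conjI)
  have E2: "C2_limit {c i 0 - \<delta>..c (Suc i) 0 + \<delta>} (E i) (E i 0) (at_right 0)" if "i < d" for i
    using EE[rule_format, OF that, THEN conjunct2] .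
  define X where "X i = {c i 0 - \<delta>..c (Suc i) 0 + \<delta>}" for i
  have pc: "piecewise_C2 d (\<lambda>i. c i e) (T e)" if "0 \<le> e" for e
    using T0 pert that unfolding C2_small_perturbations_def by (cases "e = 0") auto
  have c0: "c 0 e = 0" "c d e = 1" and cl: "\<And>i. i < d \<Longrightarrow> c i e < c (Suc i) e"
    and TI: "\<And>x. x \<in> {0..1} \<Longrightarrow> T e x \<in> {0..1}" if "0 \<le> e" for e
    using pc[OF that] unfolding piecewise_C2_def by auto
  have d: "0 < d" using c0[of 0] by (cases d) auto
  define P where "P i F' F'' f' f'' \<longleftrightarrow> C2_derivs (X i) (E i 0) f' f'' \<and> (\<forall>\<^sub>F p in at_right 0. C2_derivs (X i) (E i p) (F' p) (F'' p)) \<and>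
        uniform_limit (X i) (E i) (E i 0) (at_right 0) \<and> uniform_limit (X i) F' f' (at_right 0) \<and> uniform_limit (X i) F'' f'' (at_right 0)"
    for i F' F'' f' f''
  have "\<forall>i\<in>{..<d}. \<exists>F' F'' f' f''. P i F' F'' f' f''"
  proof
    fix i assume "i \<in> {..<d}"
    then show "\<exists>F' F'' f' f''. P i F' F'' f' f''" using E2[of i] unfolding C2_limit_def X_def[symmetric] P_def by simp
  qed
  then obtain F' F'' f' f'' where PF: "\<And>i. i < d \<Longrightarrow> P i (F' i) (F'' i) (f' i) (f'' i)"
    by (metis lessThan_iff)
  have F: "i < d \<Longrightarrow> C2_derivs (X i) (E i 0) (f' i) (f'' i)"
    "i < d \<Longrightarrow> \<forall>\<^sub>F p in at_right 0. C2_derivs (X i) (E i p) (F' i p) (F'' i p)"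
    "i < d \<Longrightarrow> uniform_limit (X i) (E i) (E i 0) (at_right 0)"
    "i < d \<Longrightarrow> uniform_limit (X i) (F' i) (f' i) (at_right 0)"
    "i < d \<Longrightarrow> uniform_limit (X i) (F'' i) (f'' i) (at_right 0)" for i
    using PF[of i] unfolding P_def by auto
  \<comment> \<open>Halfway between the required expansion and the minimum expansion; the margin
    \<open>m - lam\<close> is spent in two halves \<open>\<eta>\<close>.\<close>
  define lam where "lam = (m + L0) / 2"
  have lam: "L0 < lam" "lam < m" using L0 by (auto simp: lam_def m_def)
  define \<eta> where "\<eta> = (m - lam) / 2"
  have \<eta>: "0 < \<eta>" using lam by (simp add: \<eta>_def)
  note contF = C2_derivs_cont[OF F(1)]
  have sub0: "{c i 0..c (Suc i) 0} \<subseteq> X i" for i using \<delta> by (auto simp: X_def)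
  have c_range: "i \<le> d \<Longrightarrow> 0 \<le> c i e" "i \<le> d \<Longrightarrow> c i e \<le> 1" if e: "0 \<le> e" for i e
  proof -
    have "i \<le> j \<Longrightarrow> j \<le> d \<Longrightarrow> c i e \<le> c j e" for i j
    proof (induction j)
      case (Suc j) then show ?case using cl[OF e, of j] by (cases "i = Suc j") auto
    qed auto
    from this[of 0 i] this[of i d] show "i \<le> d \<Longrightarrow> 0 \<le> c i e" "i \<le> d \<Longrightarrow> c i e \<le> 1" using c0[OF e] by auto
  qed
  have notcrit: "x \<notin> (\<lambda>i. c i 0) ` {..d}" if "i < d" "x \<in> {c i 0<..<c (Suc i) 0}" for i x
  proof
    have mono: "i \<le> j \<Longrightarrow> j \<le> d \<Longrightarrow> c i 0 \<le> c j 0" for i j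
    proof (induction j)
      case (Suc j) then show ?case using cl[of 0 j] by (cases "i = Suc j") auto
    qed auto
    assume "x \<in> (\<lambda>i. c i 0) ` {..d}"
    then obtain j where j: "j \<le> d" "x = c j 0" by auto
    then show False using that mono[of j i] mono[of "Suc i" j] by (cases "j \<le> i") auto
  qed
  have m_open: "m \<le> \<bar>f' i x\<bar>" if i: "i < d" and x: "x \<in> {c i 0<..<c (Suc i) 0}" for i x
  proof -
    have "(E i 0 has_real_derivative f' i x) (at x within X i)"
    proof -
      have "x \<in> X i" using x sub0[of i] by auto
      then show ?thesis using F(1)[OF i] unfolding C2_derivs_def by blast
    qed
    then have dE: "(E i 0 has_real_derivative f' i x) (at x)"
      using x \<delta> unfolding X_def by (intro interior_deriv[of _ _ _ "c i 0 - \<delta>" "c (Suc i) 0 + \<delta>"]) auto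
    have "(T 0 has_real_derivative f' i x) (at x)"
      by (rule has_field_derivative_transform_within_open[OF dE, of "{c i 0<..<c (Suc i) 0}"])
        (use E1[OF i, of 0] x \<epsilon>0 in auto)
    then have "deriv (T 0) x = f' i x" by (rule DERIV_imp_deriv)
    moreover have "m \<le> \<bar>deriv (T 0) x\<bar>"
      unfolding m_def min_expansion_def
    proof (rule cINF_lower)
      show "bdd_below ((\<lambda>x. \<bar>deriv (T 0) x\<bar>) ` ({0..1} - crit d (\<lambda>i. c i 0)))" by (intro bdd_belowI[of _ 0]) auto
      show "x \<in> {0..1} - crit d (\<lambda>i. c i 0)"
        using notcrit[OF i x] x c_range[of 0 i] c_range[of 0 "Suc i"] i by (auto simp: crit_def)
    qed
    ultimately show ?thesis by simp
  qed
  have m_closed: "m \<le> \<bar>f' i x\<bar>" if i: "i < d" and x: "x \<in> {c i 0..c (Suc i) 0}" for i x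
  proof -
    have cl_eq: "closure {c i 0<..<c (Suc i) 0} = {c i 0..c (Suc i) 0}" using cl[of 0 i] i by simp
    show ?thesis
      by (rule continuous_ge_on_closure[of "{c i 0<..<c (Suc i) 0}"])
        (use cl_eq x m_open[OF i] contF(2)[OF i] sub0[of i] in \<open>auto intro!: continuous_intros intro: continuous_on_subset\<close>)
  qed
  have "\<forall>i\<in>{..<d}. \<exists>\<rho>>0. \<forall>x\<in>X i. \<forall>y\<in>X i. \<bar>x - y\<bar> < \<rho> \<longrightarrow> \<bar>f' i x - f' i y\<bar> < \<eta>"
    using unif_cont[OF contF(2)[unfolded X_def] \<eta>] unfolding X_def by (metis lessThan_iff)
  then obtain \<rho>f where \<rho>f: "\<And>i. i < d \<Longrightarrow> \<rho>f i > 0"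
    "\<And>i x y. i < d \<Longrightarrow> x \<in> X i \<Longrightarrow> y \<in> X i \<Longrightarrow> \<bar>x - y\<bar> < \<rho>f i \<Longrightarrow> \<bar>f' i x - f' i y\<bar> < \<eta>"
    by (metis lessThan_iff)
  define \<rho> where "\<rho> = Min (insert \<delta> (\<rho>f ` {..<d}))"
  have \<rho>: "0 < \<rho>" "\<rho> \<le> \<delta>" "\<And>i. i < d \<Longrightarrow> \<rho> \<le> \<rho>f i"
    using \<rho>f(1) \<delta> unfolding \<rho>_def by (auto simp: Min_gr_iff)
  have "\<forall>i\<in>{..<d}. \<exists>B. \<forall>x\<in>X i. \<bar>f'' i x\<bar> \<le> B"
  proof
    fix i assume "i \<in> {..<d}"
    then have "compact (f'' i ` X i)" using contF(3)[of i] by (intro compact_continuous_image) (auto simp: X_def)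
    then have "bounded (f'' i ` X i)" by (rule compact_imp_bounded)
    then show "\<exists>B. \<forall>x\<in>X i. \<bar>f'' i x\<bar> \<le> B" by (auto simp: bounded_iff)
  qed
  then obtain Kf where Kf: "\<And>i x. i < d \<Longrightarrow> x \<in> X i \<Longrightarrow> \<bar>f'' i x\<bar> \<le> Kf i" by (metis lessThan_iff)
  \<comment> \<open>A bound for the second derivatives of the limit branches, with 1 to spare for
    the perturbed ones.\<close>
  define K where "K = (\<Sum>i<d. \<bar>Kf i\<bar>) + 1"
  have K: "0 \<le> K" "\<And>i x. i < d \<Longrightarrow> x \<in> X i \<Longrightarrow> \<bar>f'' i x\<bar> + 1 \<le> K"
  proof -
    show "0 \<le> K" unfolding K_def by (simp add: add_nonneg_nonneg sum_nonneg)
    fix i x assume ix: "i < d" "x \<in> X i"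
    have "\<bar>Kf i\<bar> \<le> (\<Sum>i<d. \<bar>Kf i\<bar>)" using ix by (intro member_le_sum) auto
    then show "\<bar>f'' i x\<bar> + 1 \<le> K" using Kf[OF ix] unfolding K_def by linarith
  qed
  have cn: "\<exists>\<delta>>0. \<forall>e\<in>{0..<\<delta>}. \<forall>i\<le>d. \<bar>c i e - c i 0\<bar> < \<eta>'" if \<eta>': "0 < \<eta>'" for \<eta>'
  proof -
    have "\<forall>\<^sub>F \<delta> in at_right 0. \<forall>e\<in>{0..<\<delta>}. \<bar>c i e - c i 0\<bar> < \<eta>'" if "i \<in> {..d}" for i
    proof -
      obtain g g' where "C2_derivs {0..} (c i) g g'" using pert \<open>i \<in> {..d}\<close> unfolding C2_small_perturbations_def C2_on_def by auto
      then have "continuous_on {0..} (c i)" by (rule C2_derivs_cont)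
      then obtain \<delta>1 where "\<delta>1 > 0" "\<forall>e\<in>{0..}. dist e 0 < \<delta>1 \<longrightarrow> dist (c i e) (c i 0) < \<eta>'"
        using \<eta>' unfolding continuous_on_iff by force
      then show ?thesis by (intro small_evI[of \<delta>1]) (auto simp: dist_real_def)
    qed
    then have "\<forall>\<^sub>F \<delta> in at_right 0. \<forall>i\<in>{..d}. \<forall>e\<in>{0..<\<delta>}. \<bar>c i e - c i 0\<bar> < \<eta>'" by (intro eventually_ball_finite) auto
    from small_evD[OF this] show ?thesis by (metis atMost_iff)
  qed
  obtain e1 where e1: "e1 > 0" "\<And>e i. e \<in> {0..<e1} \<Longrightarrow> i \<le> d \<Longrightarrow> \<bar>c i e - c i 0\<bar> < \<rho>" using cn[OF \<rho>(1)] by blast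
  \<comment> \<open>The convergence statement supplies derivatives for small positive parameters
    only; at 0 those of the limit branch are inserted.\<close>
  define E' where "E' i e = (if e = 0 then f' i else F' i e)" for i e
  define E'' where "E'' i e = (if e = 0 then f'' i else F'' i e)" for i e
  have "\<forall>\<^sub>F e in at_right 0. \<forall>i\<in>{..<d}. C2_derivs (X i) (E i e) (F' i e) (F'' i e) \<and> (\<forall>x\<in>X i. \<bar>F' i e x - f' i x\<bar> < \<eta>) \<and> (\<forall>x\<in>X i. \<bar>F'' i e x - f'' i x\<bar> < 1)"
    by (intro eventually_ball_finite ballI eventually_conj F uniform_limit_ev \<eta>) auto
  then obtain e2 where e2: "e2 > 0" "\<And>e i. 0 < e \<Longrightarrow> e < e2 \<Longrightarrow> i < d \<Longrightarrow> C2_derivs (X i) (E i e) (F' i e) (F'' i e) \<and> (\<forall>x\<in>X i. \<bar>F' i e x - f' i x\<bar> < \<eta>) \<and> (\<forall>x\<in>X i. \<bar>F'' i e x - f'' i x\<bar> < 1)"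
    unfolding eventually_at_right_field by auto
  have E'2: "C2_derivs (X i) (E i e) (E' i e) (E'' i e)" "x \<in> X i \<Longrightarrow> \<bar>E' i e x - f' i x\<bar> < \<eta>" "x \<in> X i \<Longrightarrow> \<bar>E'' i e x - f'' i x\<bar> < 1"
    if "0 \<le> e" "e < e2" "i < d" for e i x
    using e2(2)[of e i] F(1)[of i] that \<eta> unfolding E'_def E''_def by (cases "e = 0"; auto)+
  define e0 where "e0 = min (min e1 e2) \<epsilon>0"
  have e0: "0 < e0" using e1 e2 \<epsilon>0 by (simp add: e0_def)
  have "pw_family d c E E' lam K e0 T"
  proof (rule pw_family.intro)
    show "0 < e0" by (rule e0)
    show "\<exists>\<delta>>0. \<forall>e\<in>{0..<\<delta>}. \<forall>i\<le>d. \<bar>c i e - c i 0\<bar> < \<eta>'" if "0 < \<eta>'" for \<eta>' by (rule cn[OF that])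
    show "T e x = E i e x" if "0 \<le> e" "e < e0" "i < d" "x \<in> {c i e<..<c (Suc i) e}" for e i x
      using E1[of i e] that by (auto simp: e0_def)
    show "\<exists>\<delta>>0. \<forall>e\<in>{0..<\<delta>}. \<forall>r\<in>{c i e..c (Suc i) e}. \<forall>q\<in>{c i 0..c (Suc i) 0}. \<bar>r - q\<bar> < \<delta> \<longrightarrow> \<bar>E i e r - E i 0 q\<bar> < \<eta>'"
      if i: "i < d" and \<eta>': "0 < \<eta>'" for i \<eta>'
    proof -
      have \<eta>2: "0 < \<eta>' / 2" using \<eta>' by simp
      obtain \<rho>1 where \<rho>1: "\<rho>1 > 0" "\<And>x y. x \<in> X i \<Longrightarrow> y \<in> X i \<Longrightarrow> \<bar>x - y\<bar> < \<rho>1 \<Longrightarrow> \<bar>E i 0 x - E i 0 y\<bar> < \<eta>' / 2"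
        using unif_cont[OF contF(1)[OF i, unfolded X_def] \<eta>2] unfolding X_def by blast
      obtain e3 where e3: "e3 > 0" "\<And>e x. 0 < e \<Longrightarrow> e < e3 \<Longrightarrow> x \<in> X i \<Longrightarrow> \<bar>E i e x - E i 0 x\<bar> < \<eta>' / 2"
        using uniform_limit_ev[OF F(3)[OF i] \<eta>2] unfolding eventually_at_right_field by auto
      show ?thesis
      proof (intro exI[of _ "min (min \<rho>1 e3) \<epsilon>0"] conjI ballI impI)
        fix e r q assume e: "e \<in> {0..<min (min \<rho>1 e3) \<epsilon>0}" and r: "r \<in> {c i e..c (Suc i) e}"
          and q: "q \<in> {c i 0..c (Suc i) 0}" and rq: "\<bar>r - q\<bar> < min (min \<rho>1 e3) \<epsilon>0"
        have rX: "r \<in> X i" using E1[OF i, of e] e r unfolding X_def by auto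
        have "\<bar>E i e r - E i 0 r\<bar> < \<eta>' / 2" using e3(2)[of e r] e rX \<eta>2 by (cases "e = 0") auto
        moreover have "q \<in> X i" using sub0 q by blast
        then have "\<bar>E i 0 r - E i 0 q\<bar> < \<eta>' / 2" using \<rho>1(2)[OF rX, of q] rq by auto
        ultimately show "\<bar>E i e r - E i 0 q\<bar> < \<eta>'" by linarith
      qed (use \<rho>1 e3 \<epsilon>0 in auto)
    qed
    show "pw d (\<lambda>i. c i e) (\<lambda>i. E i e) (\<lambda>i. E' i e) lam K" if e: "0 \<le> e" "e < e0" for e
    proof (rule pw.intro)
      from e have e': "e \<in> {0..<e1}" "e < e2" "e \<in> {0..<\<epsilon>0}" by (auto simp: e0_def)
      show "c 0 e = 0" "c d e = 1" using c0[OF e(1)] by auto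
      fix i assume i: "i < d"
      show cii: "c i e < c (Suc i) e" using cl[OF e(1) i] .
      have ci: "\<bar>c i e - c i 0\<bar> < \<rho>" "\<bar>c (Suc i) e - c (Suc i) 0\<bar> < \<rho>" using e1(2)[OF e'(1)] i by auto
      have inX: "c i 0 - \<delta> < x" "x < c (Suc i) 0 + \<delta>" "x \<in> X i" if "x \<in> {c i e..c (Suc i) e}" for x
        using ci \<rho>(2) that by (auto simp: X_def)
      note D = E'2[OF e(1) e'(2) i]
      have der: "(E i e has_real_derivative E' i e x) (at x)" if x: "x \<in> {c i e..c (Suc i) e}" for x
      proof -
        have "(E i e has_real_derivative E' i e x) (at x within X i)" using D(1) inX[OF x] unfolding C2_derivs_def by auto
        then show ?thesis using inX[OF x] unfolding X_def by (intro interior_deriv[of _ _ _ "c i 0 - \<delta>" "c (Suc i) 0 + \<delta>"]) auto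
      qed
      show "branch (c i e) (c (Suc i) e) (E i e) (E' i e) lam K"
      proof (rule branch.intro)
        show "1 < lam" using lam L0 by simp
        show "lam \<le> \<bar>E' i e x\<bar>" if x: "x \<in> {c i e..c (Suc i) e}" for x
        proof -
          \<comment> \<open>The nearest point of the unperturbed interval, where the expansion
            \<open>m\<close> is known.\<close>
          define y where "y = max (c i 0) (min (c (Suc i) 0) x)"
          have y: "y \<in> {c i 0..c (Suc i) 0}" "\<bar>x - y\<bar> < \<rho>" using cl[of 0 i] i ci x \<rho>(1) by (auto simp: y_def)
          then have "\<bar>f' i x - f' i y\<bar> < \<eta>" using \<rho>f(2)[OF i inX(3)[OF x], of y] \<rho>(3)[OF i] sub0[of i] by auto
          moreover have "m \<le> \<bar>f' i y\<bar>" using m_closed[OF i y(1)] .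
          moreover have "\<bar>E' i e x - f' i x\<bar> < \<eta>" using D(2)[OF inX(3)[OF x]] .
          moreover have "m = lam + 2 * \<eta>" unfolding \<eta>_def by (simp add: field_simps)
          ultimately show ?thesis by linarith
        qed
        show "\<bar>E' i e x - E' i e y\<bar> \<le> K * \<bar>x - y\<bar>" if xy: "x \<in> {c i e..c (Suc i) e}" "y \<in> {c i e..c (Suc i) e}" for x y
        proof -
          have "norm (E' i e x - E' i e y) \<le> K * norm (x - y)"
          proof (rule field_differentiable_bound[where S = "X i"])
            show "convex (X i)" by (simp add: X_def)
            show "(E' i e has_field_derivative E'' i e z) (at z within X i)" if "z \<in> X i" for z
              using D(1) that unfolding C2_derivs_def by auto
            show "norm (E'' i e z) \<le> K" if "z \<in> X i" for z using D(3)[OF that] K(2)[OF i that] by simp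
          qed (use xy inX in auto)
          then show ?thesis by simp
        qed
      qed (use cii der K in auto)
      fix x assume x: "x \<in> {c i e..c (Suc i) e}"
      have cl_eq: "closure {c i e<..<c (Suc i) e} = {c i e..c (Suc i) e}" using cii by simp
      have co: "continuous_on (closure {c i e<..<c (Suc i) e}) (E i e)"
        unfolding cl_eq by (rule DERIV_continuous_on) (use der in \<open>auto intro: has_field_derivative_at_within\<close>)
      have "E i e z \<in> {0..1}" if "z \<in> {c i e<..<c (Suc i) e}" for z
      proof -
        have "z \<in> {0..1}" using that c_range[OF e(1), of i] c_range[OF e(1), of "Suc i"] i by auto
        then show ?thesis using E1[OF i e'(3)] that TI[OF e(1)] by metis
      qed
      then show "E i e x \<in> {0..1}"
        using continuous_ge_on_closure[OF co, of x 0] continuous_le_on_closure[OF co, of x 1] x unfolding cl_eq by auto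
    qed
  qed
  then show ?thesis using lam(1) by blast
qed

section \<open>Comparison of branch values with one-sided limits\<close>

context pw_family
begin

interpretation Z: pw d "\<lambda>i. c i 0" "\<lambda>i. E i 0" "\<lambda>i. E' i 0" lam K using pw e0 by simp

definition "CC = crit d (\<lambda>i. c i 0)"

lemma mv_limits:
  assumes i: "i < d" and q: "q \<in> {c i 0..c (Suc i) 0}"
  shows "q < c (Suc i) 0 \<Longrightarrow> (T 0 \<longlongrightarrow> E i 0 q) (at_right q)" "c i 0 < q \<Longrightarrow> (T 0 \<longlongrightarrow> E i 0 q) (at_left q)"
    "c i 0 < q \<Longrightarrow> q < c (Suc i) 0 \<Longrightarrow> T 0 q = E i 0 q"
proof -
  interpret B: branch "c i 0" "c (Suc i) 0" "E i 0" "E' i 0" lam K by (rule Z.br[OF i])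
  have "isCont (E i 0) q" using B.der[OF q] by (rule DERIV_isCont)
  then have lim: "(E i 0 \<longlongrightarrow> E i 0 q) (at q)" by (simp add: isCont_def)
  show "(T 0 \<longlongrightarrow> E i 0 q) (at_right q)" if "q < c (Suc i) 0"
  proof (rule Lim_transform_eventually)
    show "(E i 0 \<longlongrightarrow> E i 0 q) (at_right q)" using lim by (rule tendsto_within_subset) auto
    show "\<forall>\<^sub>F x in at_right q. E i 0 x = T 0 x"
      unfolding eventually_at_right_field using that q T_E[of 0 i] e0 i by (intro exI[of _ "c (Suc i) 0"]) auto
  qed
  show "(T 0 \<longlongrightarrow> E i 0 q) (at_left q)" if "c i 0 < q"
  proof (rule Lim_transform_eventually)
    show "(E i 0 \<longlongrightarrow> E i 0 q) (at_left q)" using lim by (rule tendsto_within_subset) auto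
    show "\<forall>\<^sub>F x in at_left q. E i 0 x = T 0 x"
      unfolding eventually_at_left_field using that q T_E[of 0 i] e0 i by (intro exI[of _ "c i 0"]) auto
  qed
  show "T 0 q = E i 0 q" if "c i 0 < q" "q < c (Suc i) 0" using T_E[of 0 i q] e0 i that by auto
qed

text \<open>The inclusion carries hypotheses on \<open>mvals\<close>, namely (I2), (I4) and the
  invariance of the two sides, over to \<open>mv\<close>.\<close>

lemma mv_mvals: "mv q \<subseteq> mvals CC (T 0) 0 1 q"
proof
  fix y assume "y \<in> mv q"
  then obtain i where i: "i < d" "q \<in> {c i 0..c (Suc i) 0}" "y = E i 0 q" by (auto simp: mv_def)
  have r: "0 \<le> c i 0" "c (Suc i) 0 \<le> 1" using Z.c_range[of i] Z.c_range[of "Suc i"] i by auto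
  note l = mv_limits[OF i(1,2)]
  consider "q = c i 0" | "q = c (Suc i) 0" | "c i 0 < q" "q < c (Suc i) 0" using i by fastforce
  then show "y \<in> mvals CC (T 0) 0 1 q"
  proof cases
    case 1
    then have "q \<in> CC" "q < c (Suc i) 0" using i Z.c_less[of i] by (auto simp: CC_def crit_def)
    then show ?thesis using l(1) i r by (auto simp: mvals_def)
  next
    case 2
    then have "q \<in> CC" "c i 0 < q" using i Z.c_less[of i] by (auto simp: CC_def crit_def)
    then show ?thesis using l(2) i r by (auto simp: mvals_def)
  next
    case 3
    have "q \<in> Z.gap i" using 3 by (simp add: Z.gap_def)
    then have "q \<notin> CC" unfolding CC_def crit_def using Z.gap_disj_crit[OF i(1)] by auto
    then show ?thesis using l(3)[OF 3] 3 i r by (auto simp: mvals_def)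
  qed
qed

lemma Mv_mimage: "(Mv ^^ n) A \<subseteq> (mimage CC (T 0) ^^ n) A"
proof (induction n)
  case (Suc n)
  then show ?case using mv_mvals by (fastforce simp: Mv_def mimage_def)
qed auto

lemma mv_side:
  assumes b: "0 < b" "b < 1"
  shows "invariant_interval CC (T 0) 0 b \<Longrightarrow> 0 \<le> q \<Longrightarrow> q < b \<Longrightarrow> mv q \<subseteq> {0..b}"
    and "invariant_interval CC (T 0) b 1 \<Longrightarrow> b < q \<Longrightarrow> q \<le> 1 \<Longrightarrow> mv q \<subseteq> {b..1}"
proof -
  assume i: "invariant_interval CC (T 0) 0 b" "0 \<le> q" "q < b"
  have "mvals CC (T 0) 0 1 q = mvals CC (T 0) 0 b q" using i b by (simp add: mvals_def)
  moreover have "mvals CC (T 0) 0 b q \<subseteq> {0..b}" using i b unfolding invariant_interval_def by auto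
  ultimately show "mv q \<subseteq> {0..b}" using mv_mvals[of q] by blast
next
  assume i: "invariant_interval CC (T 0) b 1" "b < q" "q \<le> 1"
  have "mvals CC (T 0) 0 1 q = mvals CC (T 0) b 1 q" using i b by (simp add: mvals_def)
  moreover have "mvals CC (T 0) b 1 q \<subseteq> {b..1}" using i b unfolding invariant_interval_def by auto
  ultimately show "mv q \<subseteq> {b..1}" using mv_mvals[of q] by blast
qed

text \<open>\<open>b\<close> itself may lie in a gap; there the one-sided limit at an end of the
  invariant interval is the value of the branch, so even the image of \<open>b\<close> stays in the
  interval.\<close>

lemma E_side:
  assumes b: "0 < b" "b < 1" and i: "i < d" "x \<in> Z.gap i"
  shows "invariant_interval CC (T 0) 0 b \<Longrightarrow> x \<in> {0..b} \<Longrightarrow> E i 0 x \<in> {0..b}"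
    and "invariant_interval CC (T 0) b 1 \<Longrightarrow> x \<in> {b..1} \<Longrightarrow> E i 0 x \<in> {b..1}"
proof -
  have x: "x \<in> {c i 0..c (Suc i) 0}" "c i 0 < x" "x < c (Suc i) 0" using i by (auto simp: Z.gap_def)
  have mvx: "E i 0 x \<in> mv x" using i x by (auto simp: mv_def)
  show "E i 0 x \<in> {0..b}" if inv: "invariant_interval CC (T 0) 0 b" and "x \<in> {0..b}"
  proof (cases "x = b")
    case True
    have "E i 0 x \<in> mvals CC (T 0) 0 b b" using mv_limits(2)[OF i(1) x(1,2)] True b by (simp add: mvals_def)
    then show ?thesis using inv b unfolding invariant_interval_def by (metis atLeastAtMost_iff less_imp_le order_refl subsetD)
  qed (use mv_side(1)[OF b inv, of x] mvx that in auto)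
  show "E i 0 x \<in> {b..1}" if inv: "invariant_interval CC (T 0) b 1" and "x \<in> {b..1}"
  proof (cases "x = b")
    case True
    have "E i 0 x \<in> mvals CC (T 0) b 1 b" using mv_limits(1)[OF i(1) x(1,3)] True b by (simp add: mvals_def)
    then show ?thesis using inv b unfolding invariant_interval_def by (metis atLeastAtMost_iff less_imp_le order_refl subsetD)
  qed (use mv_side(2)[OF b inv, of x] mvx that in auto)
qed

end

subsection \<open>Limits of invariant densities\<close>

context pw
begin

lemma finite_level:
  assumes "i < d"
  shows "finite {x \<in> {c i..c (Suc i)}. E i x = a}"
proof -
  interpret branch "c i" "c (Suc i)" "E i" "E' i" lam K by (rule br[OF assms])
  have "inj_on (E i) {x \<in> {c i..c (Suc i)}. E i x = a}" by (rule inj_on_subset[OF inj]) auto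
  moreover have "finite (E i ` {x \<in> {c i..c (Suc i)}. E i x = a})" by (rule finite_subset[of _ "{a}"]) auto
  ultimately show ?thesis by (rule finite_imageD[rotated])
qed

text \<open>Branches are injective, so level sets are finite: the boundary of a side or of a
  half-line is hit only from a null set.\<close>

lemma Tm_neq:
  "AE x in lborel. x \<in> {0..1} \<longrightarrow> x \<notin> c ` {..d} \<and> Tm x \<noteq> a"
proof -
  let ?F = "c ` {..d} \<union> (\<Union>i<d. {x \<in> {c i..c (Suc i)}. E i x = a})"
  have "finite ?F" by (intro finite_UnI finite_UN_I finite_level) auto
  then have "AE x in lborel. x \<notin> ?F" by (intro AE_not_in finite_imp_null_set_lborel)
  then show ?thesis
  proof eventually_elim
    case (elim x)
    show ?case
    proof (intro impI conjI)
      assume x: "x \<in> {0..1}"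
      show n: "x \<notin> c ` {..d}" using elim by auto
      obtain i where i: "i < d" "x \<in> gap i" using gap_exists[OF x n] by blast
      then show "Tm x \<noteq> a" using elim Tm_gap[OF i] by (auto simp: gap_def)
    qed
  qed
qed

text \<open>Both sides are mapped into themselves, so up to null sets a point lies in
  \<open>S\<close> exactly when its image does, and the restriction of \<open>\<psi>\<close> to
  \<open>S\<close> is again invariant. Normalized, it is the unique invariant density there, unless
  its mass is 0.\<close>

lemma side_density:
  assumes S: "S \<in> sets borel" "S' \<in> sets borel" "S \<union> S' = {0..1}" "S \<inter> S' = {b}"
    and inv: "\<And>i x. i < d \<Longrightarrow> x \<in> gap i \<Longrightarrow> x \<in> S \<Longrightarrow> E i x \<in> S"
      "\<And>i x. i < d \<Longrightarrow> x \<in> gap i \<Longrightarrow> x \<in> S' \<Longrightarrow> E i x \<in> S'"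
    and T: "\<And>i x. i < d \<Longrightarrow> x \<in> gap i \<Longrightarrow> T x = E i x"
    and \<psi>: "dens {0..1} \<psi>" "\<And>A. A \<in> sets borel \<Longrightarrow> (LINT x|lborel. indicator A (Tm x) * \<psi> x) = (LINT x|lborel. indicator A x * \<psi> x)"
    and uniq: "\<exists>!\<nu>. acim T S \<nu>" and \<mu>: "acim T S \<mu>" "has_density \<mu> S \<phi>"
  shows "AE x in lborel. x \<in> S \<longrightarrow> \<psi> x = (LINT x|lborel. indicator S x * \<psi> x) * \<phi> x"
proof -
  note [measurable] = dens_measurable[OF \<psi>(1)] S(1,2)
  let ?m = "LINT x|lborel. indicator S x * \<psi> x"
  have SI: "S \<subseteq> {0..1}" using S(3) by auto
  have pi: "integrable lborel \<psi>" using \<psi>(1) by (rule integrable_dens)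
  have m0: "0 \<le> ?m" using integral_le_1[OF \<psi>(1) S(1)] by simp
  have inv': "(LINT x|lborel. indicator A (Tm x) * (indicator S x * \<psi> x)) = (LINT x|lborel. indicator A x * (indicator S x * \<psi> x))"
    if A[measurable]: "A \<in> sets borel" for A
  proof -
    have "(LINT x|lborel. indicator A (Tm x) * (indicator S x * \<psi> x)) = (LINT x|lborel. indicator (A \<inter> S) (Tm x) * \<psi> x)"
    proof (rule integral_cong_AE)
      show "AE x in lborel. indicator A (Tm x) * (indicator S x * \<psi> x) = indicator (A \<inter> S) (Tm x) * \<psi> x"
        using Tm_neq[of b]
      proof eventually_elim
        case (elim x)
        show ?case
        proof (cases "x \<in> {0..1}")
          case True
          obtain i where i: "i < d" "x \<in> gap i" using gap_exists[of x] elim True by blast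
          have "Tm x \<in> S \<longleftrightarrow> x \<in> S"
          proof
            assume "Tm x \<in> S"
            then have "Tm x \<notin> S'" using S(4) elim True by auto
            then have "x \<notin> S'" using inv(2)[OF i] Tm_gap[OF i] by auto
            moreover have "x \<in> S \<union> S'" unfolding S(3) by (rule True)
            ultimately show "x \<in> S" by blast
          qed (use inv(1)[OF i] Tm_gap[OF i] in auto)
          then show ?thesis by (auto simp: indicator_def)
        qed (use \<psi>(1) in \<open>simp add: dens_def\<close>)
      qed
    qed measurable
    also have "\<dots> = (LINT x|lborel. indicator (A \<inter> S) x * \<psi> x)" by (rule \<psi>(2)) measurable
    also have "\<dots> = (LINT x|lborel. indicator A x * (indicator S x * \<psi> x))"
      by (intro Bochner_Integration.integral_cong) (auto simp: indicator_def)
    finally show ?thesis .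
  qed
  show ?thesis
  proof (cases "?m = 0")
    case True
    have "AE x in lborel. indicator S x * \<psi> x = 0"
      using True by (subst (asm) integral_nonneg_eq_0_iff_AE) (auto intro!: int_ind pi simp: dens_nonneg[OF \<psi>(1)])
    then show ?thesis by eventually_elim (use True in auto)
  next
    case False
    define f where "f x = indicator S x * \<psi> x / ?m" for x
    have f: "dens S f"
      using False m0 \<psi>(1) unfolding dens_def f_def[abs_def] by (auto intro!: integrable_divide int_ind pi)
    have "acim T S (density lborel (\<lambda>x. ennreal (f x)))"
    proof (rule acimI[OF S(1) SI f T])
      fix A :: "real set" assume A: "A \<in> sets borel"
      show "(LINT x|lborel. indicator A (Tm x) * f x) = (LINT x|lborel. indicator A x * f x)"
        unfolding f_def times_divide_eq_right integral_divide_zero inv'[OF A] ..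
    qed
    then have "density lborel (\<lambda>x. ennreal (f x)) = \<mu>" using uniq \<mu> by auto
    then have eq: "density lborel (\<lambda>x. ennreal (f x)) = density lborel (\<lambda>x. ennreal (\<phi> x))"
      using \<mu> by (simp add: has_density_def)
    have "dens S \<phi>" using \<mu> by (intro has_density_dens[of \<mu>]) (auto simp: acim_def)
    from dens_AE_eq[OF f this eq] show ?thesis
      by eventually_elim (use False in \<open>auto simp: f_def field_simps\<close>)
  qed
qed

end

section \<open>From small oscillation to uniform closeness\<close>

lemma osc_mono: "osc U e f \<Longrightarrow> U' \<subseteq> U \<Longrightarrow> e \<le> e' \<Longrightarrow> osc U' e' f"
  unfolding osc_def by (meson Diff_mono add_left_mono order_refl order_trans subsetD)

lemma interval_meets:
  assumes "Z \<in> null_sets lborel" "w1 < (w2::real)"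
  shows "\<exists>y\<in>{w1<..<w2}. y \<notin> Z"
proof (rule ccontr)
  assume "\<not> ?thesis"
  then have "{w1<..<w2} \<subseteq> Z" by auto
  then have "{w1<..<w2} \<in> null_sets lborel" using assms(1) by (auto intro: null_sets_subset)
  then show False using assms(2) by (auto simp: null_sets_def)
qed

lemma AE_null_set: "AE x in lborel. P x \<Longrightarrow> \<exists>Z\<in>null_sets lborel. \<forall>x. x \<notin> Z \<longrightarrow> P x"
  unfolding eventually_ae_filter by auto

text \<open>Off a null set \<open>\<bar>f x - \<alpha> * g x\<bar>\<close> oscillates by at most
  \<open>2 * \<eta>\<close> on the interval. If it exceeded \<open>3 * \<eta>\<close> somewhere, it
  would exceed \<open>\<eta>\<close> throughout, against the bound on the integral.\<close>

lemma local_closeness: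
  assumes f: "integrable lborel f" "osc {u1<..<u2} \<eta> f" and g: "osc {u1<..<u2} \<eta> g"
    and \<psi>: "integrable lborel \<psi>" "AE x in lborel. x \<in> {u1<..<u2} \<longrightarrow> \<psi> x = \<alpha> * g x"
    and \<alpha>: "0 \<le> \<alpha>" "\<alpha> \<le> 1" and u: "u1 < u2" and \<eta>: "0 \<le> \<eta>"
    and close: "(LINT x|lborel. \<bar>f x - \<psi> x\<bar>) \<le> (u2 - u1) * \<eta>"
  shows "AE x in lborel. x \<in> {u1<..<u2} \<longrightarrow> \<bar>f x - \<alpha> * g x\<bar> \<le> 3 * \<eta>"
proof -
  obtain Z1 where Z1: "Z1 \<in> null_sets lborel" "\<forall>x\<in>{u1<..<u2} - Z1. \<forall>y\<in>{u1<..<u2} - Z1. f y \<le> f x + \<eta>"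
    using f(2) by (auto simp: osc_def)
  obtain Z2 where Z2: "Z2 \<in> null_sets lborel" "\<forall>x\<in>{u1<..<u2} - Z2. \<forall>y\<in>{u1<..<u2} - Z2. g y \<le> g x + \<eta>"
    using g by (auto simp: osc_def)
  obtain Z3 where Z3: "Z3 \<in> null_sets lborel" "\<And>x. x \<notin> Z3 \<Longrightarrow> x \<in> {u1<..<u2} \<longrightarrow> \<psi> x = \<alpha> * g x"
    using AE_null_set[OF \<psi>(2)] by blast
  define Z where "Z = Z1 \<union> Z2 \<union> Z3"
  have Z: "Z \<in> null_sets lborel" using Z1 Z2 Z3 by (auto simp: Z_def)
  have osc1: "\<bar>\<bar>f x - \<alpha> * g x\<bar> - \<bar>f y - \<alpha> * g y\<bar>\<bar> \<le> 2 * \<eta>" if "x \<in> {u1<..<u2} - Z" "y \<in> {u1<..<u2} - Z" for x y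
  proof -
    have "f y \<le> f x + \<eta>" "f x \<le> f y + \<eta>" using Z1(2) that unfolding Z_def by blast+
    moreover have "g y \<le> g x + \<eta>" "g x \<le> g y + \<eta>" using Z2(2) that unfolding Z_def by blast+
    then have "\<bar>g x - g y\<bar> \<le> \<eta>" by linarith
    then have "\<bar>\<alpha> * g x - \<alpha> * g y\<bar> \<le> \<eta>"
      using \<alpha> mult_mono[of \<alpha> 1 "\<bar>g x - g y\<bar>" \<eta>] by (simp add: right_diff_distrib[symmetric] abs_mult)
    ultimately show ?thesis by linarith
  qed
  have "\<bar>f x - \<alpha> * g x\<bar> \<le> 3 * \<eta>" if x: "x \<in> {u1<..<u2} - Z" for x
  proof -
    have "(LINT y|lborel. indicator {u1<..<u2} y * (\<bar>f x - \<alpha> * g x\<bar> - 2 * \<eta>)) \<le> (LINT y|lborel. \<bar>f y - \<psi> y\<bar>)"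
    proof (rule integral_mono_AE)
      have "AE y in lborel. y \<notin> Z" using Z by (rule AE_not_in)
      then show "AE y in lborel. indicator {u1<..<u2} y * (\<bar>f x - \<alpha> * g x\<bar> - 2 * \<eta>) \<le> \<bar>f y - \<psi> y\<bar>"
      proof eventually_elim
        case (elim y)
        show ?case
        proof (cases "y \<in> {u1<..<u2}")
          case True
          have "\<psi> y = \<alpha> * g y" using Z3(2)[of y] elim True unfolding Z_def by auto
          then show ?thesis using osc1[of x y] x elim True by simp
        qed simp
      qed
    qed (use f \<psi> u in \<open>auto intro!: integrable_mult_left integrable_real_indicator\<close>)
    then have "(u2 - u1) * (\<bar>f x - \<alpha> * g x\<bar> - 2 * \<eta>) \<le> (LINT y|lborel. \<bar>f y - \<psi> y\<bar>)" using u by simp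
    then have "(u2 - u1) * (\<bar>f x - \<alpha> * g x\<bar> - 2 * \<eta>) \<le> (u2 - u1) * \<eta>" using close by linarith
    then have "\<bar>f x - \<alpha> * g x\<bar> - 2 * \<eta> \<le> \<eta>" using u by (subst (asm) mult_le_cancel_left_pos) auto
    then show ?thesis by simp
  qed
  then show ?thesis using AE_not_in[OF Z] by (auto elim: eventually_mono)
qed

text \<open>The value at an interior point is the mean of the one-sided limits, so one of them is at
  least \<open>f q\<close>, and on that side \<open>f\<close> exceeds \<open>3 / 4 * f q\<close> on
  an interval. Small oscillation spreads the bound, with loss \<open>f q / 4\<close>, to the whole
  neighbourhood. Positivity at a single point thus becomes a bound almost everywhere.\<close>

lemma normalized_BV_lower:
  assumes BV: "normalized_BV f" and q: "q \<in> {0..1}" "0 < f q"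
    and o: "osc {u1<..<u2} \<eta> f" "u1 < q" "q < u2" "\<eta> \<le> f q / 4"
  shows "AE x in lborel. x \<in> {u1<..<u2} \<longrightarrow> f q / 2 \<le> f x"
proof -
  have t: "3 / 4 * f q < f q" using q(2) by simp
  have right: "\<exists>w1 w2. w1 < w2 \<and> {w1<..<w2} \<subseteq> {u1<..<u2} \<and> (\<forall>y\<in>{w1<..<w2}. 3 / 4 * f q < f y)"
    if "(f \<longlongrightarrow> v) (at_right q)" "f q \<le> v" for v
  proof -
    have "\<forall>\<^sub>F y in at_right q. 3 / 4 * f q < f y" by (rule order_tendstoD(1)[OF that(1)]) (use that(2) t in linarith)
    then obtain z where z: "q < z" "\<And>y. q < y \<Longrightarrow> y < z \<Longrightarrow> 3 / 4 * f q < f y" unfolding eventually_at_right_field by auto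
    then show ?thesis using o by (intro exI[of _ q] exI[of _ "min z u2"]) auto
  qed
  have left: "\<exists>w1 w2. w1 < w2 \<and> {w1<..<w2} \<subseteq> {u1<..<u2} \<and> (\<forall>y\<in>{w1<..<w2}. 3 / 4 * f q < f y)"
    if "(f \<longlongrightarrow> v) (at_left q)" "f q \<le> v" for v
  proof -
    have "\<forall>\<^sub>F y in at_left q. 3 / 4 * f q < f y" by (rule order_tendstoD(1)[OF that(1)]) (use that(2) t in linarith)
    then obtain z where z: "z < q" "\<And>y. z < y \<Longrightarrow> y < q \<Longrightarrow> 3 / 4 * f q < f y" unfolding eventually_at_left_field by auto
    then show ?thesis using o by (intro exI[of _ "max z u1"] exI[of _ q]) auto
  qed
  have "\<exists>w1 w2. w1 < w2 \<and> {w1<..<w2} \<subseteq> {u1<..<u2} \<and> (\<forall>y\<in>{w1<..<w2}. 3 / 4 * f q < f y)"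
  proof -
    consider "q = 0" | "q = 1" | "q \<in> {0<..<1}" using q(1) by fastforce
    then show ?thesis
    proof cases
      case 1
      then show ?thesis using right[of "f 0"] BV by (auto simp: normalized_BV_def)
    next
      case 2
      then show ?thesis using left[of "f 1"] BV by (auto simp: normalized_BV_def)
    next
      case 3
      then obtain u v where uv: "(f \<longlongrightarrow> u) (at_left q)" "(f \<longlongrightarrow> v) (at_right q)" "f q = (u + v) / 2"
        using BV unfolding normalized_BV_def by blast
      then have "f q \<le> u \<or> f q \<le> v" by argo
      then show ?thesis using left[OF uv(1)] right[OF uv(2)] by blast
    qed
  qed
  then obtain w1 w2 where w: "w1 < w2" "{w1<..<w2} \<subseteq> {u1<..<u2}" "\<And>y. y \<in> {w1<..<w2} \<Longrightarrow> 3 / 4 * f q < f y" by blast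
  obtain Z where Z: "Z \<in> null_sets lborel" "\<forall>x\<in>{u1<..<u2} - Z. \<forall>y\<in>{u1<..<u2} - Z. f y \<le> f x + \<eta>"
    using o(1) by (auto simp: osc_def)
  obtain y where y: "y \<in> {w1<..<w2}" "y \<notin> Z" using interval_meets[OF Z(1) w(1)] by blast
  have "f q / 2 \<le> f x" if "x \<in> {u1<..<u2} - Z" for x
  proof -
    have "f y \<le> f x + \<eta>" using Z(2) that y w(2) by blast
    then show ?thesis using w(3)[OF y(1)] o(4) by linarith
  qed
  then show ?thesis using AE_not_in[OF Z(1)] by (auto elim: eventually_mono)
qed

section \<open>Invariance of limits, and constants uniform in the parameter\<close>

context pw_family
begin

interpretation Z: pw d "\<lambda>i. c i 0" "\<lambda>i. E i 0" "\<lambda>i. E' i 0" lam K using pw e0 by simp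

definition Te :: "real \<Rightarrow> real \<Rightarrow> real" where
  "Te e = pw.Tm d (\<lambda>i. c i e) (\<lambda>i. E i e)"

definition invd :: "real \<Rightarrow> (real \<Rightarrow> real) \<Rightarrow> bool" where
  "invd e f \<longleftrightarrow> dens {0..1} f \<and>
     (\<forall>A\<in>sets borel. (LINT x|lborel. indicator A (Te e x) * f x) = (LINT x|lborel. indicator A x * f x))"

lemma Te_measurable: "0 \<le> e \<Longrightarrow> e < e0 \<Longrightarrow> Te e \<in> borel_measurable borel"
  unfolding Te_def by (rule pw.Tm_measurable[OF pw])

lemma Te_tendsto:
  assumes s: "\<And>n. 0 \<le> s n" "\<And>n. s n < e0" "s \<longlonglongrightarrow> 0" and x: "i < d" "x \<in> Z.gap i"
  shows "(\<lambda>n. Te (s n) x) \<longlonglongrightarrow> Te 0 x"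
proof (rule LIMSEQ_I)
  fix \<eta> :: real assume \<eta>: "0 < \<eta>"
  define h where "h = min (x - c i 0) (c (Suc i) 0 - x)"
  have h: "0 < h" using x by (auto simp: h_def Z.gap_def)
  obtain \<delta>1 where \<delta>1: "\<delta>1 > 0" "\<forall>e\<in>{0..<\<delta>1}. \<forall>i\<le>d. \<bar>c i e - c i 0\<bar> < h" using c_near[OF h] by blast
  obtain \<delta>2 where \<delta>2: "\<delta>2 > 0" "\<forall>e\<in>{0..<\<delta>2}. \<forall>r\<in>{c i e..c (Suc i) e}.
      \<forall>q\<in>{c i 0..c (Suc i) 0}. \<bar>r - q\<bar> < \<delta>2 \<longrightarrow> \<bar>E i e r - E i 0 q\<bar> < \<eta>" using E_near[OF x(1) \<eta>] by blast
  obtain n0 where n0: "\<And>n. n \<ge> n0 \<Longrightarrow> s n < min \<delta>1 \<delta>2"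
    using order_tendstoD(2)[OF s(3), of "min \<delta>1 \<delta>2"] \<delta>1 \<delta>2 unfolding eventually_sequentially by auto
  have "norm (Te (s n) x - Te 0 x) < \<eta>" if n: "n \<ge> n0" for n
  proof -
    interpret P: pw d "\<lambda>i. c i (s n)" "\<lambda>i. E i (s n)" "\<lambda>i. E' i (s n)" lam K using pw s by auto
    have e: "s n \<in> {0..<\<delta>1}" "s n \<in> {0..<\<delta>2}" using n0[OF n] s(1)[of n] by auto
    have "\<bar>c i (s n) - c i 0\<bar> < h" "\<bar>c (Suc i) (s n) - c (Suc i) 0\<bar> < h" using \<delta>1(2) e(1) x(1) by auto
    then have xg: "x \<in> P.gap i" unfolding P.gap_def h_def by auto
    have "Te (s n) x = E i (s n) x" "Te 0 x = E i 0 x"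
      unfolding Te_def using P.Tm_gap[OF x(1) xg] Z.Tm_gap[OF x] by auto
    moreover have "\<bar>E i (s n) x - E i 0 x\<bar> < \<eta>"
      using \<delta>2(2)[rule_format, OF e(2), of x x] \<delta>2(1) xg x(2) by (auto simp: P.gap_def Z.gap_def)
    ultimately show ?thesis by simp
  qed
  then show "\<exists>n0. \<forall>n\<ge>n0. norm (Te (s n) x - Te 0 x) < \<eta>" by blast
qed

text \<open>Half-lines suffice as test sets, because the distribution function determines the
  measure. For almost every \<open>x\<close> the image under \<open>Te 0\<close> is not the end
  point \<open>a\<close>, so the indicators converge there and dominated convergence
  applies.\<close>

lemma limit_invariant:
  assumes s: "\<And>n. 0 \<le> s n" "\<And>n. s n < e0" "s \<longlonglongrightarrow> 0"
    and f: "\<And>n. invd (s n) (f n)" and \<psi>: "dens {0..1} \<psi>"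
    and lim: "(\<lambda>n. LINT x|lborel. \<bar>f n x - \<psi> x\<bar>) \<longlonglongrightarrow> 0"
  shows "invd 0 \<psi>"
proof -
  have fd: "dens {0..1} (f n)" for n using f by (simp add: invd_def)
  have fi: "integrable lborel (f n)" for n using integrable_dens[OF fd] .
  have pi: "integrable lborel \<psi>" using integrable_dens[OF \<psi>] .
  note [measurable] = dens_measurable[OF fd] dens_measurable[OF \<psi>] Te_measurable[OF s(1,2)] Te_measurable[OF order_refl e0]
  have half: "(LINT x|lborel. indicator {..a} (Te 0 x) * \<psi> x) = (LINT x|lborel. indicator {..a} x * \<psi> x)" for a :: real
  proof -
    have 1: "(\<lambda>n. LINT x|lborel. indicator {..a} (Te (s n) x) * \<psi> x) \<longlonglongrightarrow> (LINT x|lborel. indicator {..a} (Te 0 x) * \<psi> x)"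
    proof (rule integral_dominated_convergence[where w = \<psi>])
      show "AE x in lborel. (\<lambda>n. indicator {..a} (Te (s n) x) * \<psi> x) \<longlonglongrightarrow> indicator {..a} (Te 0 x) * \<psi> x"
        using Z.Tm_neq[of a]
      proof eventually_elim
        case (elim x)
        show ?case
        proof (cases "x \<in> {0..1}")
          case True
          then obtain i where i: "i < d" "x \<in> Z.gap i" using Z.gap_exists[of x] elim by blast
          have lim: "(\<lambda>n. Te (s n) x) \<longlonglongrightarrow> Te 0 x" by (rule Te_tendsto[OF s i])
          have ne: "Te 0 x \<noteq> a" using elim True by (simp add: Te_def)
          have "\<forall>\<^sub>F n in sequentially. indicator {..a} (Te (s n) x) * \<psi> x = indicator {..a} (Te 0 x) * \<psi> x"
          proof (cases "Te 0 x < a")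
            case True
            show ?thesis using order_tendstoD(2)[OF lim True] by eventually_elim (use True in \<open>auto simp: indicator_def\<close>)
          next
            case False
            then have "a < Te 0 x" using ne by simp
            from order_tendstoD(1)[OF lim this] show ?thesis
              by eventually_elim (use \<open>a < Te 0 x\<close> in \<open>auto simp: indicator_def\<close>)
          qed
          then show ?thesis by (rule tendsto_eventually)
        qed (use \<psi> in \<open>simp add: dens_def\<close>)
      qed
      show "AE x in lborel. norm (indicator {..a} (Te (s n) x) * \<psi> x) \<le> \<psi> x" for n
        using dens_nonneg[OF \<psi>] by (auto simp: indicator_def)
    qed (use pi in auto)
    have ind: "(LINT x|lborel. indicator {..a} (Te (s n) x) * g x) = (LINT x|lborel. indicator (Te (s n) -` {..a}) x * g x)" for n and g :: "real \<Rightarrow> real"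
      by (auto intro!: Bochner_Integration.integral_cong simp: indicator_def)
    have m: "Te (s n) -` {..a} \<in> sets borel" for n using measurable_sets[OF Te_measurable[OF s(1,2)], of "{..a}" n] by simp
    have 2: "\<bar>(LINT x|lborel. indicator {..a} (Te (s n) x) * \<psi> x) - (LINT x|lborel. indicator {..a} x * \<psi> x)\<bar> \<le> 2 * (LINT x|lborel. \<bar>f n x - \<psi> x\<bar>)" for n
    proof -
      have "(LINT x|lborel. indicator {..a} (Te (s n) x) * f n x) = (LINT x|lborel. indicator {..a} x * f n x)"
        using f[of n] by (auto simp: invd_def)
      then show ?thesis using L1_close[OF fi pi m, of n n] L1_close[OF fi pi, of "{..a}" n] unfolding ind by auto
    qed
    have "(\<lambda>n. (LINT x|lborel. indicator {..a} (Te (s n) x) * \<psi> x) - (LINT x|lborel. indicator {..a} x * \<psi> x)) \<longlonglongrightarrow> 0"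
    proof (rule Lim_null_comparison[OF always_eventually])
      show "\<forall>n. norm ((LINT x|lborel. indicator {..a} (Te (s n) x) * \<psi> x) - (LINT x|lborel. indicator {..a} x * \<psi> x)) \<le> 2 * (LINT x|lborel. \<bar>f n x - \<psi> x\<bar>)"
        using 2 by simp
      show "(\<lambda>n. 2 * (LINT x|lborel. \<bar>f n x - \<psi> x\<bar>)) \<longlonglongrightarrow> 0" using tendsto_mult_right_zero[OF lim, of 2] by (simp add: mult.commute)
    qed
    from LIM_zero_cancel[OF this] show ?thesis by (rule LIMSEQ_unique[OF 1])
  qed
  let ?\<mu> = "density lborel (\<lambda>x. ennreal (\<psi> x))"
  let ?\<nu> = "distr ?\<mu> borel (Te 0)"
  have p: "prob_space ?\<mu>" by (rule prob_spaceI) (use dens_emeasure[OF \<psi>, of UNIV] \<psi> in \<open>simp add: dens_def\<close>)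
  interpret M: prob_space ?\<mu> by (rule p)
  have p2: "prob_space ?\<nu>" by (rule M.prob_space_distr) simp
  have vm: "Te 0 -` A \<in> sets borel" if "A \<in> sets borel" for A
    using measurable_sets[OF Te_measurable[OF order_refl e0] that] by simp
  have ind0: "(LINT x|lborel. indicator (Te 0 -` A) x * \<psi> x) = (LINT x|lborel. indicator A (Te 0 x) * \<psi> x)" for A
    by (auto intro!: Bochner_Integration.integral_cong simp: indicator_def)
  have em: "emeasure ?\<nu> A = ennreal (LINT x|lborel. indicator A (Te 0 x) * \<psi> x)" if A: "A \<in> sets borel" for A
    using dens_emeasure[OF \<psi> vm[OF A]] A by (subst emeasure_distr) (auto simp: ind0)
  have rd: "real_distribution ?\<mu>" "real_distribution ?\<nu>"
    using p p2 by (auto simp: real_distribution_def real_distribution_axioms_def)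
  have "cdf ?\<mu> = cdf ?\<nu>"
    by (rule ext) (simp add: cdf_def measure_def em dens_emeasure[OF \<psi>] half)
  then have eq: "?\<mu> = ?\<nu>" by (rule cdf_unique[OF rd])
  show ?thesis unfolding invd_def
  proof (intro conjI \<psi> ballI)
    fix A :: "real set" assume A: "A \<in> sets borel"
    have "ennreal (LINT x|lborel. indicator A x * \<psi> x) = ennreal (LINT x|lborel. indicator A (Te 0 x) * \<psi> x)"
      using em[OF A] dens_emeasure[OF \<psi> A] eq by simp
    then show "(LINT x|lborel. indicator A (Te 0 x) * \<psi> x) = (LINT x|lborel. indicator A x * \<psi> x)"
      using integral_le_1(1)[OF \<psi> A] integral_le_1(1)[OF \<psi> vm[OF A]] by (simp add: ind0)
  qed
qed

definition good :: "real \<Rightarrow> real \<Rightarrow> real \<Rightarrow> real \<Rightarrow> real \<Rightarrow> (real \<Rightarrow> real) \<Rightarrow> bool" where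
  "good M B Dc Bm e f \<longleftrightarrow> tight M B f \<and> (\<forall>k x1 x2. {x1<..<x2} \<inter> PCe k e = {} \<longrightarrow>
     osc {x1<..<x2} ((exp (Dc * (x2 - x1)) - 1) * M + Bm / lam ^ k) f)"

text \<open>The constants depend on the interval only through the lower bound \<open>w\<close> for
  its length, which limits the initial jumps. So the same constants serve the two sides at parameter
  0 and the unit interval at positive parameters.\<close>

lemma uniform_good:
  assumes "2 < lam \<or> (\<forall>x\<in>Ci. \<forall>n>0. x \<notin> (Mv ^^ n) {x})" and w: "0 < w"
  shows "\<exists>M B Dc Bm \<delta>. 0 < \<delta> \<and> \<delta> \<le> e0 \<and> 0 \<le> Bm \<and> (\<forall>e\<in>{0..<\<delta>}. \<forall>s t \<mu> \<phi>.
     0 \<le> s \<longrightarrow> t \<le> 1 \<longrightarrow> w \<le> t - s \<longrightarrow> (\<forall>i<d. \<forall>x\<in>{s..t} \<inter> {c i e<..<c (Suc i) e}. E i e x \<in> {s..t}) \<longrightarrow>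
     (\<exists>!\<nu>. acim (T e) {s..t} \<nu>) \<longrightarrow> acim (T e) {s..t} \<mu> \<longrightarrow> has_density \<mu> {s..t} \<phi> \<longrightarrow> good M B Dc Bm e \<phi>)"
proof -
  obtain ell kap Vm \<delta> where \<delta>: "0 < \<delta>" "\<delta> \<le> e0" and
    V: "\<And>e. e \<in> {0..<\<delta>} \<Longrightarrow> \<exists>V. pw_pot d (\<lambda>i. c i e) (\<lambda>i. E i e) (\<lambda>i. E' i e) lam K ell kap Vm V"
    using potentials[OF assms(1)] by blast
  define m where "m = 2 * Vm / w"
  define Dc where "Dc = pw_pot.D lam K"
  define M where "M = pw_pot.supb d lam K ell kap Vm m"
  define Bm where "Bm = pw_pot.Bd d lam K ell kap Vm m"
  have main: "good M (Dc * exp Dc * M + Bm) Dc Bm e \<phi>"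
    if e: "e \<in> {0..<\<delta>}" and st: "0 \<le> s" "t \<le> 1" "w \<le> t - s"
      and inv: "\<forall>i<d. \<forall>x\<in>{s..t} \<inter> {c i e<..<c (Suc i) e}. E i e x \<in> {s..t}"
      and \<mu>: "\<exists>!\<nu>. acim (T e) {s..t} \<nu>" "acim (T e) {s..t} \<mu>" "has_density \<mu> {s..t} \<phi>" for e s t \<mu> \<phi>
  proof -
    from V[OF e] obtain V where "pw_pot d (\<lambda>i. c i e) (\<lambda>i. E i e) (\<lambda>i. E' i e) lam K ell kap Vm V" by blast
    then interpret P: pw_pot d "\<lambda>i. c i e" "\<lambda>i. E i e" "\<lambda>i. E' i e" lam K ell kap Vm V .
    have mm: "2 * Vm / (t - s) \<le> m" unfolding m_def using P.Vm1 st w by (intro divide_left_mono) auto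
    have st2: "s < t" using st w by linarith
    have i2: "E i e x \<in> {s..t}" if "i < d" "x \<in> {s..t}" "x \<in> P.gap i" for i x
      using inv that unfolding P.gap_def by blast
    have T2: "T e x = E i e x" if "i < d" "x \<in> P.gap i" for i x
      using T_E[of e i x] that e \<delta> unfolding P.gap_def by auto
    note b = P.unique_acim_bounds[OF st(1) st2 st(2) i2 T2 \<mu> mm]
    show ?thesis unfolding good_def PCe_def Dc_def M_def Bm_def using b by blast
  qed
  have "0 \<le> Bm"
  proof -
    from V[of 0] \<delta> obtain V where "pw_pot d (\<lambda>i. c i 0) (\<lambda>i. E i 0) (\<lambda>i. E' i 0) lam K ell kap Vm V" by auto
    then show ?thesis unfolding Bm_def by (rule pw_pot.Bd)
  qed
  note Bm = this
  show ?thesis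
    by (intro exI[of _ M] exI[of _ "Dc * exp Dc * M + Bm"] exI[of _ Dc] exI[of _ Bm] exI[of _ \<delta>] conjI \<delta> Bm ballI allI impI)
      (rule main)
qed

text \<open>\<open>m\<close> makes the mass of old jumps small, \<open>r\<close> is at most half the
  distance from \<open>q\<close> to the finite set \<open>G m\<close>, and only then
  \<open>\<delta>\<close> brings the recent jumps to within \<open>r\<close> of \<open>G m\<close>.
  The radius therefore does not depend on the parameter.\<close>

lemma local_osc:
  assumes q: "\<And>m. q \<notin> G m" and \<eta>: "0 < \<eta>" and Bm: "0 \<le> Bm"
  shows "\<exists>r0>0. \<forall>r. 0 < r \<and> r \<le> r0 \<longrightarrow> (\<exists>\<delta>>0. \<forall>e\<in>{0..<\<delta>}. \<forall>f. good M B Dc Bm e f \<longrightarrow> osc {q - r<..<q + r} \<eta> f)"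
proof -
  obtain m where m: "Bm / lam ^ m \<le> \<eta> / 2"
  proof -
    obtain m where "2 * Bm / \<eta> < lam ^ m" using real_arch_pow[OF Z.lam1] by blast
    then have "2 * Bm < \<eta> * lam ^ m" using \<eta> by (simp add: pos_divide_less_eq mult.commute)
    moreover have "0 < lam ^ m" using Z.lam1 by simp
    ultimately show thesis using \<eta> by (intro that[of m]) (simp add: field_simps)
  qed
  have "((\<lambda>r. (exp (Dc * (2 * r)) - 1) * M) \<longlongrightarrow> (exp (Dc * (2 * 0)) - 1) * M) (at_right 0)"
    by (intro tendsto_intros)
  then have "\<forall>\<^sub>F r in at_right 0. (exp (Dc * (2 * r)) - 1) * M < \<eta> / 2"
    by (rule order_tendstoD(2)) (use \<eta> in simp)
  moreover have "\<forall>\<^sub>F r in at_right 0. \<forall>y\<in>G m. 2 * r \<le> \<bar>y - q\<bar>"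
  proof (intro eventually_ball_finite G_finite ballI)
    fix y assume "y \<in> G m"
    then have "0 < \<bar>y - q\<bar>" using q by auto
    then show "\<forall>\<^sub>F r in at_right 0. 2 * r \<le> \<bar>y - q\<bar>" by (intro small_evI[of "\<bar>y - q\<bar> / 2"]) auto
  qed
  ultimately have "\<forall>\<^sub>F r in at_right 0. (exp (Dc * (2 * r)) - 1) * M < \<eta> / 2 \<and> (\<forall>y\<in>G m. 2 * r \<le> \<bar>y - q\<bar>)"
    by (rule eventually_conj)
  then obtain r0 where r0: "r0 > 0" "\<And>r. 0 < r \<Longrightarrow> r \<le> r0 \<Longrightarrow> (exp (Dc * (2 * r)) - 1) * M < \<eta> / 2 \<and> (\<forall>y\<in>G m. 2 * r \<le> \<bar>y - q\<bar>)"
    by (elim small_evE) blast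
  show ?thesis
  proof (rule exI[of _ r0], intro conjI allI impI r0(1))
    fix r assume r: "0 < r \<and> r \<le> r0"
    obtain \<delta> where \<delta>: "\<delta> > 0" "\<forall>e\<in>{0..<\<delta>}. \<forall>p\<in>PCe m e. \<exists>y\<in>G m. \<bar>p - y\<bar> < r"
      using small_evD[OF PC_near[of r m]] r by blast
    show "\<exists>\<delta>>0. \<forall>e\<in>{0..<\<delta>}. \<forall>f. good M B Dc Bm e f \<longrightarrow> osc {q - r<..<q + r} \<eta> f"
    proof (intro exI[of _ \<delta>] conjI \<delta>(1) ballI allI impI)
      fix e f assume e: "e \<in> {0..<\<delta>}" and g: "good M B Dc Bm e f"
      have "{q - r<..<q + r} \<inter> PCe m e = {}"
      proof (rule ccontr)
        assume "\<not> ?thesis"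
        then obtain p where p: "p \<in> {q - r<..<q + r}" "p \<in> PCe m e" by blast
        then obtain y where "y \<in> G m" "\<bar>p - y\<bar> < r" using \<delta>(2) e by blast
        moreover have "2 * r \<le> \<bar>y - q\<bar>" using r0(2)[of r] r \<open>y \<in> G m\<close> by blast
        ultimately show False using p(1) by auto
      qed
      then have "osc {q - r<..<q + r} ((exp (Dc * ((q + r) - (q - r))) - 1) * M + Bm / lam ^ m) f"
        using g unfolding good_def by blast
      moreover have "(exp (Dc * ((q + r) - (q - r))) - 1) * M + Bm / lam ^ m \<le> \<eta>"
      proof -
        have "(q + r) - (q - r) = 2 * r" by simp
        then show ?thesis using r0(2)[of r] r m by (simp del: mult_2) argo
      qed
      ultimately show "osc {q - r<..<q + r} \<eta> f" by (rule osc_mono[OF _ order_refl])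
    qed
  qed
qed

end

subsection \<open>Holes\<close>

context pw_family
begin

interpretation Z: pw d "\<lambda>i. c i 0" "\<lambda>i. E i 0" "\<lambda>i. E' i 0" lam K using pw e0 by simp

text \<open>The hole in \<open>S\<close> leading to \<open>S'\<close>, without \<open>b\<close> and
  the critical points. What is removed is finite, and on the rest the multivalued map has the single
  value \<open>Te e x\<close>.\<close>

definition Hs :: "real \<Rightarrow> real \<Rightarrow> real set \<Rightarrow> real set \<Rightarrow> real set" where
  "Hs b e S S' = {x \<in> S. x \<noteq> b \<and> x \<notin> (\<lambda>i. c i e) ` {..d} \<and> Te e x \<in> S'}"

lemma Hs_borel:
  assumes "0 \<le> e" "e < e0" "S \<in> sets borel" "S' \<in> sets borel"
  shows "Hs b e S S' \<in> sets borel"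
proof -
  have "Hs b e S S' = (S \<inter> Te e -` S') - insert b ((\<lambda>i. c i e) ` {..d})" by (auto simp: Hs_def)
  moreover have "Te e -` S' \<in> sets borel" using measurable_sets[OF Te_measurable[OF assms(1,2)] assms(4)] by simp
  moreover have "insert b ((\<lambda>i. c i e) ` {..d}) \<in> sets borel" by (intro borel_closed finite_imp_closed) auto
  ultimately show ?thesis using assms by auto
qed

text \<open>Invariance gives \<open>S'\<close> and its preimage the same mass; removing the points
  that stay in \<open>S'\<close> leaves what enters it and what leaves it.\<close>

lemma balance:
  assumes e: "0 \<le> e" "e < e0" and f: "invd e f"
    and S: "S \<in> sets borel" "S' \<in> sets borel" "S \<union> S' = {0..1}" "S \<inter> S' = {b}"
  shows "(LINT x|lborel. indicator (Hs b e S S') x * f x) = (LINT x|lborel. indicator (Hs b e S' S) x * f x)"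
proof -
  interpret P: pw d "\<lambda>i. c i e" "\<lambda>i. E i e" "\<lambda>i. E' i e" lam K by (rule pw[OF e])
  have fd: "dens {0..1} f" using f by (simp add: invd_def)
  have fi: "integrable lborel f" using fd by (rule integrable_dens)
  note [measurable] = S(1,2) dens_measurable[OF fd] Te_measurable[OF e] Hs_borel[OF e S(1,2), of b] Hs_borel[OF e S(2,1), of b]
  have ind: "(LINT x|lborel. indicator S' (Te e x) * f x) = (LINT x|lborel. indicator (Te e -` S') x * f x)"
    by (auto intro!: Bochner_Integration.integral_cong simp: indicator_def)
  have m: "Te e -` S' \<in> sets borel" using measurable_sets[OF Te_measurable[OF e] S(2)] by simp
  have "(LINT x|lborel. indicator (Te e -` S') x * f x - indicator S' x * f x) =
      (LINT x|lborel. indicator (Hs b e S S') x * f x - indicator (Hs b e S' S) x * f x)"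
  proof (rule integral_cong_AE)
    have "AE x in lborel. x \<noteq> b" by (rule AE_lborel_singleton)
    then show "AE x in lborel. indicator (Te e -` S') x * f x - indicator S' x * f x =
      indicator (Hs b e S S') x * f x - indicator (Hs b e S' S) x * f x"
      using P.Tm_neq[of b]
    proof eventually_elim
      case (elim x)
      show ?case
      proof (cases "x \<in> {0..1}")
        case True
        have x: "x \<notin> (\<lambda>i. c i e) ` {..d}" "Te e x \<noteq> b" using elim True by (auto simp: Te_def)
        obtain i where i: "i < d" "x \<in> P.gap i" using P.gap_exists[OF True x(1)] by blast
        have "Te e x \<in> {0..1}" using P.range[of i x] i P.Tm_gap[OF i] by (auto simp: Te_def P.gap_def)
        then have "(Te e x \<in> S) \<noteq> (Te e x \<in> S')" using S(3,4) x(2) by blast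
        moreover have "(x \<in> S) \<noteq> (x \<in> S')" using S(3,4) True elim(1) by blast
        ultimately show ?thesis using x elim(1) by (auto simp: Hs_def indicator_def)
      qed (use fd in \<open>simp add: dens_def\<close>)
    qed
  qed (use m in measurable)
  then have "(LINT x|lborel. indicator (Te e -` S') x * f x) - (LINT x|lborel. indicator S' x * f x) =
      (LINT x|lborel. indicator (Hs b e S S') x * f x) - (LINT x|lborel. indicator (Hs b e S' S) x * f x)"
    using m fi S Hs_borel[OF e S(1,2)] Hs_borel[OF e S(2,1)] by (simp add: int_ind)
  moreover have "(LINT x|lborel. indicator S' (Te e x) * f x) = (LINT x|lborel. indicator S' x * f x)"
    using f S(2) by (auto simp: invd_def)
  ultimately show ?thesis unfolding ind by simp
qed

definition holes :: "real \<Rightarrow> real set" where "holes b = {q. b \<in> mv q} - {b}"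

lemma holes_finite: "finite (holes b)"
proof -
  have "finite (\<Union>i<d. {x \<in> {c i 0..c (Suc i) 0}. E i 0 x = b})" by (intro finite_UN_I Z.finite_level) auto
  then show ?thesis by (rule finite_subset[rotated]) (auto simp: holes_def mv_def)
qed

lemma holes_range: "holes b \<subseteq> {0..1}"
proof
  fix q assume "q \<in> holes b"
  then obtain i where "i < d" "q \<in> {c i 0..c (Suc i) 0}" by (auto simp: holes_def mv_def)
  then show "q \<in> {0..1}" using Z.c_range[of i] Z.c_range[of "Suc i"] by auto
qed

text \<open>At a point of \<open>S\<close> other than \<open>b\<close> and the infinitesimal holes,
  all values \<open>mv\<close> lie in \<open>S\<close> and differ from \<open>b\<close>, so they
  have a positive distance from the closed set \<open>S'\<close>, which small perturbations
  preserve. Compactness makes this uniform; around \<open>b\<close> it is the hypothesis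
  \<open>nb\<close> that excludes holes.\<close>

lemma hole_near:
  assumes S: "compact S" "closed S'" "S \<subseteq> {0..1}" "S \<inter> S' = {b}"
    and mvS: "\<And>q. q \<in> S \<Longrightarrow> q \<noteq> b \<Longrightarrow> mv q \<subseteq> S"
    and nb: "\<exists>\<delta>>0. \<forall>e\<in>{0<..<\<delta>}. \<forall>x\<in>S. \<bar>x - b\<bar> < \<delta> \<longrightarrow> x \<noteq> b \<longrightarrow> x \<notin> (\<lambda>i. c i e) ` {..d} \<longrightarrow> Te e x \<notin> S'"
    and \<eta>: "0 < \<eta>"
  shows "\<exists>\<delta>>0. \<forall>x\<in>S. \<forall>e\<in>{0<..<\<delta>}. x \<in> Hs b e S S' \<longrightarrow> (\<exists>q\<in>holes b \<inter> S. \<bar>x - q\<bar> < \<eta>)"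
proof (rule compact_uniform[OF S(1)])
  fix q assume q: "q \<in> S"
  show "\<exists>\<delta>>0. \<forall>r\<in>S. \<bar>r - q\<bar> < \<delta> \<longrightarrow> (\<forall>e\<in>{0<..<\<delta>}. r \<in> Hs b e S S' \<longrightarrow> (\<exists>q\<in>holes b \<inter> S. \<bar>r - q\<bar> < \<eta>))"
  proof (cases "q = b")
    case True
    then show ?thesis using nb unfolding Hs_def by blast
  next
    case ne: False
    show ?thesis
    proof (cases "q \<in> holes b")
      case True
      then show ?thesis using q \<eta> by (intro exI[of _ \<eta>]) auto
    next
      case False
      have sub: "mv q \<subseteq> - S'" using mvS[OF q ne] False ne S(4) by (auto simp: holes_def)
      have "\<forall>\<^sub>F \<eta>1 in at_right 0. \<forall>y\<in>mv q. \<forall>z. \<bar>z - y\<bar> < \<eta>1 \<longrightarrow> z \<notin> S'"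
      proof (intro eventually_ball_finite mv_finite ballI)
        fix y assume "y \<in> mv q"
        then have "y \<in> - S'" using sub by blast
        then obtain h where h: "h > 0" "ball y h \<subseteq> - S'" using S(2) by (meson open_Compl open_contains_ball)
        show "\<forall>\<^sub>F \<eta>1 in at_right 0. \<forall>z. \<bar>z - y\<bar> < \<eta>1 \<longrightarrow> z \<notin> S'"
        proof (rule small_evI[OF h(1)], intro allI impI)
          fix \<eta>1 z assume "\<eta>1 \<le> h" "\<bar>z - y\<bar> < \<eta>1"
          then have "z \<in> ball y h" by (simp add: dist_real_def abs_minus_commute)
          then show "z \<notin> S'" using h(2) by blast
        qed
      qed
      then obtain \<eta>1 where \<eta>1: "\<eta>1 > 0" "\<And>y z. y \<in> mv q \<Longrightarrow> \<bar>z - y\<bar> < \<eta>1 \<Longrightarrow> z \<notin> S'"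
        using small_evD by blast
      have "\<forall>\<^sub>F \<delta> in at_right 0. \<delta> \<le> e0" using e0 by (intro small_evI[of e0]) auto
      with shadow[OF \<eta>1(1), of q] have "\<forall>\<^sub>F \<delta> in at_right 0. (\<forall>e\<in>{0..<\<delta>}. \<forall>i<d. \<forall>r\<in>{c i e..c (Suc i) e}. \<bar>r - q\<bar> < \<delta> \<longrightarrow>
        (\<exists>y\<in>mv q. \<bar>E i e r - y\<bar> < \<eta>1)) \<and> \<delta> \<le> e0" by (rule eventually_conj)
      then obtain \<delta> where \<delta>: "\<delta> > 0" "\<delta> \<le> e0" "\<And>e i r. e \<in> {0..<\<delta>} \<Longrightarrow> i < d \<Longrightarrow> r \<in> {c i e..c (Suc i) e} \<Longrightarrow> \<bar>r - q\<bar> < \<delta> \<Longrightarrow>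
        \<exists>y\<in>mv q. \<bar>E i e r - y\<bar> < \<eta>1" using small_evD by blast
      have "r \<notin> Hs b e S S'" if r: "r \<in> S" "\<bar>r - q\<bar> < \<delta>" "e \<in> {0<..<\<delta>}" for r e
      proof
        assume H: "r \<in> Hs b e S S'"
        interpret P: pw d "\<lambda>i. c i e" "\<lambda>i. E i e" "\<lambda>i. E' i e" lam K using pw r(3) \<delta>(2) by auto
        have "r \<in> {0..1}" "r \<notin> (\<lambda>i. c i e) ` {..d}" using H S(3) by (auto simp: Hs_def)
        then obtain i where i: "i < d" "r \<in> P.gap i" by (rule P.gap_exists)
        then have "r \<in> {c i e..c (Suc i) e}" by (auto simp: P.gap_def)
        with \<delta>(3)[of e i r] r i obtain y where "y \<in> mv q" "\<bar>E i e r - y\<bar> < \<eta>1" by auto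
        then have "E i e r \<notin> S'" using \<eta>1(2) by blast
        then show False using H P.Tm_gap[OF i] by (simp add: Hs_def Te_def)
      qed
      then show ?thesis using \<delta>(1) by blast
    qed
  qed
qed auto

text \<open>If \<open>b\<close> is not critical, it is a fixed point for every parameter, and what
  has to be shown is that the branch through it is increasing. If \<open>b\<close> is critical, the
  strict inequalities for the one-sided values persist, once \<open>b\<close> is known to be the
  critical point of the same index for all small parameters.\<close>

lemma near_b:
  assumes b: "0 < b" "b < 1"
    and inv: "invariant_interval CC (T 0) 0 b" "invariant_interval CC (T 0) b 1"
    and nc: "\<And>e. b \<notin> CC \<Longrightarrow> e > 0 \<Longrightarrow> mvals (crit d (\<lambda>i. c i e)) (T e) 0 1 b = {b}"
    and cr: "b \<in> CC \<Longrightarrow> (\<exists>y<b. (T 0 \<longlongrightarrow> y) (at_left b)) \<and> (\<exists>y>b. (T 0 \<longlongrightarrow> y) (at_right b)) \<and>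
      (\<forall>e>0. b \<in> crit d (\<lambda>i. c i e))"
  shows "\<exists>\<delta>>0. \<forall>e\<in>{0<..<\<delta>}. \<forall>x\<in>{0..1}. \<bar>x - b\<bar> < \<delta> \<longrightarrow> x \<notin> (\<lambda>i. c i e) ` {..d} \<longrightarrow>
    (x < b \<longrightarrow> Te e x < b) \<and> (b < x \<longrightarrow> b < Te e x)"
proof (cases "b \<in> CC")
  case False
  then obtain j where j: "j < d" "b \<in> Z.gap j"
    using Z.gap_exists[of b] b by (auto simp: CC_def crit_def)
  have bj: "c j 0 < b" "b < c (Suc j) 0" using j by (auto simp: Z.gap_def)
  define h where "h = min (b - c j 0) (c (Suc j) 0 - b) / 2"
  have h: "0 < h" "h \<le> (b - c j 0) / 2" "h \<le> (c (Suc j) 0 - b) / 2" using bj by (simp_all add: h_def)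
  \<comment> \<open>A test point at distance \<open>h\<close> left of \<open>b\<close>. Expansion
    pushes its image under \<open>E j 0\<close> to \<open>b - h\<close> or further left, so a
    perturbation smaller than \<open>h\<close> leaves the image left of \<open>b\<close>; a
    decreasing branch fixing \<open>b\<close> could not do that.\<close>
  define x1 where "x1 = b - h"
  have x1: "x1 \<in> Z.gap j" "x1 < b" "0 \<le> x1" using h bj Z.c_range[of j] j(1) by (auto simp: x1_def Z.gap_def)
  interpret B0: branch "c j 0" "c (Suc j) 0" "E j 0" "E' j 0" lam K by (rule Z.br[OF j(1)])
  have E0b: "E j 0 b = b"
    using E_side(1)[OF b j inv(1)] E_side(2)[OF b j inv(2)] b by auto
  have E0x1: "E j 0 x1 \<le> b - h"
  proof -
    have "E j 0 x1 \<le> b" using E_side(1)[OF b j(1) x1(1) inv(1)] x1 by auto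
    moreover have "lam * \<bar>b - x1\<bar> \<le> \<bar>E j 0 b - E j 0 x1\<bar>" using x1 j by (intro B0.expansion) (auto simp: Z.gap_def)
    moreover have "1 * \<bar>b - x1\<bar> \<le> lam * \<bar>b - x1\<bar>" using Z.lam1 by (intro mult_right_mono) auto
    ultimately have "\<bar>b - x1\<bar> \<le> \<bar>b - E j 0 x1\<bar>" "E j 0 x1 \<le> b" using E0b by simp_all
    moreover have "\<bar>b - x1\<bar> = h" using h by (simp add: x1_def)
    ultimately show ?thesis by linarith
  qed
  obtain \<delta>1 where \<delta>1: "\<delta>1 > 0" "\<And>e i. e \<in> {0..<\<delta>1} \<Longrightarrow> i \<le> d \<Longrightarrow> \<bar>c i e - c i 0\<bar> < h" using c_near[OF h(1)] by blast
  obtain \<delta>2 where \<delta>2: "\<delta>2 > 0" "\<forall>e\<in>{0..<\<delta>2}. \<forall>r\<in>{c j e..c (Suc j) e}.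
      \<forall>q\<in>{c j 0..c (Suc j) 0}. \<bar>r - q\<bar> < \<delta>2 \<longrightarrow> \<bar>E j e r - E j 0 q\<bar> < h" using E_near[OF j(1) h(1)] by blast
  define \<delta> where "\<delta> = min (min \<delta>1 \<delta>2) (min e0 h)"
  have \<delta>: "0 < \<delta>" "\<delta> \<le> \<delta>1" "\<delta> \<le> \<delta>2" "\<delta> \<le> e0" "\<delta> \<le> h" using \<delta>1 \<delta>2 e0 h by (auto simp: \<delta>_def)
  have "(x < b \<longrightarrow> Te e x < b) \<and> (b < x \<longrightarrow> b < Te e x)" if e: "e \<in> {0<..<\<delta>}" and x: "\<bar>x - b\<bar> < \<delta>" for e x
  proof -
    interpret P: pw d "\<lambda>i. c i e" "\<lambda>i. E i e" "\<lambda>i. E' i e" lam K using pw e \<delta> by auto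
    interpret B: branch "c j e" "c (Suc j) e" "E j e" "E' j e" lam K by (rule P.br[OF j(1)])
    have ce: "\<bar>c j e - c j 0\<bar> < h" "\<bar>c (Suc j) e - c (Suc j) 0\<bar> < h" using \<delta>1(2)[of e] e \<delta> j(1) by auto
    have g: "z \<in> P.gap j" if "\<bar>z - b\<bar> \<le> h" for z
      unfolding P.gap_def using ce h(2,3) that by auto
    have bg: "b \<in> P.gap j" "x1 \<in> P.gap j" "x \<in> P.gap j" using g h(1) x \<delta>(5) by (auto simp: x1_def)
    have "b \<notin> crit d (\<lambda>i. c i e)" using P.gap_disj_crit[OF j(1)] bg(1) by (auto simp: crit_def)
    then have "T e b = b" using nc[OF False, of e] e b by (auto simp: mvals_def)
    then have Eb: "E j e b = b" using T_E[of e j b] bg(1) e \<delta> j(1) by (auto simp: P.gap_def)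
    have "\<bar>E j e x1 - E j 0 x1\<bar> < h"
      using \<delta>2(2)[rule_format, of e x1 x1] \<delta>2(1) e \<delta> bg(2) x1(1) by (auto simp: P.gap_def Z.gap_def)
    then have less: "E j e x1 < b" using E0x1 by linarith
    have I: "b \<in> {c j e..c (Suc j) e}" "x1 \<in> {c j e..c (Suc j) e}" "x \<in> {c j e..c (Suc j) e}" using bg by (auto simp: P.gap_def)
    have Tx: "Te e x = E j e x" unfolding Te_def by (rule P.Tm_gap[OF j(1) bg(3)])
    show ?thesis
    proof (cases rule: B.mono_cases)
      case inc
      have pos: "0 < lam * (z - y)" if "y < z" for y z using that Z.lam1 by simp
      show ?thesis using inc[OF I(1,3)] inc[OF I(3,1)] pos[of x b] pos[of b x] Eb Tx by auto
    next
      case dec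
      have "0 \<le> lam * (b - x1)" using x1 Z.lam1 by simp
      then show ?thesis using dec[OF I(2,1)] x1 less Eb by auto
    qed
  qed
  then show ?thesis using \<delta>(1) by blast
next
  case True
  then obtain j where j: "j \<le> d" "b = c j 0" by (auto simp: CC_def crit_def)
  have j0: "0 < j" "j < d"
  proof -
    show "0 < j" using j b Z.c0 by (cases j) auto
    show "j < d" using j b Z.cd by (cases "j = d") auto
  qed
  define i where "i = j - 1"
  have i: "i < d" "Suc i = j" using j0 by (auto simp: i_def)
  obtain y1 where y1: "y1 < b" "(T 0 \<longlongrightarrow> y1) (at_left b)" using cr[OF True] by blast
  obtain y2 where y2: "b < y2" "(T 0 \<longlongrightarrow> y2) (at_right b)" using cr[OF True] by blast
  have q1: "b \<in> {c i 0..c (Suc i) 0}" "c i 0 < b" using i j Z.c_less[OF i(1)] by auto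
  have q2: "b \<in> {c j 0..c (Suc j) 0}" "b < c (Suc j) 0" using j Z.c_less[OF j0(2)] by auto
  have "E i 0 b = y1" using tendsto_unique[OF _ mv_limits(2)[OF i(1) q1] y1(2)] by simp
  then have Eb1: "E i 0 b < b" using y1 by simp
  have "E j 0 b = y2" using tendsto_unique[OF _ mv_limits(1)[OF j0(2) q2] y2(2)] by simp
  then have Eb2: "b < E j 0 b" using y2 by simp
  have p1: "0 < b - E i 0 b" "0 < E j 0 b - b" using Eb1 Eb2 by auto
  obtain \<delta>1 where \<delta>1: "\<delta>1 > 0" "\<forall>e\<in>{0..<\<delta>1}. \<forall>r\<in>{c i e..c (Suc i) e}.
      \<forall>q\<in>{c i 0..c (Suc i) 0}. \<bar>r - q\<bar> < \<delta>1 \<longrightarrow> \<bar>E i e r - E i 0 q\<bar> < b - E i 0 b" using E_near[OF i(1) p1(1)] by blast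
  obtain \<delta>2 where \<delta>2: "\<delta>2 > 0" "\<forall>e\<in>{0..<\<delta>2}. \<forall>r\<in>{c j e..c (Suc j) e}.
      \<forall>q\<in>{c j 0..c (Suc j) 0}. \<bar>r - q\<bar> < \<delta>2 \<longrightarrow> \<bar>E j e r - E j 0 q\<bar> < E j 0 b - b" using E_near[OF j0(2) p1(2)] by blast
  obtain g where g: "g > 0" "\<And>e i. e \<in> {0..<g} \<Longrightarrow> i < d \<Longrightarrow> 2 * g \<le> c (Suc i) e - c i e" using small_evD[OF gaps_ev] by blast
  have "0 < g / 2" using g by simp
  then obtain \<delta>3 where \<delta>3: "\<delta>3 > 0" "\<And>e i. e \<in> {0..<\<delta>3} \<Longrightarrow> i \<le> d \<Longrightarrow> \<bar>c i e - c i 0\<bar> < g / 2" using c_near by blast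
  define \<delta> where "\<delta> = min (min \<delta>1 \<delta>2) (min (min e0 g) \<delta>3)"
  have \<delta>: "0 < \<delta>" "\<delta> \<le> \<delta>1" "\<delta> \<le> \<delta>2" "\<delta> \<le> e0" "\<delta> \<le> g" "\<delta> \<le> \<delta>3" using \<delta>1 \<delta>2 \<delta>3 e0 g by (auto simp: \<delta>_def)
  have "(x < b \<longrightarrow> Te e x < b) \<and> (b < x \<longrightarrow> b < Te e x)" if e: "e \<in> {0<..<\<delta>}" and x: "\<bar>x - b\<bar> < \<delta>" for e x
  proof -
    interpret P: pw d "\<lambda>i. c i e" "\<lambda>i. E i e" "\<lambda>i. E' i e" lam K using pw e \<delta> by auto
    have "b \<in> crit d (\<lambda>i. c i e)" using cr[OF True] e by auto
    then obtain k where k: "k \<le> d" "b = c k e" by (auto simp: crit_def)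
    have gs: "2 * g \<le> c (Suc i) e - c i e" if "i < d" for i using g(2)[OF _ that, of e] e \<delta> by auto
    have near: "\<bar>c j e - b\<bar> < g / 2" using \<delta>3(2)[of e j] e \<delta> j by auto
    \<comment> \<open>\<open>b\<close> is a critical point of the perturbed map, a priori with any
      index. The one with index \<open>j\<close> is within \<open>g / 2\<close> of \<open>b\<close>,
      and different ones are at least \<open>2 * g\<close> apart.\<close>
    have "k = j"
    proof (rule ccontr)
      assume "k \<noteq> j"
      then consider "k < j" | "j < k" by linarith
      then show False
      proof cases
        case 1
        then have "c (Suc k) e \<le> c j e" using P.c_mono[of "Suc k" j] j by auto
        then show False using gs[of k] 1 j near k g(1) by auto
      next
        case 2
        then have "c (Suc j) e \<le> c k e" using P.c_mono[of "Suc j" k] k by auto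
        then show False using gs[of j] 2 j j0 near k g(1) by auto
      qed
    qed
    then have bj: "c j e = b" using k by simp
    show ?thesis
    proof (intro conjI impI)
      assume "x < b"
      then have xg: "x \<in> P.gap i" using bj i gs[of i] x \<delta>(5) g(1) by (auto simp: P.gap_def)
      have "\<bar>E i e x - E i 0 b\<bar> < b - E i 0 b"
        using \<delta>1(2)[rule_format, of e x b] e \<delta> xg q1 x by (auto simp: P.gap_def)
      then show "Te e x < b" using P.Tm_gap[OF i(1) xg] by (simp add: Te_def)
    next
      assume "b < x"
      then have xg: "x \<in> P.gap j" using bj gs[of j] x \<delta>(5) g(1) j0 by (auto simp: P.gap_def)
      have "\<bar>E j e x - E j 0 b\<bar> < E j 0 b - b"
        using \<delta>2(2)[rule_format, of e x b] e \<delta> xg q2 x by (auto simp: P.gap_def)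
      then show "b < Te e x" using P.Tm_gap[OF j0(2) xg] by (simp add: Te_def)
    qed
  qed
  then show ?thesis using \<delta>(1) by blast
qed

text \<open>Near a hole both densities are almost constant and close in \<open>L\<^sup>1\<close>, hence uniformly
  close.\<close>

lemma hole_closeness:
  assumes q: "q \<in> holes b \<inter> S" "\<And>m. q \<notin> G m" and S: "closed S'" "S \<union> S' = {0..1}" "S \<inter> S' = {b}"
    and \<phi>: "good M B Dc Bm 0 \<phi>" "normalized_BV \<phi>" "0 < \<phi> q" "\<And>x. x \<notin> S \<Longrightarrow> \<phi> x = 0" and Bm: "0 \<le> Bm"
    and s: "\<And>n. 0 < s n" "s \<longlonglongrightarrow> 0" and f: "\<And>n. good M B Dc Bm (s n) (f n)"
    and lim: "(\<lambda>n. LINT x|lborel. \<bar>f n x - \<psi> x\<bar>) \<longlonglongrightarrow> 0" and \<psi>: "dens {0..1} \<psi>"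
    and \<psi>\<phi>: "AE x in lborel. x \<in> S \<longrightarrow> \<psi> x = \<alpha> * \<phi> x" and \<alpha>: "0 \<le> \<alpha>" "\<alpha> \<le> 1" and \<eta>: "0 < \<eta>"
  shows "\<exists>r>0. \<forall>\<^sub>F n in sequentially. AE x in lborel. x \<in> {q - r<..<q + r} \<longrightarrow> \<bar>f n x - \<alpha> * \<phi> x\<bar> \<le> \<eta> * \<phi> x"
proof -
  \<comment> \<open>The first entry is what the lower bound \<open>\<phi> q / 2\<close> near
    \<open>q\<close> requires; the second turns the absolute error \<open>3 * \<eta>1\<close> into
    one of at most \<open>\<eta> * \<phi> x\<close>.\<close>
  define \<eta>1 where "\<eta>1 = min (\<phi> q / 4) (\<eta> * \<phi> q / 6)"
  have \<eta>1: "0 < \<eta>1" "\<eta>1 \<le> \<phi> q / 4" "3 * \<eta>1 \<le> \<eta> * (\<phi> q / 2)" using \<phi>(3) \<eta> by (auto simp: \<eta>1_def)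
  obtain r0 where r0: "r0 > 0" "\<And>r. 0 < r \<Longrightarrow> r \<le> r0 \<Longrightarrow> \<exists>\<delta>>0. \<forall>e\<in>{0..<\<delta>}. \<forall>f. good M B Dc Bm e f \<longrightarrow> osc {q - r<..<q + r} \<eta>1 f"
    using local_osc[OF q(2) \<eta>1(1) Bm, where M = M and B = B and Dc = Dc] by blast
  have "q \<in> - S'" using q S(3) by (auto simp: holes_def)
  then obtain h where h: "h > 0" "ball q h \<subseteq> - S'" using S(1) by (meson open_Compl open_contains_ball)
  define r where "r = min r0 h"
  have r: "0 < r" "r \<le> r0" "r \<le> h" using r0 h by (auto simp: r_def)
  have U: "x \<notin> S'" if "x \<in> {q - r<..<q + r}" for x
  proof -
    have "x \<in> ball q h" using that r(3) by (auto simp: dist_real_def)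
    then show ?thesis using h(2) by blast
  qed
  obtain \<delta> where \<delta>: "\<delta> > 0" "\<And>e f. e \<in> {0..<\<delta>} \<Longrightarrow> good M B Dc Bm e f \<Longrightarrow> osc {q - r<..<q + r} \<eta>1 f"
    using r0(2)[OF r(1,2)] by blast
  have o: "osc {q - r<..<q + r} \<eta>1 \<phi>" using \<delta> \<phi>(1) by auto
  have q01: "q \<in> {0..1}" using q(1) S(2) by blast
  have low: "AE x in lborel. x \<in> {q - r<..<q + r} \<longrightarrow> \<phi> q / 2 \<le> \<phi> x"
    by (rule normalized_BV_lower[OF \<phi>(2) q01 \<phi>(3) o]) (use r \<eta>1 in auto)
  have \<psi>U: "AE x in lborel. x \<in> {q - r<..<q + r} \<longrightarrow> \<psi> x = \<alpha> * \<phi> x"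
    using \<psi>\<phi>
  proof eventually_elim
    case (elim x)
    show ?case
    proof
      assume "x \<in> {q - r<..<q + r}"
      then have "x \<notin> S'" by (rule U)
      then consider "x \<in> S" | "x \<notin> {0..1}" "x \<notin> S" using S(2) by blast
      then show "\<psi> x = \<alpha> * \<phi> x" using elim \<psi> \<phi>(4) by cases (auto simp: dens_def)
    qed
  qed
  have "0 < 2 * r * \<eta>1" using r \<eta>1 by simp
  from order_tendstoD(2)[OF lim this] order_tendstoD(2)[OF s(2) \<delta>(1)]
  have "\<forall>\<^sub>F n in sequentially. AE x in lborel. x \<in> {q - r<..<q + r} \<longrightarrow> \<bar>f n x - \<alpha> * \<phi> x\<bar> \<le> \<eta> * \<phi> x"
  proof eventually_elim
    case (elim n)
    have fi: "integrable lborel (f n)" using f[of n] by (auto simp: good_def tight_def dens_def)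
    have of: "osc {q - r<..<q + r} \<eta>1 (f n)" using \<delta>(2)[OF _ f[of n]] elim(2) s(1)[of n] by auto
    have "AE x in lborel. x \<in> {q - r<..<q + r} \<longrightarrow> \<bar>f n x - \<alpha> * \<phi> x\<bar> \<le> 3 * \<eta>1"
      by (rule local_closeness[OF fi of o integrable_dens[OF \<psi>] \<psi>U \<alpha>]) (use r \<eta>1 elim in auto)
    then show ?case using low
    proof eventually_elim
      case (elim x)
      show ?case
      proof
        assume x: "x \<in> {q - r<..<q + r}"
        have "\<eta> * (\<phi> q / 2) \<le> \<eta> * \<phi> x" using elim(2) x \<eta> by (intro mult_left_mono) auto
        then show "\<bar>f n x - \<alpha> * \<phi> x\<bar> \<le> \<eta> * \<phi> x" using elim(1) x \<eta>1(3) by linarith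
      qed
    qed
  qed
  then show ?thesis using r(1) by blast
qed

text \<open>For small parameters the hole is covered by the finitely many neighbourhoods in which
  the densities are compared; integrating the pointwise inequality yields an error relative to the
  mass of the hole, however small that is.\<close>

lemma hole_mass:
  assumes S: "compact S" "closed S'" "S \<union> S' = {0..1}" "S \<inter> S' = {b}"
    and mvS: "\<And>q. q \<in> S \<Longrightarrow> q \<noteq> b \<Longrightarrow> mv q \<subseteq> S"
    and nb: "\<exists>\<delta>>0. \<forall>e\<in>{0<..<\<delta>}. \<forall>x\<in>S. \<bar>x - b\<bar> < \<delta> \<longrightarrow> x \<noteq> b \<longrightarrow> x \<notin> (\<lambda>i. c i e) ` {..d} \<longrightarrow> Te e x \<notin> S'"
    and G: "\<And>q m. q \<in> holes b \<Longrightarrow> q \<notin> G m"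
    and \<phi>: "good M B Dc Bm 0 \<phi>" "normalized_BV \<phi>" "\<And>q. q \<in> holes b \<inter> S \<Longrightarrow> 0 < \<phi> q" "\<And>x. x \<notin> S \<Longrightarrow> \<phi> x = 0" and Bm: "0 \<le> Bm"
    and s: "\<And>n. 0 < s n" "\<And>n. s n < e0" "s \<longlonglongrightarrow> 0" and f: "\<And>n. good M B Dc Bm (s n) (f n)"
    and lim: "(\<lambda>n. LINT x|lborel. \<bar>f n x - \<psi> x\<bar>) \<longlonglongrightarrow> 0" and \<psi>: "dens {0..1} \<psi>"
    and \<psi>\<phi>: "AE x in lborel. x \<in> S \<longrightarrow> \<psi> x = \<alpha> * \<phi> x" and \<alpha>: "0 \<le> \<alpha>" "\<alpha> \<le> 1" and \<eta>: "0 < \<eta>"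
  shows "\<forall>\<^sub>F n in sequentially. \<bar>(LINT x|lborel. indicator (Hs b (s n) S S') x * f n x) -
      \<alpha> * (LINT x|lborel. indicator (Hs b (s n) S S') x * \<phi> x)\<bar> \<le> \<eta> * (LINT x|lborel. indicator (Hs b (s n) S S') x * \<phi> x)"
proof -
  have "\<forall>q\<in>holes b \<inter> S. \<exists>r>0. \<forall>\<^sub>F n in sequentially. AE x in lborel. x \<in> {q - r<..<q + r} \<longrightarrow> \<bar>f n x - \<alpha> * \<phi> x\<bar> \<le> \<eta> * \<phi> x"
  proof
    fix q assume q: "q \<in> holes b \<inter> S"
    have "q \<notin> G m" for m using q G by blast
    then show "\<exists>r>0. \<forall>\<^sub>F n in sequentially. AE x in lborel. x \<in> {q - r<..<q + r} \<longrightarrow> \<bar>f n x - \<alpha> * \<phi> x\<bar> \<le> \<eta> * \<phi> x"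
      by (rule hole_closeness[OF q _ S(2,3,4) \<phi>(1,2) \<phi>(3)[OF q] \<phi>(4) Bm s(1,3) f lim \<psi> \<psi>\<phi> \<alpha> \<eta>])
  qed
  from bchoice[OF this] obtain R where "\<forall>q\<in>holes b \<inter> S. 0 < R q \<and> (\<forall>\<^sub>F n in sequentially. AE x in lborel. x \<in> {q - R q<..<q + R q} \<longrightarrow> \<bar>f n x - \<alpha> * \<phi> x\<bar> \<le> \<eta> * \<phi> x)" ..
  then have R: "\<And>q. q \<in> holes b \<inter> S \<Longrightarrow> 0 < R q"
    "\<And>q. q \<in> holes b \<inter> S \<Longrightarrow> \<forall>\<^sub>F n in sequentially. AE x in lborel. x \<in> {q - R q<..<q + R q} \<longrightarrow> \<bar>f n x - \<alpha> * \<phi> x\<bar> \<le> \<eta> * \<phi> x"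
    by blast+
  have fin: "finite (holes b \<inter> S)" using holes_finite by blast
  define r where "r = Min (insert 1 (R ` (holes b \<inter> S)))"
  have r: "0 < r" "\<And>q. q \<in> holes b \<inter> S \<Longrightarrow> r \<le> R q" using fin R(1) by (auto simp: r_def)
  have S01: "S \<subseteq> {0..1}" using S(3) by blast
  obtain \<delta> where \<delta>: "\<delta> > 0" "\<And>x e. x \<in> S \<Longrightarrow> e \<in> {0<..<\<delta>} \<Longrightarrow> x \<in> Hs b e S S' \<Longrightarrow> \<exists>q\<in>holes b \<inter> S. \<bar>x - q\<bar> < r"
    using hole_near[OF S(1,2) S01 S(4) mvS nb r(1)] by blast
  have "\<forall>\<^sub>F n in sequentially. \<forall>q\<in>holes b \<inter> S. AE x in lborel. x \<in> {q - R q<..<q + R q} \<longrightarrow> \<bar>f n x - \<alpha> * \<phi> x\<bar> \<le> \<eta> * \<phi> x"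
    using R(2) by (intro eventually_ball_finite fin) auto
  then show ?thesis using order_tendstoD(2)[OF s(3) \<delta>(1)]
  proof eventually_elim
    case (elim n)
    let ?H = "Hs b (s n) S S'"
    have sn: "0 \<le> s n" "s n < e0" using s(1,2)[of n] by auto
    have H: "?H \<in> sets borel" using S(2) compact_imp_closed[OF S(1)] by (intro Hs_borel[OF sn] borel_closed)
    have fi: "integrable lborel (f n)" using f[of n] by (auto simp: good_def tight_def dens_def)
    have pi: "integrable lborel \<phi>" using \<phi>(1) by (auto simp: good_def tight_def dens_def)
    have "AE x in lborel. \<forall>q\<in>holes b \<inter> S. x \<in> {q - R q<..<q + R q} \<longrightarrow> \<bar>f n x - \<alpha> * \<phi> x\<bar> \<le> \<eta> * \<phi> x"
      using elim(1) fin by (subst AE_ball_countable) (auto intro: countable_finite)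
    then have ae: "AE x in lborel. \<bar>indicator ?H x * (f n x - \<alpha> * \<phi> x)\<bar> \<le> \<eta> * (indicator ?H x * \<phi> x)"
    proof eventually_elim
      case (elim x)
      show ?case
      proof (cases "x \<in> ?H")
        case True
        then obtain q where q: "q \<in> holes b \<inter> S" "\<bar>x - q\<bar> < r"
          using \<delta>(2)[of x "s n"] s(1)[of n] \<open>s n < \<delta>\<close> by (auto simp: Hs_def)
        then have "x \<in> {q - R q<..<q + R q}" using r(2)[OF q(1)] by auto
        then have "\<bar>f n x - \<alpha> * \<phi> x\<bar> \<le> \<eta> * \<phi> x" using elim q(1) by blast
        then show ?thesis using True by simp
      qed simp
    qed
    have "(LINT x|lborel. indicator ?H x * f n x) - \<alpha> * (LINT x|lborel. indicator ?H x * \<phi> x) =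
        (LINT x|lborel. indicator ?H x * f n x) - (LINT x|lborel. \<alpha> * (indicator ?H x * \<phi> x))" by simp
    also have "\<dots> = (LINT x|lborel. indicator ?H x * f n x - \<alpha> * (indicator ?H x * \<phi> x))"
      by (rule Bochner_Integration.integral_diff[symmetric]) (auto intro!: int_ind fi pi H)
    also have "\<dots> = (LINT x|lborel. indicator ?H x * (f n x - \<alpha> * \<phi> x))" by (simp add: algebra_simps)
    finally have eq: "(LINT x|lborel. indicator ?H x * f n x) - \<alpha> * (LINT x|lborel. indicator ?H x * \<phi> x) =
        (LINT x|lborel. indicator ?H x * (f n x - \<alpha> * \<phi> x))" .
    have "\<bar>LINT x|lborel. indicator ?H x * (f n x - \<alpha> * \<phi> x)\<bar> \<le> (LINT x|lborel. \<bar>indicator ?H x * (f n x - \<alpha> * \<phi> x)\<bar>)"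
      by (rule integral_abs_bound)
    also have "\<dots> \<le> (LINT x|lborel. \<eta> * (indicator ?H x * \<phi> x))"
      by (rule integral_mono_AE[OF _ _ ae]) (auto intro!: integrable_abs int_ind fi pi H)
    finally show ?case unfolding eq by simp
  qed
qed

end

subsection \<open>The ratio of the hole masses\<close>

context pw_family
begin

interpretation Z: pw d "\<lambda>i. c i 0" "\<lambda>i. E i 0" "\<lambda>i. E' i 0" lam K using pw e0 by simp

lemma Te_eq:
  assumes "0 \<le> e" "e < e0" "x \<in> {0..1}" "x \<notin> (\<lambda>i. c i e) ` {..d}"
  shows "Te e x = T e x" "mvals (crit d (\<lambda>i. c i e)) (T e) 0 1 x = {T e x}"
proof -
  interpret P: pw d "\<lambda>i. c i e" "\<lambda>i. E i e" "\<lambda>i. E' i e" lam K by (rule pw[OF assms(1,2)])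
  obtain i where i: "i < d" "x \<in> P.gap i" using P.gap_exists[OF assms(3,4)] by blast
  show "Te e x = T e x" using P.Tm_gap[OF i] T_E[OF assms(1,2) i(1)] i(2) by (simp add: Te_def P.gap_def)
  have "x \<noteq> 0" "x \<noteq> 1" using assms(4) P.c0 P.cd by (metis atMost_iff image_eqI le0, metis atMost_iff image_eqI order_refl)
  then show "mvals (crit d (\<lambda>i. c i e)) (T e) 0 1 x = {T e x}" using assms(4) by (simp add: mvals_def crit_def)
qed

text \<open>The hole given by the multivalued preimage and \<open>Hs\<close> differ by finitely many
  points.\<close>

lemma hole_measure:
  assumes e: "0 \<le> e" "e < e0" and S: "S \<in> sets borel" "S' \<in> sets borel" "S \<subseteq> {0..1}"
    and \<phi>: "dens S0 \<phi>" "\<mu> = density lborel (\<lambda>x. ennreal (\<phi> x))"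
  shows "measure \<mu> (S \<inter> mpreimage (crit d (\<lambda>i. c i e)) (T e) S') = (LINT x|lborel. indicator (Hs b e S S') x * \<phi> x)"
proof -
  let ?X = "S \<inter> mpreimage (crit d (\<lambda>i. c i e)) (T e) S'"
  let ?F = "insert b ((\<lambda>i. c i e) ` {..d})"
  have iff: "x \<in> ?X \<longleftrightarrow> x \<in> Hs b e S S'" if "x \<notin> ?F" for x
  proof (cases "x \<in> S")
    case True
    then have "x \<in> {0..1}" "x \<notin> (\<lambda>i. c i e) ` {..d}" using S that by auto
    from Te_eq[OF e this] this True that show ?thesis by (auto simp: Hs_def mpreimage_def)
  qed (simp add: Hs_def)
  have "?X = Hs b e S S' \<union> (?X \<inter> ?F)" using iff by (auto simp: Hs_def)
  moreover have "?X \<inter> ?F \<in> sets borel" by (intro borel_closed finite_imp_closed) auto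
  ultimately have X: "?X \<in> sets borel" using Hs_borel[OF e S(1,2), of b] by (metis sets.Un)
  note [measurable] = X Hs_borel[OF e S(1,2), of b] dens_measurable[OF \<phi>(1)]
  have "measure \<mu> ?X = (LINT x|lborel. indicator ?X x * \<phi> x)"
    unfolding \<phi>(2) measure_def dens_emeasure[OF \<phi>(1) X] using integral_le_1(1)[OF \<phi>(1) X] by simp
  also have "\<dots> = (LINT x|lborel. indicator (Hs b e S S') x * \<phi> x)"
  proof (rule integral_cong_AE)
    have "AE x in lborel. x \<notin> ?F" by (intro AE_not_in finite_imp_null_set_lborel) auto
    then show "AE x in lborel. indicator ?X x * \<phi> x = indicator (Hs b e S S') x * \<phi> x"
      by eventually_elim (use iff in \<open>simp add: indicator_def\<close>)
  qed measurable
  finally show ?thesis .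
qed

end

text \<open>\<open>A n\<close> is the mass passing through either hole, close to
  \<open>\<alpha> * L n\<close> and to \<open>(1 - \<alpha>) * R n\<close>. Dividing by
  \<open>L n\<close> and passing to the limit gives \<open>\<alpha> = (1 - \<alpha>) * lhr\<close>
  if \<open>lhr\<close> is finite, and forces \<open>\<alpha> = 1\<close> otherwise.\<close>

lemma ratio_limit:
  fixes L R A :: "nat \<Rightarrow> real" and \<alpha> :: real and lhr :: ereal
  assumes \<alpha>: "0 \<le> \<alpha>" "\<alpha> \<le> 1"
    and L: "\<forall>\<^sub>F n in sequentially. 0 < L n" and R: "\<And>n. 0 \<le> R n"
    and 1: "\<And>\<eta>. 0 < \<eta> \<Longrightarrow> \<forall>\<^sub>F n in sequentially. \<bar>A n - \<alpha> * L n\<bar> \<le> \<eta> * L n"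
    and 2: "\<And>\<eta>. 0 < \<eta> \<Longrightarrow> \<forall>\<^sub>F n in sequentially. \<bar>A n - (1 - \<alpha>) * R n\<bar> \<le> \<eta> * R n"
    and lim: "(\<lambda>n. ereal (R n / L n)) \<longlonglongrightarrow> lhr"
  shows "if lhr = \<infinity> then \<alpha> = 1 else \<alpha> < 1 \<and> ereal (\<alpha> / (1 - \<alpha>)) = lhr"
proof -
  have ev: "\<forall>\<^sub>F n in sequentially. (1 - \<alpha> - \<eta>) * (R n / L n) \<le> \<alpha> + \<eta> \<and> \<alpha> - \<eta> \<le> (1 - \<alpha> + \<eta>) * (R n / L n)"
    if "0 < \<eta>" for \<eta>
    using 1[OF that] 2[OF that] L
  proof eventually_elim
    case (elim n)
    have "(1 - \<alpha> - \<eta>) * R n \<le> (\<alpha> + \<eta>) * L n" "(\<alpha> - \<eta>) * L n \<le> (1 - \<alpha> + \<eta>) * R n"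
      using elim(1,2) unfolding left_diff_distrib distrib_right by linarith+
    then show ?case using elim(3) by (simp add: pos_divide_le_eq pos_le_divide_eq)
  qed
  show ?thesis
  proof (cases "lhr = \<infinity>")
    case True
    have "\<alpha> = 1"
    proof (rule ccontr)
      assume "\<alpha> \<noteq> 1"
      \<comment> \<open>With \<open>\<eta> = (1 - \<alpha>) / 2\<close> the first inequality of
        \<open>ev\<close> bounds \<open>R n / L n\<close>, against its divergence.\<close>
      then have p: "0 < (1 - \<alpha>) / 2" using \<alpha> by simp
      have "\<forall>\<^sub>F n in sequentially. ereal ((\<alpha> + 1) / ((1 - \<alpha>) / 2)) < ereal (R n / L n)"
        using lim unfolding True by (rule order_tendstoD) simp
      with ev[OF p] have "\<forall>\<^sub>F n in sequentially. False"
      proof eventually_elim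
        case (elim n)
        have le: "(1 - \<alpha>) / 2 * (R n / L n) \<le> \<alpha> + (1 - \<alpha>) / 2"
          using elim(1) by (simp add: field_simps)
        have "\<alpha> + 1 < (1 - \<alpha>) / 2 * (R n / L n)"
        proof -
          have "(\<alpha> + 1) / ((1 - \<alpha>) / 2) < R n / L n" using elim(2) by (simp only: less_ereal.simps)
          then have "\<alpha> + 1 < R n / L n * ((1 - \<alpha>) / 2)" by (subst (asm) pos_divide_less_eq[OF p])
          then show ?thesis by (simp only: mult.commute)
        qed
        from less_le_trans[OF this le] show False using \<alpha> by simp
      qed
      then show False by simp
    qed
    then show ?thesis using True by simp
  next
    case False
    have "\<forall>\<^sub>F n in sequentially. 0 \<le> ereal (R n / L n)"
      using L by eventually_elim (use R in \<open>simp add: divide_nonneg_pos\<close>)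
    then have "0 \<le> lhr" using lim by (intro tendsto_lowerbound[OF lim]) auto
    then obtain l where l: "lhr = ereal l" "0 \<le> l" using False by (cases lhr) auto
    have lim': "(\<lambda>n. R n / L n) \<longlonglongrightarrow> l" using lim unfolding l by simp
    have le: "(1 - \<alpha> - \<eta>) * l \<le> \<alpha> + \<eta>" "\<alpha> - \<eta> \<le> (1 - \<alpha> + \<eta>) * l" if "0 < \<eta>" for \<eta>
    proof -
      show "(1 - \<alpha> - \<eta>) * l \<le> \<alpha> + \<eta>"
        by (rule tendsto_upperbound[OF tendsto_mult_left[OF lim']]) (use ev[OF that] in \<open>auto elim: eventually_mono\<close>)
      show "\<alpha> - \<eta> \<le> (1 - \<alpha> + \<eta>) * l"
        by (rule tendsto_lowerbound[OF tendsto_mult_left[OF lim']]) (use ev[OF that] in \<open>auto elim: eventually_mono\<close>)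
    qed
    have a: "(1 - \<alpha>) * l \<le> \<alpha> + x" "\<alpha> \<le> (1 - \<alpha>) * l + x" if "0 < x" for x
    proof -
      \<comment> \<open>\<open>x / (1 + l)\<close> is the \<open>\<eta>\<close> for which the total
        error \<open>\<eta> + \<eta> * l\<close> equals \<open>x\<close>.\<close>
      have p: "0 < x / (1 + l)" using that l(2) by simp
      have "x / (1 + l) + x / (1 + l) * l = x / (1 + l) * (1 + l)" by (simp only: distrib_left mult_1_right)
      then have "x / (1 + l) + x / (1 + l) * l = x" using l(2) by simp
      then show "(1 - \<alpha>) * l \<le> \<alpha> + x" "\<alpha> \<le> (1 - \<alpha>) * l + x"
        using le[OF p] unfolding left_diff_distrib distrib_right by linarith+
    qed
    have eq: "(1 - \<alpha>) * l = \<alpha>"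
      by (rule antisym) (rule field_le_epsilon, use a in blast)+
    then have "\<alpha> \<noteq> 1" by auto
    then show ?thesis using False eq \<alpha> l by (simp add: field_simps)
  qed
qed

lemma ratio_determines:
  assumes "if lhr = \<infinity> then \<alpha> = 1 else \<alpha> < 1 \<and> ereal (\<alpha> / (1 - \<alpha>)) = lhr"
    and "if lhr = \<infinity> then \<beta> = 1 else \<beta> < 1 \<and> ereal (\<beta> / (1 - \<beta>)) = lhr"
  shows "\<alpha> = \<beta>"
proof (cases "lhr = \<infinity>")
  case False
  then have "\<alpha> < 1" "\<beta> < 1" "\<alpha> / (1 - \<alpha>) = \<beta> / (1 - \<beta>)" using assms by auto
  then show ?thesis by (simp add: field_simps)
qed (use assms in simp)

theorem theorem1:
  fixes T :: "real \<Rightarrow> real \<Rightarrow> real" and c :: "nat \<Rightarrow> real \<Rightarrow> real" and d :: nat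
    and C :: "real \<Rightarrow> real set" and b :: real and H0 :: "real set"
    and \<mu>l \<mu>r :: "real measure" and \<mu> :: "real \<Rightarrow> real measure"
    and \<phi>l \<phi>r :: "real \<Rightarrow> real" and \<phi> :: "real \<Rightarrow> real \<Rightarrow> real"
    and Hl Hr :: "real \<Rightarrow> real set" and lhr :: ereal
  defines "C \<equiv> \<lambda>\<epsilon>. crit d (\<lambda>i. c i \<epsilon>)"
    and "H0 \<equiv> inf_holes (C 0) (T 0) b"
    and "Hl \<equiv> \<lambda>\<epsilon>. {0..b} \<inter> mpreimage (C \<epsilon>) (T \<epsilon>) {b..1}"
    and "Hr \<equiv> \<lambda>\<epsilon>. {b..1} \<inter> mpreimage (C \<epsilon>) (T \<epsilon>) {0..b}"
  assumes T0: "piecewise_C2 d (\<lambda>i. c i 0) (T 0)"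
    and expanding: "min_expansion (C 0) (T 0) > 1"
    and b: "0 < b" "b < 1"
    and inv_l: "invariant_interval (C 0) (T 0) 0 b"
    and inv_r: "invariant_interval (C 0) (T 0) b 1"
    and I1_l: "\<exists>!\<nu>. acim (T 0) {0..b} \<nu>" "acim (T 0) {0..b} \<mu>l"
      "has_density \<mu>l {0..b} \<phi>l" "normalized_BV \<phi>l"
    and I1_r: "\<exists>!\<nu>. acim (T 0) {b..1} \<nu>" "acim (T 0) {b..1} \<mu>r"
      "has_density \<mu>r {b..1} \<phi>r" "normalized_BV \<phi>r"
    and I2: "\<And>k. k > 0 \<Longrightarrow> (mimage (C 0) (T 0) ^^ k) (C 0) \<inter> H0 = {}"
    and I3_l: "\<And>x. x \<in> H0 \<inter> {0..b} \<Longrightarrow> \<phi>l x > 0"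
    and I3_r: "\<And>x. x \<in> H0 \<inter> {b..1} \<Longrightarrow> \<phi>r x > 0"
    and I4: "min_expansion (C 0) (T 0) > 2 \<or>
      (\<forall>x\<in>C 0. periodic_point (C 0) (T 0) x \<longrightarrow>
         (x = 0 \<or> x = 1) \<and> x \<in> mvals (C 0) (T 0) 0 1 x)"
    and pert: "C2_small_perturbations d c T"
    and P1: "\<And>\<epsilon>. \<epsilon> > 0 \<Longrightarrow> \<exists>!\<nu>. acim (T \<epsilon>) {0..1} \<nu>"
      "\<And>\<epsilon>. \<epsilon> > 0 \<Longrightarrow> acim (T \<epsilon>) {0..1} (\<mu> \<epsilon>)"
      "\<And>\<epsilon>. \<epsilon> > 0 \<Longrightarrow> has_density (\<mu> \<epsilon>) {0..1} (\<phi> \<epsilon>)"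
    and P2_noncrit: "b \<notin> C 0 \<Longrightarrow> (\<And>\<epsilon>. \<epsilon> > 0 \<Longrightarrow> mvals (C \<epsilon>) (T \<epsilon>) 0 1 b = {b})"
    and P2_crit: "b \<in> C 0 \<Longrightarrow>
      (\<exists>y<b. (T 0 \<longlongrightarrow> y) (at_left b)) \<and> (\<exists>y>b. (T 0 \<longlongrightarrow> y) (at_right b)) \<and>
      (\<forall>\<epsilon>>0. b \<in> C \<epsilon>)"
    and Hl_pos: "\<forall>\<^sub>F \<epsilon> in at_right 0. measure \<mu>l (Hl \<epsilon>) > 0"
    and lhr: "((\<lambda>\<epsilon>. ereal (measure \<mu>r (Hr \<epsilon>) / measure \<mu>l (Hl \<epsilon>))) \<longlongrightarrow> lhr) (at_right 0)"
  shows "\<exists>\<alpha>\<in>{0..1}.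
    (if lhr = \<infinity> then \<alpha> = 1 else \<alpha> < 1 \<and> ereal (\<alpha> / (1 - \<alpha>)) = lhr) \<and>
    ((\<lambda>\<epsilon>. LINT x:{0..1}|lborel. \<bar>\<phi> \<epsilon> x - (\<alpha> * \<phi>l x + (1 - \<alpha>) * \<phi>r x)\<bar>) \<longlongrightarrow> 0) (at_right 0)"
proof -
  \<comment> \<open>The expansion that \<open>lam\<close> must exceed: 2 under the first alternative
    of (I4), so that the first alternative of \<open>potentials\<close> applies, and 1
    otherwise.\<close>
  define L0 :: real where "L0 = (if min_expansion (C 0) (T 0) > 2 then 2 else 1)"
  have "1 \<le> L0" "L0 < min_expansion (crit d (\<lambda>i. c i 0)) (T 0)" using expanding by (auto simp: L0_def C_def)
  from family_exists[OF T0 this pert] obtain E E' lam K e0 where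
    fam: "pw_family d c E E' lam K e0 T" and lam: "L0 < lam" by blast
  interpret pw_family d c E E' lam K e0 T by (rule fam)
  interpret Z: pw d "\<lambda>i. c i 0" "\<lambda>i. E i 0" "\<lambda>i. E' i 0" lam K using pw e0 by simp
  have C0: "C 0 = CC" by (simp add: C_def CC_def)
  have nonper: "2 < lam \<or> (\<forall>x\<in>Ci. \<forall>n>0. x \<notin> (Mv ^^ n) {x})"
  proof (cases "min_expansion (C 0) (T 0) > 2")
    case True
    then show ?thesis using lam by (simp add: L0_def)
  next
    case False
    have "x \<notin> (Mv ^^ n) {x}" if x: "x \<in> Ci" and n: "n > 0" for x n
    proof
      assume "x \<in> (Mv ^^ n) {x}"
      then have "x \<in> (mimage (C 0) (T 0) ^^ n) {x}" using Mv_mimage unfolding C0 by blast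
      then have per: "periodic_point (C 0) (T 0) x" using n unfolding periodic_point_def by blast
      obtain i where i: "x = c i 0" "0 < i" "i < d" using x by (auto simp: Ci_def)
      then have "x \<in> C 0" by (auto simp: C_def crit_def)
      \<comment> \<open>(I4) tolerates periodic critical points at 0 and 1 only, and an interior one
        is neither.\<close>
      then have "x = 0 \<or> x = 1" using I4 False per by blast
      then show False using i Z.c_strict[of 0 i] Z.c_strict[of i d] Z.c0 Z.cd by auto
    qed
    then show ?thesis by blast
  qed
  \<comment> \<open>The length of the shortest of the three intervals on which invariant densities
    are estimated.\<close>
  define w where "w = min b (1 - b)"
  have w: "0 < w" "w \<le> b - 0" "w \<le> 1 - b" "w \<le> 1 - 0" using b by (auto simp: w_def)
  obtain M B Dc Bm \<delta> where \<delta>: "0 < \<delta>" "\<delta> \<le> e0" and Bm: "0 \<le> Bm" and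
    good: "\<forall>e\<in>{0..<\<delta>}. \<forall>s t \<mu> \<phi>. 0 \<le> s \<longrightarrow> t \<le> 1 \<longrightarrow> w \<le> t - s \<longrightarrow>
      (\<forall>i<d. \<forall>x\<in>{s..t} \<inter> {c i e<..<c (Suc i) e}. E i e x \<in> {s..t}) \<longrightarrow>
     (\<exists>!\<nu>. acim (T e) {s..t} \<nu>) \<longrightarrow> acim (T e) {s..t} \<mu> \<longrightarrow> has_density \<mu> {s..t} \<phi> \<longrightarrow> good M B Dc Bm e \<phi>"
    using uniform_good[OF nonper w(1)] by (elim exE conjE)
  have b01: "0 \<le> b" "b \<le> 1" using b by auto
  note invl = inv_l[unfolded C0] and invr = inv_r[unfolded C0]
  have El: "E i 0 x \<in> {0..b}" if "i < d" "x \<in> Z.gap i" "x \<in> {0..b}" for i x using E_side(1)[OF b that(1,2) invl that(3)] .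
  have Er: "E i 0 x \<in> {b..1}" if "i < d" "x \<in> Z.gap i" "x \<in> {b..1}" for i x using E_side(2)[OF b that(1,2) invr that(3)] .
  have T0E: "T 0 x = E i 0 x" if "i < d" "x \<in> Z.gap i" for i x using T_E[of 0 i x] e0 that by (auto simp: Z.gap_def)
  have zero: "0 \<in> {0..<\<delta>}" using \<delta> by simp
  have gl: "good M B Dc Bm 0 \<phi>l"
    by (rule good[rule_format, OF zero order_refl b01(2) w(2) _ I1_l(1,2,3)]) (use El in \<open>auto simp: Z.gap_def\<close>)
  have gr: "good M B Dc Bm 0 \<phi>r"
    by (rule good[rule_format, OF zero b01(1) order_refl w(3) _ I1_r(1,2,3)]) (use Er in \<open>auto simp: Z.gap_def\<close>)
  have ge: "good M B Dc Bm e (\<phi> e)" "invd e (\<phi> e)" if e: "e \<in> {0<..<\<delta>}" for e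
  proof -
    interpret P: pw d "\<lambda>i. c i e" "\<lambda>i. E i e" "\<lambda>i. E' i e" lam K using pw e \<delta> by auto
    have e': "e \<in> {0..<\<delta>}" "e > 0" using e by auto
    show "good M B Dc Bm e (\<phi> e)"
      by (rule good[rule_format, OF e'(1) order_refl order_refl w(4) _ P1[OF e'(2)]]) (use P.range in auto)
    have TE: "T e x = E i e x" if "i < d" "x \<in> P.gap i" for i x using T_E[of e i x] e \<delta> that by (auto simp: P.gap_def)
    have S: "{0..1::real} \<in> sets borel" "{0..1::real} \<subseteq> {0..1}" by auto
    show "invd e (\<phi> e)" unfolding invd_def Te_def
      using P.acimD[OF S P1(2,3)[OF e'(2)] TE] by blast
  qed
  have fl: "dens {0..b} \<phi>l" and fr: "dens {b..1} \<phi>r"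
    using has_density_dens I1_l(2,3) I1_r(2,3) by (auto simp: acim_def)
  have hH0: "holes b \<subseteq> H0"
  proof
    fix q assume q: "q \<in> holes b"
    then have "q \<in> {0..1}" using holes_range by blast
    moreover have "b \<in> mvals CC (T 0) 0 1 q" using q mv_mvals by (auto simp: holes_def)
    ultimately show "q \<in> H0" using q unfolding H0_def inf_holes_def mpreimage_def C0 by (auto simp: holes_def)
  qed
  have hG: "q \<notin> G m" if q: "q \<in> holes b" for q m
  proof
    assume "q \<in> G m"
    then obtain j where j: "j \<ge> 1" "q \<in> (Mv ^^ j) ((\<lambda>i. c i 0) ` {..d})" unfolding G_def by auto
    then have "q \<in> (mimage (C 0) (T 0) ^^ j) (C 0)" using Mv_mimage[of j "C 0"] unfolding C0 by (auto simp: CC_def crit_def)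
    then show False using I2[of j] j(1) q hH0 by auto
  qed
  obtain \<delta>b where \<delta>b: "\<delta>b > 0" "\<forall>e\<in>{0<..<\<delta>b}. \<forall>x\<in>{0..1}. \<bar>x - b\<bar> < \<delta>b \<longrightarrow> x \<notin> (\<lambda>i. c i e) ` {..d} \<longrightarrow>
    (x < b \<longrightarrow> Te e x < b) \<and> (b < x \<longrightarrow> b < Te e x)"
    using near_b[OF b invl invr P2_noncrit[unfolded C_def, folded CC_def] P2_crit[unfolded C_def, folded CC_def]] by blast
  have Sl: "{0..b} \<in> sets borel" "{b..1} \<in> sets borel" "{0..b} \<union> {b..1} = {0..1}" "{0..b} \<inter> {b..1} = {b}"
    using b by auto
  have Sr: "{b..1} \<in> sets borel" "{0..b} \<in> sets borel" "{b..1} \<union> {0..b} = {0..1}" "{b..1} \<inter> {0..b} = {b}"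
    using b by auto
  have nbl: "\<exists>\<delta>>0. \<forall>e\<in>{0<..<\<delta>}. \<forall>x\<in>{0..b}. \<bar>x - b\<bar> < \<delta> \<longrightarrow> x \<noteq> b \<longrightarrow> x \<notin> (\<lambda>i. c i e) ` {..d} \<longrightarrow> Te e x \<notin> {b..1}"
  proof (intro exI[of _ \<delta>b] conjI \<delta>b(1) ballI impI)
    fix e x assume "e \<in> {0<..<\<delta>b}" "x \<in> {0..b}" "\<bar>x - b\<bar> < \<delta>b" "x \<noteq> b" "x \<notin> (\<lambda>i. c i e) ` {..d}"
    then show "Te e x \<notin> {b..1}" using \<delta>b(2)[rule_format, of e x] b by auto
  qed
  have nbr: "\<exists>\<delta>>0. \<forall>e\<in>{0<..<\<delta>}. \<forall>x\<in>{b..1}. \<bar>x - b\<bar> < \<delta> \<longrightarrow> x \<noteq> b \<longrightarrow> x \<notin> (\<lambda>i. c i e) ` {..d} \<longrightarrow> Te e x \<notin> {0..b}"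
  proof (intro exI[of _ \<delta>b] conjI \<delta>b(1) ballI impI)
    fix e x assume "e \<in> {0<..<\<delta>b}" "x \<in> {b..1}" "\<bar>x - b\<bar> < \<delta>b" "x \<noteq> b" "x \<notin> (\<lambda>i. c i e) ` {..d}"
    then show "Te e x \<notin> {0..b}" using \<delta>b(2)[rule_format, of e x] b by auto
  qed
  have mvl: "mv q \<subseteq> {0..b}" if "q \<in> {0..b}" "q \<noteq> b" for q using mv_side(1)[OF b invl, of q] that by auto
  have mvr: "mv q \<subseteq> {b..1}" if "q \<in> {b..1}" "q \<noteq> b" for q using mv_side(2)[OF b invr, of q] that by auto
  \<comment> \<open>Every L^1 limit along parameters tending to 0 is the claimed combination with
    the claimed weight; the weight is the mass that the limit gives to the left side.\<close>
  have key: "\<exists>\<alpha>. 0 \<le> \<alpha> \<and> \<alpha> \<le> 1 \<and> (if lhr = \<infinity> then \<alpha> = 1 else \<alpha> < 1 \<and> ereal (\<alpha> / (1 - \<alpha>)) = lhr) \<and>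
      (AE x in lborel. \<psi> x = \<alpha> * \<phi>l x + (1 - \<alpha>) * \<phi>r x)"
    if s: "\<And>n. s n \<in> {0<..<\<delta>}" "s \<longlonglongrightarrow> 0" and \<psi>: "dens {0..1} \<psi>"
      and lim: "(\<lambda>n. LINT x|lborel. \<bar>\<phi> (s n) x - \<psi> x\<bar>) \<longlonglongrightarrow> 0" for s \<psi>
  proof -
    have s': "0 < s n" "0 \<le> s n" "s n < e0" for n using s(1)[of n] \<delta>(2) by auto
    have inv\<psi>: "invd 0 \<psi>" by (rule limit_invariant[OF s'(2,3) s(2) ge(2)[OF s(1)] \<psi> lim])
    then have inv\<psi>': "\<And>A. A \<in> sets borel \<Longrightarrow> (LINT x|lborel. indicator A (Z.Tm x) * \<psi> x) = (LINT x|lborel. indicator A x * \<psi> x)"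
      unfolding invd_def Te_def by blast
    define \<alpha> where "\<alpha> = (LINT x|lborel. indicator {0..b} x * \<psi> x)"
    have \<alpha>: "0 \<le> \<alpha>" "\<alpha> \<le> 1" unfolding \<alpha>_def using integral_le_1[OF \<psi>, of "{0..b}"] by auto
    have \<alpha>': "(LINT x|lborel. indicator {b..1} x * \<psi> x) = 1 - \<alpha>"
    proof -
      have pi: "integrable lborel \<psi>" using \<psi> by (rule integrable_dens)
      note [measurable] = dens_measurable[OF \<psi>]
      have "\<alpha> + (LINT x|lborel. indicator {b..1} x * \<psi> x) = (LINT x|lborel. indicator {0..b} x * \<psi> x + indicator {b..1} x * \<psi> x)"
        unfolding \<alpha>_def by (rule Bochner_Integration.integral_add[symmetric]) (auto intro!: int_ind pi)
      also have "\<dots> = (LINT x|lborel. \<psi> x)"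
      proof (rule integral_cong_AE)
        have "AE x in lborel. x \<noteq> b" by (rule AE_lborel_singleton)
        then show "AE x in lborel. indicator {0..b} x * \<psi> x + indicator {b..1} x * \<psi> x = \<psi> x"
        proof eventually_elim
          case (elim x)
          show ?case
          proof (cases "x \<in> {0..1}")
            case True
            then show ?thesis using elim by (auto simp: indicator_def)
          qed (use \<psi> in \<open>simp add: dens_def\<close>)
        qed
      qed measurable
      also have "\<dots> = 1" using \<psi> by (simp add: dens_def)
      finally show ?thesis by simp
    qed
    have l: "AE x in lborel. x \<in> {0..b} \<longrightarrow> \<psi> x = \<alpha> * \<phi>l x"
      unfolding \<alpha>_def
      by (rule Z.side_density[OF Sl El Er T0E \<psi> inv\<psi>' I1_l(1,2,3)])
    have r: "AE x in lborel. x \<in> {b..1} \<longrightarrow> \<psi> x = (1 - \<alpha>) * \<phi>r x"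
      unfolding \<alpha>'[symmetric]
      by (rule Z.side_density[OF Sr Er El T0E \<psi> inv\<psi>' I1_r(1,2,3)])
    have ae: "AE x in lborel. \<psi> x = \<alpha> * \<phi>l x + (1 - \<alpha>) * \<phi>r x"
    proof -
      have "AE x in lborel. x \<noteq> b" by (rule AE_lborel_singleton)
      then show ?thesis using l r
      proof eventually_elim
        case (elim x)
        consider "x \<in> {0..b}" "x \<notin> {b..1}" | "x \<notin> {0..b}" "x \<in> {b..1}" | "x \<notin> {0..b}" "x \<notin> {b..1}" "x \<notin> {0..1}"
          using elim(1) by fastforce
        then show ?case using elim fl fr \<psi> by cases (auto simp: dens_def)
      qed
    qed
    define L where "L n = (LINT x|lborel. indicator (Hs b (s n) {0..b} {b..1}) x * \<phi>l x)" for n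
    define R where "R n = (LINT x|lborel. indicator (Hs b (s n) {b..1} {0..b}) x * \<phi>r x)" for n
    define A where "A n = (LINT x|lborel. indicator (Hs b (s n) {0..b} {b..1}) x * \<phi> (s n) x)" for n
    have L: "measure \<mu>l (Hl (s n)) = L n" for n
      unfolding Hl_def C_def L_def
      by (rule hole_measure[OF s'(2,3) _ _ _ fl]) (use I1_l(3) b in \<open>auto simp: has_density_def\<close>)
    have R: "measure \<mu>r (Hr (s n)) = R n" for n
      unfolding Hr_def C_def R_def
      by (rule hole_measure[OF s'(2,3) _ _ _ fr]) (use I1_r(3) b in \<open>auto simp: has_density_def\<close>)
    have A': "A n = (LINT x|lborel. indicator (Hs b (s n) {b..1} {0..b}) x * \<phi> (s n) x)" for n
      unfolding A_def by (rule balance[OF s'(2,3) ge(2)[OF s(1)] Sl])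
    have flt: "filterlim s (at_right 0) sequentially"
    proof -
      have "s n \<noteq> 0" for n using s'(1)[of n] by simp
      then show ?thesis unfolding filterlim_at using s(2) s'(1) by (auto intro!: always_eventually)
    qed
    have "if lhr = \<infinity> then \<alpha> = 1 else \<alpha> < 1 \<and> ereal (\<alpha> / (1 - \<alpha>)) = lhr"
    proof (rule ratio_limit[OF \<alpha>, where L = L and R = R and A = A])
      show "\<forall>\<^sub>F n in sequentially. 0 < L n"
        using eventually_compose_filterlim[OF Hl_pos flt] by (simp add: L)
      show "0 \<le> R n" for n unfolding R[symmetric] by simp
      show "(\<lambda>n. ereal (R n / L n)) \<longlonglongrightarrow> lhr"
        using filterlim_compose[OF lhr flt] by (simp add: L R)
      fix \<eta> :: real assume \<eta>: "0 < \<eta>"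
      have I3l': "0 < \<phi>l q" if "q \<in> holes b \<inter> {0..b}" for q using I3_l[of q] that hH0 by blast
      have I3r': "0 < \<phi>r q" if "q \<in> holes b \<inter> {b..1}" for q using I3_r[of q] that hH0 by blast
      have outl: "\<phi>l x = 0" if "x \<notin> {0..b}" for x using fl that by (simp add: dens_def)
      have outr: "\<phi>r x = 0" if "x \<notin> {b..1}" for x using fr that by (simp add: dens_def)
      show "\<forall>\<^sub>F n in sequentially. \<bar>A n - \<alpha> * L n\<bar> \<le> \<eta> * L n"
        unfolding A_def L_def
        by (rule hole_mass[OF compact_Icc closed_atLeastAtMost Sl(3,4) mvl nbl hG gl I1_l(4) I3l' outl Bm s'(1,3) s(2) ge(1)[OF s(1)] lim \<psi> l \<alpha> \<eta>])
      have \<alpha>2: "0 \<le> 1 - \<alpha>" "1 - \<alpha> \<le> 1" using \<alpha> by auto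
      show "\<forall>\<^sub>F n in sequentially. \<bar>A n - (1 - \<alpha>) * R n\<bar> \<le> \<eta> * R n"
        unfolding A' R_def
        by (rule hole_mass[OF compact_Icc closed_atLeastAtMost Sr(3,4) mvr nbr hG gr I1_r(4) I3r' outr Bm s'(1,3) s(2) ge(1)[OF s(1)] lim \<psi> r \<alpha>2 \<eta>])
    qed
    then show ?thesis using \<alpha> ae by blast
  qed
  have sub: "\<exists>k \<psi>. strict_mono (k :: nat \<Rightarrow> nat) \<and> dens {0..1} \<psi> \<and> (\<lambda>n. LINT x|lborel. \<bar>\<phi> (s (k n)) x - \<psi> x\<bar>) \<longlonglongrightarrow> 0"
    if s: "\<And>n. s n \<in> {0<..<\<delta>}" for s
  proof -
    have "tight M B (\<phi> (s n))" for n using ge(1)[OF s] by (simp add: good_def)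
    moreover have "dens {0..1} (\<phi> (s n))" for n using ge(2)[OF s] by (simp add: invd_def)
    ultimately obtain k :: "nat \<Rightarrow> nat" and \<psi> where "strict_mono k" "dens {0..1} \<psi>" "(\<lambda>n. LINT x|lborel. \<bar>\<phi> (s (k n)) x - \<psi> x\<bar>) \<longlonglongrightarrow> 0"
      by (rule tight_subseq[of M B "\<lambda>n. \<phi> (s n)" "{0..1}"]) auto
    then show ?thesis by blast
  qed
  \<comment> \<open>The weight is taken from the limit along one sequence; since the ratio
    determines it, all other limits have the same weight.\<close>
  have "\<exists>\<alpha>. 0 \<le> \<alpha> \<and> \<alpha> \<le> 1 \<and> (if lhr = \<infinity> then \<alpha> = 1 else \<alpha> < 1 \<and> ereal (\<alpha> / (1 - \<alpha>)) = lhr)"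
  proof -
    define s where "s n = \<delta> / real (Suc (Suc n))" for n
    have s: "s n \<in> {0<..<\<delta>}" for n using \<delta>(1) by (simp add: s_def divide_less_eq)
    have "(\<lambda>n. \<delta> / real (Suc (Suc n))) \<longlonglongrightarrow> 0"
      using LIMSEQ_Suc[OF LIMSEQ_Suc[OF lim_const_over_n[of \<delta>]]] .
    then have s0: "s \<longlonglongrightarrow> 0" by (simp add: s_def[abs_def])
    from sub[of s, OF s] obtain k \<psi> where k: "strict_mono (k :: nat \<Rightarrow> nat)" "dens {0..1} \<psi>" "(\<lambda>n. LINT x|lborel. \<bar>\<phi> (s (k n)) x - \<psi> x\<bar>) \<longlonglongrightarrow> 0" by blast
    have "(\<lambda>n. s (k n)) \<longlonglongrightarrow> 0" using LIMSEQ_subseq_LIMSEQ[OF s0 k(1)] by (simp add: comp_def)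
    from key[of "\<lambda>n. s (k n)", OF s this k(2,3)] show ?thesis by blast
  qed
  then obtain \<alpha> where \<alpha>: "0 \<le> \<alpha>" "\<alpha> \<le> 1" "if lhr = \<infinity> then \<alpha> = 1 else \<alpha> < 1 \<and> ereal (\<alpha> / (1 - \<alpha>)) = lhr" by blast
  let ?g = "\<lambda>x. \<alpha> * \<phi>l x + (1 - \<alpha>) * \<phi>r x"
  have set_eq: "(LINT x:{0..1}|lborel. \<bar>\<phi> e x - ?g x\<bar>) = (LINT x|lborel. \<bar>\<phi> e x - ?g x\<bar>)" if "e \<in> {0<..<\<delta>}" for e
    unfolding set_lebesgue_integral_def
  proof (rule Bochner_Integration.integral_cong[OF refl])
    fix x
    have "\<phi> e x = 0 \<and> \<phi>l x = 0 \<and> \<phi>r x = 0" if "x \<notin> {0..1}"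
      using that ge(2)[OF \<open>e \<in> _\<close>] fl fr b by (auto simp: invd_def dens_def)
    then show "indicat_real {0..1} x *\<^sub>R \<bar>\<phi> e x - ?g x\<bar> = \<bar>\<phi> e x - ?g x\<bar>"
      by (cases "x \<in> {0..1}") simp_all
  qed
  have "((\<lambda>e. LINT x:{0..1}|lborel. \<bar>\<phi> e x - ?g x\<bar>) \<longlongrightarrow> 0) (at_right 0)"
  proof (rule tendsto_at_right_sequentially[OF \<delta>(1)])
    fix s :: "nat \<Rightarrow> real" assume s: "\<And>n. 0 < s n" "\<And>n. s n < \<delta>" "s \<longlonglongrightarrow> 0"
    have s\<delta>: "s n \<in> {0<..<\<delta>}" for n using s by simp
    let ?X = "\<lambda>n. LINT x|lborel. \<bar>\<phi> (s n) x - ?g x\<bar>"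
    have "?X \<longlonglongrightarrow> 0"
    \<comment> \<open>A subsequence bounded away from the claimed limit would have a convergent
      subsequence, whose limit must be the claimed one.\<close>
    proof (rule ccontr)
      assume "\<not> ?X \<longlonglongrightarrow> 0"
      then obtain \<eta> where \<eta>: "\<eta> > 0" "\<not> (\<forall>\<^sub>F n in sequentially. dist (?X n) 0 < \<eta>)" unfolding tendsto_iff by blast
      from not_eventually_sequentiallyD[OF this(2)] obtain r :: "nat \<Rightarrow> nat" where
        r: "strict_mono r" "\<And>n. \<not> dist (?X (r n)) 0 < \<eta>" by blast
      from sub[of "\<lambda>n. s (r n)", OF s\<delta>] obtain k \<psi> where k: "strict_mono (k :: nat \<Rightarrow> nat)" "dens {0..1} \<psi>"
        "(\<lambda>n. LINT x|lborel. \<bar>\<phi> (s (r (k n))) x - \<psi> x\<bar>) \<longlonglongrightarrow> 0" by blast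
      have "(\<lambda>n. s (r (k n))) \<longlonglongrightarrow> 0"
        using LIMSEQ_subseq_LIMSEQ[OF LIMSEQ_subseq_LIMSEQ[OF s(3) r(1)] k(1)] by (simp add: comp_def)
      from key[of "\<lambda>n. s (r (k n))", OF s\<delta> this k(2,3)] obtain \<beta> where
        \<beta>: "if lhr = \<infinity> then \<beta> = 1 else \<beta> < 1 \<and> ereal (\<beta> / (1 - \<beta>)) = lhr"
        "AE x in lborel. \<psi> x = \<beta> * \<phi>l x + (1 - \<beta>) * \<phi>r x" by blast
      have "\<beta> = \<alpha>" by (rule ratio_determines[OF \<beta>(1) \<alpha>(3)])
      then have ae: "AE x in lborel. \<psi> x = ?g x" using \<beta>(2) by simp
      have "(LINT x|lborel. \<bar>\<phi> (s (r (k n))) x - \<psi> x\<bar>) = ?X (r (k n))" for n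
      proof (rule integral_cong_AE)
        have d: "dens {0..1} (\<phi> (s (r (k n))))" using ge(2)[OF s\<delta>] by (simp add: invd_def)
        note [measurable] = dens_measurable[OF d] dens_measurable[OF k(2)] dens_measurable[OF fl] dens_measurable[OF fr]
        show "(\<lambda>x. \<bar>\<phi> (s (r (k n))) x - \<psi> x\<bar>) \<in> borel_measurable lborel" by measurable
        show "(\<lambda>x. \<bar>\<phi> (s (r (k n))) x - ?g x\<bar>) \<in> borel_measurable lborel" by measurable
        show "AE x in lborel. \<bar>\<phi> (s (r (k n))) x - \<psi> x\<bar> = \<bar>\<phi> (s (r (k n))) x - ?g x\<bar>"
          using ae by eventually_elim simp
      qed
      then have "(\<lambda>n. ?X (r (k n))) \<longlonglongrightarrow> 0" using k(3) by simp
      then have "\<forall>\<^sub>F n in sequentially. dist (?X (r (k n))) 0 < \<eta>" using \<eta>(1) unfolding tendsto_iff by blast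
      then show False using r(2) by simp
    qed
    then show "(\<lambda>n. LINT x:{0..1}|lborel. \<bar>\<phi> (s n) x - ?g x\<bar>) \<longlonglongrightarrow> 0" using set_eq[OF s\<delta>] by simp
  qed
  then show ?thesis using \<alpha> by (intro bexI[of _ \<alpha>]) auto
qed

end
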